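(* Let $\Delta\subset\mathbb{R}^n$ be an $n$-dimensional lattice polytope (vertices in $\mathbb{Z}^n$) with exactly $n+2$ vertices. Then the upper bound $n!\operatorname{Vol}(\Delta)$ on the number of connected components of the complement of the closed coamoeba $\overline{\mathcal{A}'}(f)$ in $\mathbf{T}^n$, valid for Laurent polynomials $f$ with Newton polytope $\Delta_f=\Delta$, is attained for maximally sparse polynomials with generic coefficients. That is, with $A$ the set of vertices of $\Delta$, for generic $c\in(\mathbb{C}^* )^A$ the polynomial $f(z)=\sum_{\alpha\in A}c_\alpha z^\alpha$ is such that the complement of $\overline{\mathcal{A}'}(f)$ in $\mathbf{T}^n$ has exactly $n!\operatorname{Vol}(\Delta)$ connected components.
   Context: The Newton polytope of $f(z)=\sum_{\alpha\in A}c_\alpha z^\alpha$ (all $c_\alpha\ne0$) is $\Delta_f=\operatorname{Conv}(A)$; $f$ is maximally sparse if $A$ equals the set of vertices of $\Delta_f$. $\operatorname{Vol}$ is Euclidean volume in $\mathbb{R}^n$. $\mathbf{T}^n=(\mathbb{R}/2\pi\mathbb{Z})^n$. The coamoeba $\mathcal{A}'(f)\subset\mathbf{T}^n$ is the image of the zero locus $V(f)\subset(\mathbb{C}^* )^n$ under $\operatorname{Arg}(z)=(\arg z_1,\dots,\arg z_n)$, and $\overline{\mathcal{A}'}(f)$ is its closure. "For generic $c$" means: for all $c$ in some open dense subset of $(\mathbb{C}^* )^A$. It is a previously known result that the number of connected components of the complement of $\overline{\mathcal{A}'}(f)$ in $\mathbf{T}^n$ is at most $n!\operatorname{Vol}(\Delta_f)$.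 *)

theory Defs
  imports "HOL-Analysis.Analysis"
begin

text \<open>The circle \<open>\<real>/2\<pi>\<int>\<close> with the quotient topology. The torus is \<open>circle ^ 'n\<close>, whose topology
  is the product topology of the library's instance for \<open>vec\<close>.\<close>

definition angle_eq :: "real \<Rightarrow> real \<Rightarrow> bool" where
  "angle_eq s t \<longleftrightarrow> (\<exists>k::int. s - t = 2 * pi * of_int k)"

lemma equivp_angle_eq: "equivp angle_eq"
proof (rule equivpI)
  show "reflp angle_eq"
    unfolding reflp_def angle_eq_def by (auto intro: exI[of _ 0])
  show "symp angle_eq"
  proof (rule sympI)
    fix s t assume "angle_eq s t"
    then obtain k :: int where "s - t = 2 * pi * of_int k"
      unfolding angle_eq_def by blast
    then have "t - s = 2 * pi * of_int (- k)" by simp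
    then show "angle_eq t s" unfolding angle_eq_def by blast
  qed
  show "transp angle_eq"
  proof (rule transpI)
    fix s t u assume "angle_eq s t" "angle_eq t u"
    then obtain k l :: int where "s - t = 2 * pi * of_int k" "t - u = 2 * pi * of_int l"
      unfolding angle_eq_def by blast
    then have "s - u = 2 * pi * of_int (k + l)" by (simp add: algebra_simps)
    then show "angle_eq s u" unfolding angle_eq_def by blast
  qed
qed

quotient_type circle = real / angle_eq
  by (rule equivp_angle_eq)

instantiation circle :: topological_space
begin

definition open_circle :: "circle set \<Rightarrow> bool" where
  "open_circle U \<longleftrightarrow> open (abs_circle -` U)"

instance
  by standard (auto simp: open_circle_def vimage_Int vimage_Union intro: open_Int open_UN)

end

definition Arg_vec :: "complex ^ 'n \<Rightarrow> circle ^ 'n" where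
  "Arg_vec z = (\<chi> i. abs_circle (Arg (z $ i)))"

definition of_int_vec :: "int ^ 'n \<Rightarrow> real ^ 'n" where
  "of_int_vec \<alpha> = (\<chi> i. of_int (\<alpha> $ i))"

definition vertices :: "(real ^ 'n) set \<Rightarrow> (real ^ 'n) set" where
  "vertices P = {v. v extreme_point_of P}"

definition lattice_polytope :: "(real ^ 'n) set \<Rightarrow> bool" where
  "lattice_polytope P \<longleftrightarrow> polytope P \<and> vertices P \<subseteq> range of_int_vec"

text \<open>A Laurent polynomial is given by its finite support \<open>A\<close> and coefficients \<open>c\<close>, nonzero on \<open>A\<close>;
  values of \<open>c\<close> outside \<open>A\<close> are irrelevant.\<close>

definition laurent_poly :: "(int ^ 'n) set \<Rightarrow> (int ^ 'n \<Rightarrow> complex) \<Rightarrow> complex ^ 'n \<Rightarrow> complex" where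
  "laurent_poly A c z = (\<Sum>\<alpha>\<in>A. c \<alpha> * (\<Prod>i\<in>UNIV. (z $ i) powi (\<alpha> $ i)))"

definition newton_polytope :: "(int ^ 'n) set \<Rightarrow> (real ^ 'n) set" where
  "newton_polytope A = convex hull (of_int_vec ` A)"

definition maximally_sparse :: "(int ^ 'n) set \<Rightarrow> bool" where
  "maximally_sparse A \<longleftrightarrow> of_int_vec ` A = vertices (newton_polytope A)"

lemma newton_polytope_vertices:
  fixes \<Delta> :: "(real ^ 'n) set"
  assumes "lattice_polytope \<Delta>" and "of_int_vec ` A = vertices \<Delta>"
  shows "newton_polytope A = \<Delta>" and "maximally_sparse A"
proof -
  have "compact \<Delta>" "convex \<Delta>"
    using assms(1) by (auto simp: lattice_polytope_def polytope_imp_compact polytope_imp_convex)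
  then show "newton_polytope A = \<Delta>"
    using Krein_Milman_Minkowski[of \<Delta>] assms(2) by (simp add: newton_polytope_def vertices_def)
  then show "maximally_sparse A"
    using assms(2) by (simp add: maximally_sparse_def)
qed

definition zero_locus :: "(complex ^ 'n \<Rightarrow> complex) \<Rightarrow> (complex ^ 'n) set" where
  "zero_locus f = {z. (\<forall>i. z $ i \<noteq> 0) \<and> f z = 0}"

definition coamoeba :: "(complex ^ 'n \<Rightarrow> complex) \<Rightarrow> (circle ^ 'n) set" where
  "coamoeba f = Arg_vec ` zero_locus f"

text \<open>The space \<open>(\<complex>\<^sup>*)\<^sup>A\<close>; its points are functions that are \<open>undefined\<close> outside \<open>A\<close>.\<close>

definition coeff_space :: "'a set \<Rightarrow> ('a \<Rightarrow> complex) topology" where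
  "coeff_space A = product_topology (\<lambda>_. top_of_set (- {0})) A"

definition generically :: "'a set \<Rightarrow> (('a \<Rightarrow> complex) \<Rightarrow> bool) \<Rightarrow> bool" where
  "generically A P \<longleftrightarrow>
    (\<exists>U. openin (coeff_space A) U \<and> coeff_space A closure_of U = topspace (coeff_space A) \<and>
      (\<forall>c\<in>U. P c))"

end

(* At a point theta of the torus the terms of f have fixed phases w_alpha, and theta is the argument
   of a zero of f iff there is a positive relation sum p_alpha w_alpha = 0 with prod p_alpha^b_alpha
   equal to a constant, where b is the unique affine relation among the n + 2 exponents. If an
   exponent with b_alpha > 0 and one with b_alpha < 0 can each be dropped from such a relation, the
   constant is attained by the intermediate value theorem; and if the two terms of an edge of the
   polytope are opposite, theta lies in the closed coamoeba. Hence the complement of the closed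
   coamoeba is covered by disjoint open polyhedral cells, indexed by the lifts of the phases to the
   reals. Inside a cell it can be joined by translations to the lopsided part, where all w_alpha lie
   in a half plane. That part is convex, and it is nonempty iff sum b_alpha (lifted phase of alpha)
   lies in an interval of length 2 pi sum_{b_alpha > 0} b_alpha. Modulo the lattice, a subinterval of
   length 2 pi b_alpha contains n! Vol(conv(A - {alpha})) classes of lifts, and for b_alpha > 0 these
   simplices triangulate the polytope. *)

theory Submission imports Defs begin

section \<open>The torus\<close>

text \<open>In Gale dual terms a pair of vertices spans an edge exactly when \<open>b\<close> takes
  both signs off the pair. No vertex is a convex combination of the others, so \<open>b\<close> has
  at least two entries of each sign, and a pair can fail to be an edge only if it consists of all
  exponents of one sign. Such a diagonal is the main obstacle: its two terms may become opposite
  away from the closed coamoeba, so a component can be larger than its lopsided part. Closing the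
  angle of the diagonal without meeting a zero rests on a monotonicity estimate for logarithms of
  sines. The coefficients enter the count only through \<open>sum b Arg c\<close>. A lift is
  admissible when its integer weight lies in an open interval whose length is the sum of the
  positive \<open>b\<close>; genericity keeps the ends of the interval off the integers, where it
  could contain fewer weights than the half-open windows that are counted. The relation is taken
  integral to make weights integers; a multiple of it scales weights and windows alike. The factor
  \<open>n!\<close> comes from the volume of a simplex, \<open>\<bar>det\<bar> / n!\<close>, where
  the determinant is a lattice index.\<close>

definition torus_proj :: "real ^ 'n \<Rightarrow> circle ^ 'n" where
  "torus_proj \<theta> = (\<chi> i. abs_circle (\<theta> $ i))"

lemma abs_circle_eq_iff: "abs_circle s = abs_circle t \<longleftrightarrow> (\<exists>k::int. s - t = 2 * pi * of_int k)"
  by (simp add: circle.abs_eq_iff angle_eq_def)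

lemma torus_proj_eq_iff:
  "torus_proj \<theta> = torus_proj \<phi> \<longleftrightarrow> (\<exists>t. \<theta> = \<phi> + (2 * pi) *\<^sub>R of_int_vec t)"
proof
  assume "torus_proj \<theta> = torus_proj \<phi>"
  then have "\<forall>i. \<exists>k::int. \<theta> $ i - \<phi> $ i = 2 * pi * of_int k"
    by (simp add: torus_proj_def vec_eq_iff abs_circle_eq_iff)
  then obtain k :: "'a \<Rightarrow> int" where "\<And>i. \<theta> $ i - \<phi> $ i = 2 * pi * of_int (k i)" by metis
  then have "\<theta> = \<phi> + (2 * pi) *\<^sub>R of_int_vec (\<chi> i. k i)"
    by (simp add: vec_eq_iff of_int_vec_def algebra_simps)
  then show "\<exists>t. \<theta> = \<phi> + (2 * pi) *\<^sub>R of_int_vec t" ..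
next
  assume "\<exists>t. \<theta> = \<phi> + (2 * pi) *\<^sub>R of_int_vec t"
  then show "torus_proj \<theta> = torus_proj \<phi>"
    by (auto simp: torus_proj_def vec_eq_iff abs_circle_eq_iff of_int_vec_def)
qed

lemma surj_abs_circle: "\<exists>s. x = abs_circle s"
  by (induction x) auto

lemma surj_torus_proj: "surj torus_proj"
proof -
  have "\<exists>\<theta>. x = torus_proj \<theta>" for x :: "circle ^ 'a"
  proof -
    have "\<forall>i. \<exists>s. x $ i = abs_circle s" using surj_abs_circle by blast
    then obtain s where "\<And>i. x $ i = abs_circle (s i)" by metis
    then have "x = torus_proj (\<chi> i. s i)" by (simp add: torus_proj_def vec_eq_iff)
    then show ?thesis ..
  qed
  then show ?thesis by (auto simp: surj_def)
qed

text \<open>The saturation of \<open>V\<close> is the union of its translates by multiples of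
  \<open>2 * pi\<close>, hence open.\<close>

lemma open_abs_circle_image:
  assumes "open V" shows "open (abs_circle ` V)"
proof -
  have "abs_circle -` (abs_circle ` V) = (\<Union>k::int. (+) (2 * pi * of_int k) ` V)"
  proof (intro set_eqI iffI)
    fix s assume "s \<in> abs_circle -` (abs_circle ` V)"
    then obtain t where t: "t \<in> V" "abs_circle s = abs_circle t" by auto
    then obtain k :: int where "s - t = 2 * pi * of_int k" by (auto simp: abs_circle_eq_iff)
    then have "s = 2 * pi * of_int k + t" by simp
    with t show "s \<in> (\<Union>k::int. (+) (2 * pi * of_int k) ` V)" by blast
  next
    fix s assume "s \<in> (\<Union>k::int. (+) (2 * pi * of_int k) ` V)"
    then obtain k :: int and t where "t \<in> V" "s = 2 * pi * of_int k + t" by auto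
    then have "t \<in> V" "abs_circle s = abs_circle t" by (auto simp: abs_circle_eq_iff)
    then show "s \<in> abs_circle -` (abs_circle ` V)" by auto
  qed
  then show ?thesis
    using assms by (auto simp: open_circle_def intro: open_translation)
qed

lemma open_torus_proj_image:
  assumes "open V" shows "open (torus_proj ` V)"
  unfolding open_vec_def
proof
  fix x assume "x \<in> torus_proj ` V"
  then obtain \<theta> where \<theta>: "\<theta> \<in> V" "x = torus_proj \<theta>" by auto
  with assms obtain S where S: "\<And>i. open (S i)" "\<And>i. \<theta> $ i \<in> S i" "\<And>y. (\<And>i. y $ i \<in> S i) \<Longrightarrow> y \<in> V"
    unfolding open_vec_def by metis
  have "y \<in> torus_proj ` V" if y: "\<And>i. y $ i \<in> abs_circle ` S i" for y
  proof -
    have "\<forall>i. \<exists>s. s \<in> S i \<and> y $ i = abs_circle s" using y by blast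
    then obtain s where s: "\<And>i. s i \<in> S i" "\<And>i. y $ i = abs_circle (s i)" by metis
    then have "y = torus_proj (\<chi> i. s i)" "(\<chi> i. s i) \<in> V"
      by (auto simp: torus_proj_def vec_eq_iff intro: S(3))
    then show ?thesis by blast
  qed
  then show "\<exists>T. (\<forall>i. open (T i) \<and> x $ i \<in> T i) \<and> (\<forall>y. (\<forall>i. y $ i \<in> T i) \<longrightarrow> y \<in> torus_proj ` V)"
    using S \<theta> by (intro exI[of _ "\<lambda>i. abs_circle ` S i"]) (auto simp: open_abs_circle_image torus_proj_def)
qed

lemma open_torus_proj_vimage:
  assumes "open U" shows "open (torus_proj -` U)"
  unfolding open_vec_def
proof
  fix \<theta> assume "\<theta> \<in> torus_proj -` U"
  then have "torus_proj \<theta> \<in> U" by simp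
  with assms obtain S where S: "\<And>i. open (S i)" "\<And>i. torus_proj \<theta> $ i \<in> S i" "\<And>y. (\<And>i. y $ i \<in> S i) \<Longrightarrow> y \<in> U"
    unfolding open_vec_def by metis
  then show "\<exists>T. (\<forall>i. open (T i) \<and> \<theta> $ i \<in> T i) \<and> (\<forall>y. (\<forall>i. y $ i \<in> T i) \<longrightarrow> y \<in> torus_proj -` U)"
    by (intro exI[of _ "\<lambda>i. abs_circle -` S i"])
      (auto simp: open_circle_def[symmetric] torus_proj_def)
qed

lemma continuous_torus_proj: "continuous_on S torus_proj"
  by (rule continuous_on_subset[of UNIV])
    (auto simp: continuous_on_open_vimage open_torus_proj_vimage)

text \<open>Openness of the covering map gives the first inclusion, continuity the second. The
  closed coamoeba can thus be studied on the universal cover.\<close>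

lemma torus_proj_vimage_closure:
  "torus_proj -` closure X = closure (torus_proj -` X)"
proof
  show "torus_proj -` closure X \<subseteq> closure (torus_proj -` X)"
  proof
    fix \<theta> assume \<theta>: "\<theta> \<in> torus_proj -` closure X"
    show "\<theta> \<in> closure (torus_proj -` X)"
    proof (rule ccontr)
      define V where "V = - closure (torus_proj -` X)"
      assume "\<theta> \<notin> closure (torus_proj -` X)"
      then have 1: "torus_proj \<theta> \<in> torus_proj ` V" by (simp add: V_def)
      have 2: "torus_proj ` V \<inter> X = {}"
        using closure_subset[of "torus_proj -` X"] by (auto simp: V_def)
      have "open V" by (simp add: V_def open_Compl)
      then have "torus_proj ` V \<inter> closure X = {}"
        using 2 open_Int_closure_eq_empty[OF open_torus_proj_image] by blast
      with 1 \<theta> show False by auto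
    qed
  qed
  have "closed (torus_proj -` closure X)"
    unfolding closed_def vimage_Compl[symmetric] by (intro open_torus_proj_vimage open_Compl closed_closure)
  then show "closure (torus_proj -` X) \<subseteq> torus_proj -` closure X"
    by (rule closure_minimal[rotated]) (rule vimage_mono[OF closure_subset])
qed

text \<open>The union of the other members is open as well, so a connected set that meets
  \<open>C\<close> cannot leave it.\<close>

lemma components_open_partition:
  fixes X :: "'a::topological_space set"
  assumes "\<Union>\<C> = X"
    and "\<And>C. C \<in> \<C> \<Longrightarrow> open C" "\<And>C. C \<in> \<C> \<Longrightarrow> connected C" "\<And>C. C \<in> \<C> \<Longrightarrow> C \<noteq> {}"
    and disj: "\<And>C D. C \<in> \<C> \<Longrightarrow> D \<in> \<C> \<Longrightarrow> C \<inter> D \<noteq> {} \<Longrightarrow> C = D"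
  shows "components X = \<C>"
proof -
  have comp: "connected_component_set X x = C" if "C \<in> \<C>" "x \<in> C" for C x
  proof (rule connected_component_unique)
    show "x \<in> C" "C \<subseteq> X" "connected C" using that assms by auto
    fix D assume D: "x \<in> D" "D \<subseteq> X" "connected D"
    show "D \<subseteq> C"
    proof (rule ccontr)
      assume "\<not> D \<subseteq> C"
      then obtain y where y: "y \<in> D" "y \<notin> C" by auto
      define E where "E = \<Union>(\<C> - {C})"
      have "open E" "open C" using assms(2) that by (auto simp: E_def)
      moreover have "D \<subseteq> C \<union> E" using D assms(1) by (auto simp: E_def)
      moreover have "C \<inter> E = {}" using disj[OF that(1)] by (auto simp: E_def)
      moreover have "x \<in> C \<inter> D" using that D by auto
      moreover have "y \<in> E \<inter> D" using y \<open>D \<subseteq> C \<union> E\<close> by auto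
      ultimately show False
        using D(3) unfolding connected_def by blast
    qed
  qed
  show ?thesis
  proof (intro equalityI subsetI)
    fix C assume "C \<in> components X"
    then obtain x where "x \<in> X" "C = connected_component_set X x" by (auto simp: components_def)
    then show "C \<in> \<C>" using comp assms(1) by auto
  next
    fix C assume C: "C \<in> \<C>"
    then obtain x where "x \<in> C" using assms(4) by blast
    with C comp[of C x] assms(1) show "C \<in> components X" by (auto simp: components_def)
  qed
qed

section \<open>Cosets of an integer lattice and the volume of a simplex\<close>

text \<open>A coset of the column lattice of the integer matrix with rows
  \<open>u k\<close>.\<close>

definition lattice_coset :: "('m \<Rightarrow> int ^ 'n) \<Rightarrow> ('m \<Rightarrow> int) \<Rightarrow> ('m \<Rightarrow> int) set" where
  "lattice_coset u v = {w. \<exists>t. \<forall>k. w k - v k = (\<Sum>j\<in>UNIV. u k $ j * t $ j)}"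

lemma lattice_coset_self: "v \<in> lattice_coset u v"
  by (auto simp: lattice_coset_def intro: exI[of _ 0])

lemma lattice_coset_eq_iff: "lattice_coset u v = lattice_coset u w \<longleftrightarrow> w \<in> lattice_coset u v"
proof
  assume "lattice_coset u v = lattice_coset u w"
  then show "w \<in> lattice_coset u v" by (simp add: lattice_coset_self)
next
  assume "w \<in> lattice_coset u v"
  then obtain t where t: "\<And>k. w k - v k = (\<Sum>j\<in>UNIV. u k $ j * t $ j)" by (auto simp: lattice_coset_def)
  have "x \<in> lattice_coset u v \<longleftrightarrow> x \<in> lattice_coset u w" for x
  proof
    assume "x \<in> lattice_coset u v"
    then obtain s where s: "\<And>k. x k - v k = (\<Sum>j\<in>UNIV. u k $ j * s $ j)" by (auto simp: lattice_coset_def)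
    have "x k - w k = (\<Sum>j\<in>UNIV. u k $ j * (s - t) $ j)" for k
      using s[of k] t[of k] by (simp add: right_diff_distrib sum_subtractf)
    then show "x \<in> lattice_coset u w" unfolding lattice_coset_def by blast
  next
    assume "x \<in> lattice_coset u w"
    then obtain s where s: "\<And>k. x k - w k = (\<Sum>j\<in>UNIV. u k $ j * s $ j)" by (auto simp: lattice_coset_def)
    have "x k - v k = (\<Sum>j\<in>UNIV. u k $ j * (s + t) $ j)" for k
      using s[of k] t[of k] by (simp add: distrib_left sum.distrib)
    then show "x \<in> lattice_coset u v" unfolding lattice_coset_def by blast
  qed
  then show "lattice_coset u v = lattice_coset u w" by blast
qed

text \<open>Used to pass from components to classes of lifts, and from these to lattice cosets,
  although the values have different types.\<close>

lemma card_image_cong_kernel: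
  assumes "\<And>x y. x \<in> M \<Longrightarrow> y \<in> M \<Longrightarrow> f x = f y \<longleftrightarrow> g x = g y"
  shows "card (f ` M) = card (g ` M)"
proof (rule bij_betw_same_card)
  show "bij_betw (\<lambda>C. g (inv_into M f C)) (f ` M) (g ` M)"
  proof (rule bij_betw_imageI)
    show "inj_on (\<lambda>C. g (inv_into M f C)) (f ` M)"
      by (rule inj_onI) (metis assms f_inv_into_f inv_into_into)
    have "g (inv_into M f (f x)) = g x" if "x \<in> M" for x
      using that assms by (meson f_inv_into_f image_eqI inv_into_into)
    then show "(\<lambda>C. g (inv_into M f C)) ` f ` M = g ` M" by (simp add: image_image)
  qed
qed

lemma finite_int_box: "finite {v :: 'n::finite \<Rightarrow> int. \<forall>i. \<bar>v i\<bar> \<le> M}"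
proof (rule finite_subset)
  show "{v :: 'n \<Rightarrow> int. \<forall>i. \<bar>v i\<bar> \<le> M} \<subseteq> (UNIV \<rightarrow>\<^sub>E {- M..M})" by (auto simp: abs_le_iff minus_le_iff)
  show "finite (UNIV \<rightarrow>\<^sub>E {- M..M} :: ('n \<Rightarrow> int) set)" by (intro finite_PiE) auto
qed

section \<open>Fundamental domains: the index of an integer lattice as a determinant\<close>

definition unit_cube :: "(real ^ 'n) set" where
  "unit_cube = {x. \<forall>i. 0 \<le> x $ i \<and> x $ i < 1}"

lemma unit_cube_shift: "\<exists>!t::'n \<Rightarrow> int. (x :: real ^ 'n) - (\<chi> i. of_int (t i)) \<in> unit_cube"
proof (rule ex1I[of _ "\<lambda>i. \<lfloor>x $ i\<rfloor>"])
  show "x - (\<chi> i. of_int \<lfloor>x $ i\<rfloor>) \<in> unit_cube"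
    by (auto simp: unit_cube_def) linarith+
  fix t :: "'n \<Rightarrow> int" assume "x - (\<chi> i. of_int (t i)) \<in> unit_cube"
  then have "0 \<le> x $ i - of_int (t i)" "x $ i - of_int (t i) < 1" for i by (auto simp: unit_cube_def)
  then have "\<lfloor>x $ i\<rfloor> = t i" for i by (intro floor_unique) (simp_all add: algebra_simps)
  then show "t = (\<lambda>i. \<lfloor>x $ i\<rfloor>)" by simp
qed

lemma unit_cube_shift_unique:
  fixes x :: "real ^ 'n"
  assumes "x - (\<chi> i. of_int (s i)) \<in> unit_cube" "x - (\<chi> i. of_int (t i)) \<in> unit_cube"
  shows "s = t"
  using ex1_implies_ex[OF unit_cube_shift[of x]] assms unit_cube_shift[of x] by metis

lemma bounded_unit_cube: "bounded (unit_cube :: (real ^ 'n) set)"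
  by (rule bounded_subset[OF bounded_cbox[of 0 1]])
    (auto simp: unit_cube_def mem_box_cart less_imp_le)

lemma lmeasurable_unit_cube: "(unit_cube :: (real ^ 'n) set) \<in> lmeasurable"
proof (rule bounded_set_imp_lmeasurable)
  have "(unit_cube :: (real ^ 'n) set) = (\<Inter>i. {x. 0 \<le> x $ i} \<inter> {x. x $ i < 1})"
    by (auto simp: unit_cube_def)
  also have "\<dots> \<in> sets borel"
    by (intro sets.finite_INT sets.Int borel_closed borel_open closed_Collect_le open_Collect_less
        continuous_intros) auto
  finally show "(unit_cube :: (real ^ 'n) set) \<in> sets lebesgue" by simp
qed (rule bounded_unit_cube)

lemma measure_unit_cube_pos: "measure lebesgue (unit_cube :: (real ^ 'n) set) > 0"
proof -
  have "box 0 1 \<subseteq> (unit_cube :: (real ^ 'n) set)"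
    by (auto simp: unit_cube_def mem_box_cart less_imp_le)
  moreover have "box 0 1 \<noteq> ({} :: (real ^ 'n) set)"
    by (auto simp: set_eq_iff mem_box_cart intro!: exI[of _ "\<chi> i. 1 / 2"])
  ultimately have "\<not> negligible (unit_cube :: (real ^ 'n) set)"
    using open_not_negligible[OF open_box] negligible_subset by blast
  then have "measure lebesgue (unit_cube :: (real ^ 'n) set) \<noteq> 0"
    using negligible_iff_measure lmeasurable_unit_cube by blast
  then show ?thesis by (simp add: zero_less_measure_iff)
qed

text \<open>Both the unit cube, translated by representatives of the cosets, and its image under the
  matrix with rows \<open>u k\<close> are fundamental domains for the column lattice of that matrix.\<close>

lemma card_lattice_cosets_det:
  fixes u :: "'n::{finite,wellorder} \<Rightarrow> int ^ 'n::_"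
  defines "D \<equiv> (\<chi> k j. of_int (u k $ j)) :: real ^ 'n::_ ^ 'n::_"
  assumes "det D \<noteq> 0"
  shows "real (card (range (lattice_coset u))) = \<bar>det D\<bar>"
proof -
  define r :: "('n \<Rightarrow> int) \<Rightarrow> real ^ 'n::_" where "r v = (\<chi> i. of_int (v i))" for v
  have r_diff: "r v - r w = r (\<lambda>k. v k - w k)" for v w by (simp add: r_def vec_eq_iff)
  have r_inj: "v = w" if "r v = r w" for v w using that by (auto simp: r_def vec_eq_iff)
  have D_int: "D *v r t = r (\<lambda>k. \<Sum>j\<in>UNIV. u k $ j * t j)" for t
    by (simp add: D_def r_def matrix_vector_mult_def vec_eq_iff)
  have coset: "w \<in> lattice_coset u v \<longleftrightarrow> (\<exists>t. r w - r v = D *v r t)" for v w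
  proof
    assume "w \<in> lattice_coset u v"
    then obtain t where "\<And>k. w k - v k = (\<Sum>j\<in>UNIV. u k $ j * t $ j)" by (auto simp: lattice_coset_def)
    then show "\<exists>t. r w - r v = D *v r t" by (intro exI[of _ "\<lambda>j. t $ j"]) (simp add: r_diff D_int)
  next
    assume "\<exists>t. r w - r v = D *v r t"
    then obtain t where "r w - r v = D *v r t" ..
    then have "(\<lambda>k. w k - v k) = (\<lambda>k. \<Sum>j\<in>UNIV. u k $ j * t j)" by (metis r_diff D_int r_inj)
    then show "w \<in> lattice_coset u v"
      by (auto simp: lattice_coset_def fun_eq_iff intro!: exI[of _ "\<chi> j. t j"])
  qed
  obtain D' where D': "D ** D' = mat 1" "D' ** D = mat 1"
    using assms(2) invertible_det_nz[of D] unfolding invertible_def by blast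
  have D'D: "D' *v (D *v x) = x" "D *v (D' *v x) = x" for x
    by (simp_all add: D' matrix_vector_mul_assoc)
  define P where "P = (*v) D ` unit_cube"
  \<comment> \<open>The integer points that translation by \<open>x\<close> brings into
    \<open>P\<close>. They represent every coset exactly once, so their number does not depend on
    \<open>x\<close>.\<close>
  define N where "N x = {v. x + r v \<in> P}" for x
  have bij: "bij_betw (lattice_coset u) (N x) (range (lattice_coset u))" for x
  proof (rule bij_betw_imageI)
    show "inj_on (lattice_coset u) (N x)"
    proof (rule inj_onI)
      fix v w assume v: "v \<in> N x" and w: "w \<in> N x" and eq: "lattice_coset u v = lattice_coset u w"
      obtain p q where p: "p \<in> unit_cube" "x + r v = D *v p" and q: "q \<in> unit_cube" "x + r w = D *v q"
        using v w by (auto simp: N_def P_def)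
      obtain t where "r w - r v = D *v r t" using eq by (auto simp: lattice_coset_eq_iff coset)
      then have "D *v q - D *v p = D *v r t" using p(2) q(2) by (metis add_diff_cancel_left)
      then have "D *v (q - p) = D *v r t" by (simp add: matrix_vector_mult_diff_distrib)
      then have "q - p = r t" by (metis D'D(1))
      then have "q - r t = p" by (simp add: algebra_simps)
      then have "q - r t \<in> unit_cube" "q - r (\<lambda>_. 0) \<in> unit_cube"
        using p q by (auto simp: r_def zero_vec_def[symmetric])
      then have "t = (\<lambda>_. 0)" unfolding r_def by (rule unit_cube_shift_unique)
      then have "p = q" using \<open>q - r t = p\<close> by (simp add: r_def zero_vec_def[symmetric])
      then have "r v = r w" using p(2) q(2) by (metis add_left_cancel)
      then show "v = w" by (rule r_inj)
    qed
    show "lattice_coset u ` N x = range (lattice_coset u)"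
    proof (intro equalityI subsetI)
      fix C assume "C \<in> range (lattice_coset u)"
      then obtain w where w: "C = lattice_coset u w" by auto
      obtain t where t: "D' *v (x + r w) - r t \<in> unit_cube"
        using unit_cube_shift[of "D' *v (x + r w)"] unfolding r_def by blast
      define v where "v = (\<lambda>k. w k - (\<Sum>j\<in>UNIV. u k $ j * t j))"
      have rv: "r v = r w - D *v r t" by (simp add: v_def r_diff D_int)
      have "x + r v = D *v (D' *v (x + r w) - r t)"
        by (simp add: matrix_vector_mult_diff_distrib D'D rv)
      then have "v \<in> N x" using t by (auto simp: N_def P_def)
      have "w \<in> lattice_coset u v" unfolding coset rv by (rule exI[of _ t]) simp
      then have "lattice_coset u v = C" by (simp add: w lattice_coset_eq_iff)
      with \<open>v \<in> N x\<close> show "C \<in> lattice_coset u ` N x" by blast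
    qed auto
  qed
  define K where "K = card (range (lattice_coset u))"
  have cardN: "card (N x) = K" for x using bij_betw_same_card[OF bij] by (simp add: K_def)
  have "bounded P"
    unfolding P_def by (rule bounded_linear_image[OF bounded_unit_cube]) (rule matrix_vector_mul_bounded_linear)
  then obtain B where B: "\<And>p. p \<in> P \<Longrightarrow> norm p \<le> B" by (auto simp: bounded_iff)
  \<comment> \<open>A finite range for the integer translations; the \<open>+ 1\<close> accounts for
    the coordinates of \<open>x\<close>, which lie in [0, 1).\<close>
  define V where "V = {v :: 'n \<Rightarrow> int. \<forall>i. \<bar>v i\<bar> \<le> \<lceil>B\<rceil> + 1}"
  have finV: "finite V" unfolding V_def by (rule finite_int_box)
  have NV: "N x \<subseteq> V" if "x \<in> unit_cube" for x
  proof
    fix v assume "v \<in> N x"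
    then have "norm (x + r v) \<le> B" using B by (auto simp: N_def)
    then have "\<bar>v i\<bar> \<le> \<lceil>B\<rceil> + 1" for i
    proof -
      have "\<bar>x $ i + of_int (v i)\<bar> \<le> B"
        using component_le_norm_cart[of "x + r v" i] \<open>norm (x + r v) \<le> B\<close> by (simp add: r_def)
      moreover have "0 \<le> x $ i" "x $ i < 1" using that by (auto simp: unit_cube_def)
      moreover have "B \<le> of_int \<lceil>B\<rceil>" by simp
      ultimately have "of_int \<bar>v i\<bar> \<le> (of_int (\<lceil>B\<rceil> + 1) :: real)" unfolding of_int_abs of_int_add of_int_1 by linarith
      then show ?thesis by (simp only: of_int_le_iff)
    qed
    then show "v \<in> V" by (simp add: V_def)
  qed
  have Qm: "(unit_cube :: (real ^ 'n::_) set) \<in> lmeasurable" by (rule lmeasurable_unit_cube)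
  have Pm: "P \<in> lmeasurable" unfolding P_def by (intro measurable_linear_image Qm) simp
  \<comment> \<open>\<open>P\<close> is cut along the integer translates of the cube. Once the
    pieces are moved back, a point \<open>x\<close> of the cube is covered once for each element of
    \<open>N x\<close>, hence \<open>K\<close> times.\<close>
  define S where "S v = P \<inter> (+) (r v) ` unit_cube" for v
  have Sm: "S v \<in> lmeasurable" for v
    unfolding S_def by (intro fmeasurable.Int Pm measurable_translation Qm)
  have "P = \<Union>(S ` V)"
  proof (intro equalityI subsetI)
    fix p assume p: "p \<in> P"
    obtain v where v: "p - r v \<in> unit_cube" using unit_cube_shift[of p] unfolding r_def by blast
    then have "v \<in> N (p - r v)" using p by (auto simp: N_def)
    then have "v \<in> V" using NV[OF v] by blast
    moreover have "p \<in> (+) (r v) ` unit_cube" using v by (intro image_eqI[of _ _ "p - r v"]) auto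
    ultimately show "p \<in> \<Union>(S ` V)" using p by (auto simp: S_def)
  qed (auto simp: S_def)
  then have "measure lebesgue P = measure lebesgue (\<Union>(S ` V))" by simp
  also have "\<dots> = (\<Sum>v\<in>V. measure lebesgue (S v))"
  proof (rule measure_negligible_finite_Union_image[OF finV Sm])
    have "S v \<inter> S w = {}" if "v \<noteq> w" for v w
    proof (rule ccontr)
      assume "S v \<inter> S w \<noteq> {}"
      then obtain p q where pq: "p \<in> unit_cube" "q \<in> unit_cube" "r v + p = r w + q" by (auto simp: S_def)
      have "(r v + p) - r v \<in> unit_cube" using pq(1) by simp
      moreover have "(r v + p) - r w \<in> unit_cube" using pq(2,3) by simp
      ultimately have "v = w" unfolding r_def by (rule unit_cube_shift_unique)
      with that show False by simp
    qed
    then show "pairwise (\<lambda>v w. negligible (S v \<inter> S w)) V" by (auto simp: pairwise_def)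
  qed
  also have "\<dots> = (\<Sum>v\<in>V. measure lebesgue ((+) (- r v) ` S v))"
    by (intro sum.cong refl measure_translation[symmetric])
  also have "\<dots> = (\<Sum>v\<in>V. integral UNIV (indicator ((+) (- r v) ` S v)))"
    by (intro sum.cong refl lmeasure_integral_UNIV measurable_translation Sm)
  also have "\<dots> = integral UNIV (\<lambda>x. \<Sum>v\<in>V. indicator ((+) (- r v) ` S v) x)"
    by (rule integral_sum[OF finV, symmetric])
      (use measurable_translation[OF Sm] in \<open>simp only: integrable_on_indicator Int_UNIV_right\<close>)
  also have "(\<lambda>x. \<Sum>v\<in>V. indicator ((+) (- r v) ` S v) x) = (\<lambda>x. real K * indicator unit_cube x)"
  proof
    fix x :: "real ^ 'n::_"
    have mem: "x \<in> (+) (- r v) ` S v \<longleftrightarrow> x \<in> unit_cube \<and> v \<in> N x" for v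
    proof
      assume "x \<in> (+) (- r v) ` S v"
      then show "x \<in> unit_cube \<and> v \<in> N x" by (auto simp: S_def N_def add.commute)
    next
      assume "x \<in> unit_cube \<and> v \<in> N x"
      then show "x \<in> (+) (- r v) ` S v"
        by (intro image_eqI[of _ _ "r v + x"]) (auto simp: S_def N_def add.commute)
    qed
    have ind: "indicator ((+) (- r v) ` S v) x = (indicator unit_cube x * indicator (N x) v :: real)" for v
      unfolding indicator_def mem by simp
    have "(\<Sum>v\<in>V. indicator ((+) (- r v) ` S v) x) = indicator unit_cube x * (\<Sum>v\<in>V. indicator (N x) v :: real)"
      by (simp only: ind sum_distrib_left)
    also have "\<dots> = real K * indicator unit_cube x"
    proof (cases "x \<in> unit_cube")
      case True
      have "(\<Sum>v\<in>V. indicator (N x) v :: real) = real (card (N x))"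
        using finV NV[OF True] by (simp add: indicator_def sum.If_cases Int_absorb1)
      then show ?thesis by (simp add: cardN)
    qed simp
    finally show "(\<Sum>v\<in>V. indicator ((+) (- r v) ` S v) x) = real K * indicator unit_cube x" .
  qed
  also have "integral UNIV (\<lambda>x :: real ^ 'n::_. real K * indicator unit_cube x) = real K * measure lebesgue (unit_cube :: (real ^ 'n::_) set)"
    by (simp add: lmeasure_integral_UNIV Qm)
  finally have "measure lebesgue P = real K * measure lebesgue (unit_cube :: (real ^ 'n::_) set)" .
  moreover have "measure lebesgue P = \<bar>det D\<bar> * measure lebesgue (unit_cube :: (real ^ 'n::_) set)"
    unfolding P_def
    using measure_lebesgue_linear_transformation[of unit_cube "(*v) D"] bounded_unit_cube Qm
    by (simp add: fmeasurableD)
  ultimately show ?thesis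
    using measure_unit_cube_pos[where 'n="'n::_"] by (simp add: K_def)
qed

text \<open>The determinant formulas of the library are stated for well-ordered index types only;
  \<open>'n ranked\<close> is a copy of an arbitrary finite type carrying such an order.\<close>

typedef 'n ranked = "UNIV :: 'n set" by simp

definition rank_of :: "'n::finite \<Rightarrow> nat" where
  "rank_of = (SOME f. inj f)"

lemma inj_rank_of: "inj (rank_of :: 'n::finite \<Rightarrow> nat)"
proof -
  have "\<exists>f :: 'n \<Rightarrow> nat. inj f"
    using finite_imp_inj_to_nat_seg[of "UNIV :: 'n set"] by auto
  then show ?thesis unfolding rank_of_def by (rule someI_ex)
qed

instantiation ranked :: (finite) "{finite,wellorder}"
begin

definition "x \<le> y \<longleftrightarrow> rank_of (Rep_ranked x) \<le> rank_of (Rep_ranked y)"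
definition "x < y \<longleftrightarrow> rank_of (Rep_ranked x) < rank_of (Rep_ranked y)"

instance
proof
  fix x y :: "'a ranked"
  assume "x \<le> y" "y \<le> x"
  then have "rank_of (Rep_ranked x) = rank_of (Rep_ranked y)" by (simp add: less_eq_ranked_def)
  then show "x = y" by (simp add: inj_rank_of[THEN inj_eq] Rep_ranked_inject)
next
  fix P :: "'a ranked \<Rightarrow> bool" and x
  assume *: "\<And>x. (\<And>y. y < x \<Longrightarrow> P y) \<Longrightarrow> P x"
  show "P x"
    by (induction x rule: measure_induct_rule[of "\<lambda>x. rank_of (Rep_ranked x)"])
      (rule *, simp add: less_ranked_def)
next
  have "(UNIV :: 'a ranked set) = Abs_ranked ` UNIV"
    using Abs_ranked_cases by (metis UNIV_I surj_def surj_def)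
  then show "finite (UNIV :: 'a ranked set)" by (metis finite finite_imageI)
qed (auto simp: less_eq_ranked_def less_ranked_def)

end

lemma bij_Rep_ranked: "bij (Rep_ranked :: 'n ranked \<Rightarrow> 'n)"
  by (rule bijI) (auto simp: inj_def Rep_ranked_inject surj_def intro: Abs_ranked_inverse[symmetric])

lemma prod_Basis_cart:
  "(\<Prod>b\<in>Basis. f b) = (\<Prod>i\<in>UNIV. f (axis i 1 :: real ^ 'n))"
proof -
  have "Basis = range (\<lambda>i. axis i 1 :: real ^ 'n)" by (auto simp: Basis_vec_def)
  moreover have "inj (\<lambda>i. axis i 1 :: real ^ 'n)" by (auto simp: inj_def axis_eq_axis)
  ultimately show ?thesis using prod.reindex[of "\<lambda>i. axis i 1 :: real ^ 'n" UNIV f] by (simp only: o_def)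
qed

definition vec_reindex :: "('m \<Rightarrow> 'n) \<Rightarrow> 'a ^ 'n \<Rightarrow> 'a ^ 'm" where
  "vec_reindex h x = (\<chi> k. x $ h k)"

lemma linear_vec_reindex: "linear (vec_reindex h :: real ^ 'n \<Rightarrow> real ^ 'm)"
  by (rule linearI) (auto simp: vec_reindex_def vec_eq_iff)

text \<open>Renaming coordinates maps boxes to boxes with the same side lengths, and the volumes of
  boxes characterise Lebesgue measure.\<close>

lemma distr_vec_reindex:
  fixes h :: "'m::finite \<Rightarrow> 'n::finite"
  assumes "bij h"
  shows "distr lborel borel (vec_reindex h :: real ^ 'n \<Rightarrow> real ^ 'm) = lborel"
proof (rule lborel_eqI[symmetric])
  have meas: "(vec_reindex h :: real ^ 'n \<Rightarrow> real ^ 'm) \<in> borel \<rightarrow>\<^sub>M borel"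
    by (intro borel_measurable_continuous_onI linear_continuous_on linear_conv_bounded_linear[THEN iffD1] linear_vec_reindex)
  fix l u :: "real ^ 'm"
  assume le: "\<And>b. b \<in> Basis \<Longrightarrow> l \<bullet> b \<le> u \<bullet> b"
  have le': "l $ k \<le> u $ k" for k
    using le[of "axis k 1"] by (simp add: inner_axis axis_in_Basis_iff)
  define g where "g = inv h"
  have hg: "h (g i) = i" "g (h k) = k" for i k
    using assms by (auto simp: g_def bij_def surj_f_inv_f)
  have "(vec_reindex h :: real ^ 'n \<Rightarrow> real ^ 'm) -` box l u = box (vec_reindex g l) (vec_reindex g u)"
    by (auto simp: mem_box_cart vec_reindex_def) (metis hg)+
  moreover have "emeasure lborel (box (vec_reindex g l) (vec_reindex g u) :: (real ^ 'n) set)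
    = (\<Prod>b\<in>Basis. (vec_reindex g u - vec_reindex g l) \<bullet> b)"
    using le' by (intro emeasure_lborel_box) (auto simp: vec_reindex_def Basis_vec_def inner_axis)
  moreover have "(\<Prod>b\<in>Basis. (vec_reindex g u - vec_reindex g l :: real ^ 'n) \<bullet> b)
    = (\<Prod>i\<in>UNIV. u $ g i - l $ g i)"
    by (simp add: prod_Basis_cart inner_axis vec_reindex_def)
  moreover have "(\<Prod>i\<in>UNIV. u $ g i - l $ g i) = (\<Prod>k\<in>UNIV. u $ k - l $ k)"
    by (rule prod.reindex_bij_witness[of _ h g]) (auto simp: hg)
  moreover have "(\<Prod>k\<in>UNIV. u $ k - l $ k) = (\<Prod>b\<in>Basis. (u - l) \<bullet> b)"
    by (simp add: prod_Basis_cart inner_axis)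
  ultimately show "emeasure (distr lborel borel (vec_reindex h)) (box l u) = (\<Prod>b\<in>Basis. (u - l) \<bullet> b)"
    using meas by (simp add: emeasure_distr)
qed simp

lemma measure_vec_reindex_image:
  fixes h :: "'m::finite \<Rightarrow> 'n::finite" and S :: "(real ^ 'n) set"
  assumes "bij h" "compact S"
  shows "measure lebesgue (vec_reindex h ` S) = measure lebesgue S"
proof -
  let ?f = "vec_reindex h :: real ^ 'n \<Rightarrow> real ^ 'm"
  have cont: "continuous_on UNIV ?f"
    by (intro linear_continuous_on linear_conv_bounded_linear[THEN iffD1] linear_vec_reindex)
  have "compact (?f ` S)"
    using assms(2) cont by (meson compact_continuous_image continuous_on_subset subset_UNIV)
  then have borel: "?f ` S \<in> sets borel" "S \<in> sets borel"
    using assms(2) by (auto simp: borel_compact)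
  have "inj ?f"
    using assms(1) by (auto simp: inj_def vec_reindex_def vec_eq_iff) (metis bij_pointE)
  then have "?f -` (?f ` S) = S" by (rule inj_vimage_image_eq)
  moreover have "measure lborel (?f ` S) = measure (distr lborel borel ?f) (?f ` S)"
    by (simp add: distr_vec_reindex assms)
  moreover have "\<dots> = measure lborel (?f -` (?f ` S))"
    using borel cont by (subst measure_distr) (auto intro: borel_measurable_continuous_onI)
  ultimately show ?thesis using borel by simp
qed

text \<open>Both sides are the modulus of the determinant with rows \<open>u k\<close>: on the left
  as the index of the lattice, on the right as \<open>n!\<close> times the volume of the simplex on
  0 and the \<open>u k\<close>.\<close>

lemma card_lattice_cosets_simplex_ranked:
  fixes u :: "'n::{finite,wellorder} \<Rightarrow> int ^ 'n::_"
  assumes "\<And>t :: real ^ 'n::_. (\<And>k. (\<Sum>j\<in>UNIV. of_int (u k $ j) * t $ j) = 0) \<Longrightarrow> t = 0"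
  shows "real (card (range (lattice_coset u))) =
    fact CARD('n) * measure lebesgue (convex hull (insert 0 (range (\<lambda>k. of_int_vec (u k)))))"
proof -
  define D where "D = ((\<chi> k j. of_int (u k $ j)) :: real ^ 'n::_ ^ 'n::_)"
  have "t = 0" if "D *v t = 0" for t
    using assms[of t] that by (simp add: D_def matrix_vector_mult_def vec_eq_iff)
  then have "det D \<noteq> 0"
    using matrix_left_invertible_ker[of D] invertible_left_inverse[of D] invertible_det_nz[of D] by blast
  have dT: "det (transpose D) \<noteq> 0" using \<open>det D \<noteq> 0\<close> by (simp add: det_transpose)
  define f where "f k = (of_int_vec (u k) :: real ^ 'n::_)" for k
  have f_col: "f k = transpose D *v axis k 1" for k
    by (simp add: f_def D_def of_int_vec_def matrix_vector_mult_basis column_def transpose_def)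
  have inj_D: "inj ((*v) (transpose D))"
    using dT by (simp add: inj_matrix_vector_mult invertible_det_nz)
  have "inj f"
    by (rule injI) (use inj_D in \<open>metis f_col injD axis_eq_axis zero_neq_one\<close>)
  moreover have nz: "f k \<noteq> 0" for k
    using injD[OF inj_D, of "axis k 1" 0] by (auto simp: f_col)
  ultimately have bij: "bij_betw f UNIV (insert 0 (range f) - {0})"
    by (auto simp: bij_betw_def)
  have "card (insert 0 (range f)) = Suc CARD('n)"
    using nz \<open>inj f\<close> by (subst card_insert_disjoint) (auto simp: card_image)
  then have "measure lborel (convex hull (insert 0 (range f))) =
      \<bar>det (\<chi> i j. f j $ i - 0 $ i)\<bar> / fact CARD('n)"
    by (intro content_simplex bij) auto
  also have "(\<chi> i j. f j $ i - 0 $ i) = transpose D"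
    by (simp add: transpose_def D_def f_def of_int_vec_def vec_eq_iff)
  finally have "measure lborel (convex hull (insert 0 (range f))) = \<bar>det D\<bar> / fact CARD('n)"
    by (simp add: det_transpose)
  moreover have "measure lebesgue (convex hull (insert 0 (range f))) = measure lborel (convex hull (insert 0 (range f)))"
    by (intro measure_completion)
      (simp add: borel_compact finite_imp_compact_convex_hull)
  moreover have "real (card (range (lattice_coset u))) = \<bar>det D\<bar>"
    unfolding D_def by (rule card_lattice_cosets_det) (use \<open>det D \<noteq> 0\<close> in \<open>simp add: D_def\<close>)
  ultimately show ?thesis by (simp add: f_def[abs_def])
qed

lemma card_lattice_cosets_simplex:
  fixes u :: "'n::finite \<Rightarrow> int ^ 'n"
  assumes "\<And>t :: real ^ 'n. (\<And>k. of_int_vec (u k) \<bullet> t = 0) \<Longrightarrow> t = 0"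
  shows "real (card (range (lattice_coset u))) =
    fact CARD('n) * measure lebesgue (convex hull (insert 0 (range (\<lambda>k. of_int_vec (u k)))))"
proof -
  let ?h = "Rep_ranked :: 'n ranked \<Rightarrow> 'n" and ?g = "Abs_ranked :: 'n \<Rightarrow> 'n ranked"
  have hg: "?h (?g i) = i" "?g (?h k) = k" for i k
    by (auto simp: Abs_ranked_inverse Rep_ranked_inverse)
  \<comment> \<open>Rows and coordinates are renamed simultaneously, so the matrix stays square over
    the ordered type.\<close>
  define u' where "u' k = vec_reindex ?h (u (?h k))" for k
  have sum_h: "(\<Sum>j\<in>UNIV. F (?h j)) = (\<Sum>j\<in>UNIV. F j)" for F :: "'n \<Rightarrow> 'a::comm_monoid_add"
    by (rule sum.reindex_bij_witness[of _ ?g ?h]) (auto simp: hg)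
  have "real (card (range (lattice_coset u'))) =
    fact CARD('n ranked) * measure lebesgue (convex hull (insert 0 (range (\<lambda>k. of_int_vec (u' k)))))"
  proof (rule card_lattice_cosets_simplex_ranked)
    fix t :: "real ^ 'n ranked" assume t: "\<And>k. (\<Sum>j\<in>UNIV. of_int (u' k $ j) * t $ j) = 0"
    have "of_int_vec (u i) \<bullet> vec_reindex ?g t = 0" for i
      using t[of "?g i"] sum_h[of "\<lambda>j. of_int (u i $ j) * t $ ?g j"]
      by (simp add: u'_def vec_reindex_def hg of_int_vec_def inner_vec_def)
    then have "vec_reindex ?g t = 0" by (rule assms)
    then have "t $ ?g j = 0" for j by (simp add: vec_reindex_def vec_eq_iff)
    then have "t $ k = 0" for k by (metis hg(2))
    then show "t = 0" by (simp add: vec_eq_iff)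
  qed
  moreover have "CARD('n ranked) = CARD('n)"
    using bij_Rep_ranked bij_betw_same_card by blast
  moreover have "card (range (lattice_coset u')) = card (range (lattice_coset u))"
  proof -
    have mem: "w \<circ> ?h \<in> lattice_coset u' (v \<circ> ?h) \<longleftrightarrow> w \<in> lattice_coset u v" for v w
    proof
      assume "w \<circ> ?h \<in> lattice_coset u' (v \<circ> ?h)"
      then obtain t where t: "\<And>k. w (?h k) - v (?h k) = (\<Sum>j\<in>UNIV. u' k $ j * t $ j)"
        by (auto simp: lattice_coset_def)
      have "w i - v i = (\<Sum>j\<in>UNIV. u i $ j * vec_reindex ?g t $ j)" for i
        using t[of "?g i"] sum_h[of "\<lambda>j. u i $ j * t $ ?g j"]
        by (simp add: u'_def vec_reindex_def hg)
      then show "w \<in> lattice_coset u v" unfolding lattice_coset_def by blast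
    next
      assume "w \<in> lattice_coset u v"
      then obtain t where t: "\<And>i. w i - v i = (\<Sum>j\<in>UNIV. u i $ j * t $ j)"
        by (auto simp: lattice_coset_def)
      have "(w \<circ> ?h) k - (v \<circ> ?h) k = (\<Sum>j\<in>UNIV. u' k $ j * vec_reindex ?h t $ j)" for k
        using t[of "?h k"] sum_h[of "\<lambda>j. u (?h k) $ j * t $ j"]
        by (simp add: u'_def vec_reindex_def)
      then show "w \<circ> ?h \<in> lattice_coset u' (v \<circ> ?h)" unfolding lattice_coset_def by blast
    qed
    have eq: "lattice_coset u' (v \<circ> ?h) = lattice_coset u' (w \<circ> ?h) \<longleftrightarrow> lattice_coset u v = lattice_coset u w" for v w
      by (simp add: lattice_coset_eq_iff mem)
    have "range (lattice_coset u') = range (\<lambda>v. lattice_coset u' (v \<circ> ?h))"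
    proof (intro equalityI subsetI)
      fix C assume "C \<in> range (lattice_coset u')"
      then obtain v where "C = lattice_coset u' v" by auto
      moreover have "v = (v \<circ> ?g) \<circ> ?h" by (simp add: fun_eq_iff hg)
      ultimately show "C \<in> range (\<lambda>v. lattice_coset u' (v \<circ> ?h))" by (metis rangeI)
    qed auto
    then show ?thesis using card_image_cong_kernel[OF eq] by simp
  qed
  moreover have "measure lebesgue (convex hull (insert 0 (range (\<lambda>k. of_int_vec (u' k)))))
    = measure lebesgue (convex hull (insert 0 (range (\<lambda>k. of_int_vec (u k)))))"
  proof -
    have "vec_reindex ?h ` (convex hull (insert 0 (range (\<lambda>k. of_int_vec (u k)))))
      = convex hull (vec_reindex ?h ` insert 0 (range (\<lambda>k. of_int_vec (u k) :: real ^ 'n)))"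
      by (rule convex_hull_linear_image) (rule linear_vec_reindex)
    also have "vec_reindex ?h ` insert 0 (range (\<lambda>k. of_int_vec (u k) :: real ^ 'n))
      = insert 0 (range (\<lambda>k. of_int_vec (u' (?g k))))"
    proof -
      have "vec_reindex ?h (of_int_vec (u k) :: real ^ 'n) = of_int_vec (u' (?g k))" for k
        by (simp add: vec_reindex_def u'_def hg of_int_vec_def)
      then show ?thesis by (simp add: image_image linear_0[OF linear_vec_reindex])
    qed
    also have "range (\<lambda>k. of_int_vec (u' (?g k)) :: real ^ 'n ranked) = range (\<lambda>k. of_int_vec (u' k))"
    proof (intro equalityI subsetI)
      fix x :: "real ^ 'n ranked" assume "x \<in> range (\<lambda>k. of_int_vec (u' k))"
      then obtain k where "x = of_int_vec (u' (?g (?h k)))" by (auto simp: hg)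
      then show "x \<in> range (\<lambda>k. of_int_vec (u' (?g k)))" by blast
    qed auto
    finally show ?thesis
      using measure_vec_reindex_image[OF bij_Rep_ranked, of "convex hull (insert 0 (range (\<lambda>k. of_int_vec (u k))))"]
      by (simp add: finite_imp_compact_convex_hull)
  qed
  ultimately show ?thesis by simp
qed

section \<open>Phases and zeros\<close>

definition phase :: "('i \<Rightarrow> 'v::euclidean_space) \<Rightarrow> ('i \<Rightarrow> complex) \<Rightarrow> 'i \<Rightarrow> 'v \<Rightarrow> real" where
  "phase a c i \<theta> = a i \<bullet> \<theta> + Arg (c i)"

text \<open>The coamoeba lifted to the universal cover: with
  \<open>z = exp (x + i \<theta>)\<close>, the vector \<open>x\<close> holds the logarithms of the
  moduli.\<close>

definition zero_args :: "'i set \<Rightarrow> ('i \<Rightarrow> 'v::euclidean_space) \<Rightarrow> ('i \<Rightarrow> complex) \<Rightarrow> 'v set" where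
  "zero_args A a c = {\<theta>. \<exists>x. (\<Sum>i\<in>A. c i * exp (Complex (a i \<bullet> x) (a i \<bullet> \<theta>))) = 0}"

text \<open>The Gale dual form of an edge: an affine function that is 0 at \<open>i\<close> and
  \<open>j\<close> and negative at the other exponents has values orthogonal to \<open>b\<close>, so
  \<open>b\<close> must take both signs off the pair; conversely, then such values exist.\<close>

definition rel_edge :: "'i set \<Rightarrow> ('i \<Rightarrow> real) \<Rightarrow> 'i \<Rightarrow> 'i \<Rightarrow> bool" where
  "rel_edge A b i j \<longleftrightarrow> (\<exists>k\<in>A. k \<noteq> i \<and> k \<noteq> j \<and> b k > 0) \<and> (\<exists>k\<in>A. k \<noteq> i \<and> k \<noteq> j \<and> b k < 0)"

definition lift_phase ::
    "('i \<Rightarrow> 'v::euclidean_space) \<Rightarrow> ('i \<Rightarrow> complex) \<Rightarrow> ('i \<Rightarrow> int) \<Rightarrow> 'i \<Rightarrow> 'v \<Rightarrow> real" where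
  "lift_phase a c m i \<theta> = phase a c i \<theta> + 2 * pi * of_int (m i)"

definition lopsided_cell ::
    "'i set \<Rightarrow> ('i \<Rightarrow> 'v::euclidean_space) \<Rightarrow> ('i \<Rightarrow> complex) \<Rightarrow> ('i \<Rightarrow> int) \<Rightarrow> 'v set" where
  "lopsided_cell A a c m =
    {\<theta>. \<forall>i\<in>A. \<forall>j\<in>A. \<bar>lift_phase a c m i \<theta> - lift_phase a c m j \<theta>\<bar> < pi}"

text \<open>Only edges are compared, because opposite terms force a point into the closed coamoeba
  only when they belong to an edge.\<close>

definition cell ::
    "'i set \<Rightarrow> ('i \<Rightarrow> 'v::euclidean_space) \<Rightarrow> ('i \<Rightarrow> real) \<Rightarrow> ('i \<Rightarrow> complex) \<Rightarrow> ('i \<Rightarrow> int) \<Rightarrow> 'v set" where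
  "cell A a b c m =
    {\<theta>. \<forall>i\<in>A. \<forall>j\<in>A. rel_edge A b i j \<longrightarrow> \<bar>lift_phase a c m i \<theta> - lift_phase a c m j \<theta>\<bar> < pi}"

text \<open>\<open>interpolation\<close> is the dual form of uniqueness of the relation: every
  vector orthogonal to \<open>b\<close> consists of the values of an affine function.
  \<open>ex_pos\<close> and \<open>ex_neg\<close> provide two coefficients of each sign.\<close>

locale affine_relation =
  fixes A :: "'i set" and a :: "'i \<Rightarrow> 'v::euclidean_space" and b :: "'i \<Rightarrow> real"
  assumes finite_A: "finite A"
    and inj_a: "inj_on a A"
    and sum_b: "(\<Sum>i\<in>A. b i) = 0"
    and sum_b_a: "(\<Sum>i\<in>A. b i *\<^sub>R a i) = 0"
    and interpolation: "\<And>x. (\<Sum>i\<in>A. b i * x i) = 0 \<Longrightarrow> \<exists>y s. \<forall>i\<in>A. a i \<bullet> y + s = x i"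
    and ex_pos: "\<And>i. \<exists>j\<in>A. j \<noteq> i \<and> b j > 0"
    and ex_neg: "\<And>i. \<exists>j\<in>A. j \<noteq> i \<and> b j < 0"

text \<open>The axioms are symmetric in the sign of \<open>b\<close>, so an argument for one sign is
  reused for the other by interpreting the locale at \<open>- b\<close>.\<close>

lemma affine_relation_uminus:
  assumes "affine_relation A a b" shows "affine_relation A a (\<lambda>i. - b i)"
proof -
  interpret affine_relation A a b by fact
  show ?thesis
    by unfold_locales
      (use finite_A inj_a sum_b sum_b_a interpolation ex_pos ex_neg in \<open>auto simp: sum_negf\<close>)
qed

lemma rel_edge_uminus: "rel_edge A (\<lambda>i. - b i) = rel_edge A b"
  by (auto simp: rel_edge_def fun_eq_iff)

lemma cell_uminus: "cell A a (\<lambda>i. - b i) c m = cell A a b c m"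
  by (simp add: cell_def rel_edge_uminus)

lemma cis_lift_phase: "cis (lift_phase a c m i \<theta>) = cis (phase a c i \<theta>)"
  by (simp add: lift_phase_def cis_mult[symmetric])

lemma exp_term_polar:
  assumes "c i \<noteq> 0"
  shows "c i * exp (Complex (a i \<bullet> x) (a i \<bullet> \<theta>))
    = of_real (norm (c i) * exp (a i \<bullet> x)) * cis (phase a c i \<theta>)"
proof -
  have "c i = of_real (norm (c i)) * cis (Arg (c i))"
    by (metis rcis_cmod_Arg rcis_def)
  moreover have "exp (Complex (a i \<bullet> x) (a i \<bullet> \<theta>)) = of_real (exp (a i \<bullet> x)) * cis (a i \<bullet> \<theta>)"
    by (simp add: exp_eq_polar)
  ultimately have "c i * exp (Complex (a i \<bullet> x) (a i \<bullet> \<theta>)) =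
      (of_real (norm (c i)) * cis (Arg (c i))) * (of_real (exp (a i \<bullet> x)) * cis (a i \<bullet> \<theta>))" by simp
  also have "\<dots> = of_real (norm (c i) * exp (a i \<bullet> x)) * (cis (a i \<bullet> \<theta>) * cis (Arg (c i)))"
    by (simp only: of_real_mult mult_ac)
  finally show ?thesis by (simp add: cis_mult phase_def)
qed

context affine_relation
begin

lemma sum_b_affine: "(\<Sum>i\<in>A. b i * (a i \<bullet> y + s)) = 0"
proof -
  have "(\<Sum>i\<in>A. b i * (a i \<bullet> y + s)) = (\<Sum>i\<in>A. b i *\<^sub>R a i) \<bullet> y + (\<Sum>i\<in>A. b i) * s"
    by (simp add: distrib_left sum.distrib inner_sum_left sum_distrib_right)
  then show ?thesis by (simp add: sum_b sum_b_a)
qed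

text \<open>The moduli of the terms are \<open>norm (c i) * exp (a i \<bullet> x)\<close>. Taking
  logarithms, a positive vector is of this form up to a common factor exactly when its pairing with
  \<open>b\<close> agrees with that of \<open>norm (c i)\<close>.\<close>

lemma zero_args_iff:
  assumes c: "\<And>i. i \<in> A \<Longrightarrow> c i \<noteq> 0"
  shows "\<theta> \<in> zero_args A a c \<longleftrightarrow> (\<exists>p. (\<forall>i\<in>A. p i > 0) \<and>
    (\<Sum>i\<in>A. of_real (p i) * cis (phase a c i \<theta>)) = 0 \<and>
    (\<Sum>i\<in>A. b i * ln (p i)) = (\<Sum>i\<in>A. b i * ln (norm (c i))))" (is "_ \<longleftrightarrow> (\<exists>p. ?Q p)")
proof
  assume "\<theta> \<in> zero_args A a c"
  then obtain x where x: "(\<Sum>i\<in>A. c i * exp (Complex (a i \<bullet> x) (a i \<bullet> \<theta>))) = 0"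
    by (auto simp: zero_args_def)
  define p where "p i = norm (c i) * exp (a i \<bullet> x)" for i
  have "\<forall>i\<in>A. p i > 0" using c by (simp add: p_def)
  moreover have "(\<Sum>i\<in>A. of_real (p i) * cis (phase a c i \<theta>)) = 0"
    unfolding x[symmetric] by (intro sum.cong refl) (use exp_term_polar[where a=a and c=c] c in \<open>simp add: p_def\<close>)
  moreover have "(\<Sum>i\<in>A. b i * ln (p i)) = (\<Sum>i\<in>A. b i * ln (norm (c i)) + b i * (a i \<bullet> x + 0))"
    using c by (intro sum.cong) (auto simp: p_def ln_mult algebra_simps)
  ultimately show "\<exists>p. ?Q p"
    using sum_b_affine[of x 0] by (intro exI[of _ p]) (simp add: sum.distrib)
next
  assume "\<exists>p. ?Q p"
  then obtain p where p: "\<And>i. i \<in> A \<Longrightarrow> p i > 0" "(\<Sum>i\<in>A. of_real (p i) * cis (phase a c i \<theta>)) = 0"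
    "(\<Sum>i\<in>A. b i * ln (p i)) = (\<Sum>i\<in>A. b i * ln (norm (c i)))" by auto
  have "(\<Sum>i\<in>A. b i * (ln (p i) - ln (norm (c i)))) = 0"
    using p(3) by (simp add: right_diff_distrib sum_subtractf)
  from interpolation[OF this] obtain y s where
    y: "\<And>i. i \<in> A \<Longrightarrow> a i \<bullet> y + s = ln (p i) - ln (norm (c i))" by auto
  \<comment> \<open>Interpolation gives the logarithms up to the constant \<open>s\<close>; the
    resulting common factor \<open>exp (- s)\<close> does not affect the vanishing of the
    sum.\<close>
  have e: "norm (c i) * exp (a i \<bullet> y) = exp (- s) * p i" if "i \<in> A" for i
  proof -
    have "norm (c i) * exp (a i \<bullet> y) = exp (ln (norm (c i)) + a i \<bullet> y)"
      using c[OF that] by (simp add: exp_add)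
    also have "ln (norm (c i)) + a i \<bullet> y = - s + ln (p i)" using y[OF that] by simp
    also have "exp (- s + ln (p i)) = exp (- s) * p i" using p(1)[OF that] by (simp only: exp_add exp_ln)
    finally show ?thesis .
  qed
  have "(\<Sum>i\<in>A. c i * exp (Complex (a i \<bullet> y) (a i \<bullet> \<theta>)))
      = (\<Sum>i\<in>A. of_real (exp (- s)) * (of_real (p i) * cis (phase a c i \<theta>)))"
  proof (intro sum.cong refl)
    fix i assume "i \<in> A"
    show "c i * exp (Complex (a i \<bullet> y) (a i \<bullet> \<theta>)) = of_real (exp (- s)) * (of_real (p i) * cis (phase a c i \<theta>))"
      unfolding exp_term_polar[of c i a y \<theta>, OF c[OF \<open>i \<in> A\<close>]] e[OF \<open>i \<in> A\<close>] of_real_mult mult.assoc by (rule refl)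
  qed
  also have "\<dots> = 0" by (simp only: sum_distrib_left[symmetric] p(2) mult_zero_right)
  finally show "\<theta> \<in> zero_args A a c" by (auto simp: zero_args_def)
qed

end

section \<open>Positive linear relations between plane vectors\<close>

text \<open>On the segment from \<open>q\<close> to \<open>p\<close> all coefficients except that of
  \<open>j\<close> stay bounded away from 0, while that of \<open>j\<close> tends to 0 at
  \<open>q\<close>. As \<open>b j > 0\<close>, the logarithmic sum tends to minus infinity there and
  attains \<open>l\<close> by the intermediate value theorem.\<close>

lemma positive_relation_level:
  fixes w :: "'i \<Rightarrow> complex" and b :: "'i \<Rightarrow> real"
  assumes A: "finite A" "j \<in> A" "b j > 0"
    and p: "\<And>i. i \<in> A \<Longrightarrow> p i > 0" "(\<Sum>i\<in>A. of_real (p i) * w i) = 0" "(\<Sum>i\<in>A. b i * ln (p i)) \<ge> l"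
    and q: "\<And>i. i \<in> A - {j} \<Longrightarrow> q i > 0" "q j = 0" "(\<Sum>i\<in>A. of_real (q i) * w i) = 0"
  shows "\<exists>r. (\<forall>i\<in>A. r i > 0) \<and> (\<Sum>i\<in>A. of_real (r i) * w i) = 0 \<and> (\<Sum>i\<in>A. b i * ln (r i)) = l"
proof -
  define r where "r t i = (1 - t) * q i + t * p i" for t :: real and i
  define g where "g t = (\<Sum>i\<in>A. b i * ln (r t i))" for t
  define h where "h t = (\<Sum>i\<in>A-{j}. b i * ln (r t i))" for t
  have r_pos': "r t i > 0" if "i \<in> A - {j}" "0 \<le> t" "t \<le> 1" for t i
  proof (cases "t = 0")
    case False
    then show ?thesis using that q(1)[of i] p(1)[of i]
      unfolding r_def by (intro add_nonneg_pos mult_pos_pos mult_nonneg_nonneg) auto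
  qed (use that q(1)[of i] in \<open>simp add: r_def\<close>)
  have r_pos: "r t i > 0" if "i \<in> A" "0 < t" "t \<le> 1" for t i
    using r_pos'[of i t] that p(1)[of j] A q(2) by (cases "i = j") (auto simp: r_def)
  have g_h: "g t = b j * ln (t * p j) + h t" for t
    using A by (simp add: g_def h_def sum.remove[of A j] r_def q(2))
  have cont_r: "continuous_on X (\<lambda>t. r t i)" for X i
    unfolding r_def by (intro continuous_intros)
  have "continuous_on {0..1} h"
    unfolding h_def by (intro continuous_on_sum continuous_on_mult continuous_on_const continuous_on_ln cont_r ballI)
      (metis r_pos' atLeastAtMost_iff less_irrefl)
  then have "bounded (h ` {0..1})" by (intro compact_imp_bounded compact_continuous_image) auto
  then obtain H where H: "\<And>t. 0 \<le> t \<Longrightarrow> t \<le> 1 \<Longrightarrow> h t \<le> H"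
    by (auto simp: bounded_iff) (metis abs_le_D1 atLeastAtMost_iff)
  \<comment> \<open>Solves \<open>b j * ln (t0 * p j) <= l - H\<close>, where \<open>H\<close>
    bounds the contribution of the other terms; the minimum with 1 keeps the point on the
    segment.\<close>
  define t0 where "t0 = min 1 (exp ((l - H) / b j) / p j)"
  have t0: "0 < t0" "t0 \<le> 1" using p(1)[OF A(2)] by (auto simp: t0_def)
  have "t0 * p j \<le> exp ((l - H) / b j)"
    using p(1)[OF A(2)] by (simp add: t0_def min_def field_simps)
  moreover have "0 < t0 * p j" using p(1)[OF A(2)] t0 by simp
  ultimately have "ln (t0 * p j) \<le> (l - H) / b j"
    by (metis ln_exp ln_le_cancel_iff exp_gt_zero)
  then have "b j * ln (t0 * p j) \<le> l - H" using A(3) by (simp add: field_simps)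
  then have "g t0 \<le> l" using H[of t0] t0 by (simp add: g_h)
  moreover have "l \<le> g 1" using p(3) by (simp add: g_def r_def)
  moreover have "continuous_on {t0..1} g"
    unfolding g_def by (intro continuous_on_sum continuous_on_mult continuous_on_const continuous_on_ln cont_r ballI)
      (metis r_pos t0(1) atLeastAtMost_iff less_irrefl less_le_trans)
  ultimately obtain t where t: "t0 \<le> t" "t \<le> 1" "g t = l"
    using IVT'[of g t0 l 1] t0 by auto
  have "(\<Sum>i\<in>A. of_real (r t i) * w i) =
      of_real (1 - t) * (\<Sum>i\<in>A. of_real (q i) * w i) + of_real t * (\<Sum>i\<in>A. of_real (p i) * w i)"
  proof -
    have "of_real (r t i) * w i = of_real (1 - t) * (of_real (q i) * w i) + of_real t * (of_real (p i) * w i)" for i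
      by (simp add: r_def algebra_simps)
    then show ?thesis by (simp only: sum.distrib sum_distrib_left)
  qed
  then have "(\<Sum>i\<in>A. of_real (r t i) * w i) = 0" by (simp add: p q)
  then show ?thesis using t t0 r_pos by (intro exI[of _ "r t"]) (auto simp: g_def)
qed

lemma positive_relation_level_neg:
  fixes w :: "'i \<Rightarrow> complex" and b :: "'i \<Rightarrow> real"
  assumes A: "finite A" "j \<in> A" "b j < 0"
    and p: "\<And>i. i \<in> A \<Longrightarrow> p i > 0" "(\<Sum>i\<in>A. of_real (p i) * w i) = 0" "(\<Sum>i\<in>A. b i * ln (p i)) \<le> l"
    and q: "\<And>i. i \<in> A - {j} \<Longrightarrow> q i > 0" "q j = 0" "(\<Sum>i\<in>A. of_real (q i) * w i) = 0"
  shows "\<exists>r. (\<forall>i\<in>A. r i > 0) \<and> (\<Sum>i\<in>A. of_real (r i) * w i) = 0 \<and> (\<Sum>i\<in>A. b i * ln (r i)) = l"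
  using positive_relation_level[of A j "\<lambda>i. - b i" p w "- l" q] assms by (auto simp: sum_negf)

text \<open>Gordan's alternative in the plane, strengthened to strictly positive coefficients.
  Separation yields a nonnegative relation; by \<open>gen\<close> two vectors in its support form a
  real basis, and these two can absorb a small multiple of the sum of all vectors.\<close>

lemma positive_relation_or_halfplane:
  fixes w :: "'i \<Rightarrow> complex"
  assumes J: "finite J" and nz: "\<And>i. i \<in> J \<Longrightarrow> w i \<noteq> 0"
    and gen: "\<And>i j. i \<in> J \<Longrightarrow> j \<in> J \<Longrightarrow> i \<noteq> j \<Longrightarrow> Im (w i * cnj (w j)) \<noteq> 0"
    and half: "\<nexists>u. \<forall>i\<in>J. Re (u * w i) > 0"
  shows "\<exists>p. (\<forall>i\<in>J. p i > 0) \<and> (\<Sum>i\<in>J. of_real (p i) * w i) = 0"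
proof -
  have inj: "inj_on w J"
  proof (rule inj_onI, rule ccontr)
    fix i j assume "i \<in> J" "j \<in> J" "w i = w j" "i \<noteq> j"
    then show False using gen[of i j] by (simp add: complex_mult_cnj)
  qed
  have "0 \<in> convex hull (w ` J)"
  proof (rule ccontr)
    assume "0 \<notin> convex hull (w ` J)"
    moreover have "closed (convex hull (w ` J))"
      using J by (intro compact_imp_closed finite_imp_compact_convex_hull) auto
    ultimately obtain u d where "d > 0" "\<And>x. x \<in> convex hull (w ` J) \<Longrightarrow> inner u x > d"
      using separating_hyperplane_closed_0[OF convex_convex_hull] by metis
    then have "\<forall>i\<in>J. inner u (w i) > 0" using hull_inc[of _ "w ` J" convex] by fastforce
    then have "\<forall>i\<in>J. Re (cnj u * w i) > 0" by (simp add: inner_complex_def)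
    then show False using half by blast
  qed
  then obtain q where q: "\<And>z. z \<in> w ` J \<Longrightarrow> q z \<ge> 0" "sum q (w ` J) = 1" "(\<Sum>z\<in>w ` J. q z *\<^sub>R z) = 0"
    using J by (auto simp: convex_hull_finite)
  define p where "p i = q (w i)" for i
  have p: "\<And>i. i \<in> J \<Longrightarrow> p i \<ge> 0" "sum p J = 1" "(\<Sum>i\<in>J. of_real (p i) * w i) = 0"
    using q inj by (auto simp: p_def sum.reindex o_def scaleR_conv_of_real)
  obtain i where i: "i \<in> J" "p i > 0"
  proof -
    have "\<exists>i\<in>J. p i \<noteq> 0" using p(2) by (metis sum.neutral zero_neq_one)
    then show ?thesis using that p(1) by (metis order_le_less)
  qed
  obtain j where j: "j \<in> J" "j \<noteq> i" "p j > 0"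
  proof -
    have "\<exists>j\<in>J - {i}. p j \<noteq> 0"
    proof (rule ccontr)
      assume "\<not> ?thesis"
      then have "(\<Sum>k\<in>J - {i}. of_real (p k) * w k) = 0" by (intro sum.neutral) auto
      then have "of_real (p i) * w i = 0" using p(3) J i(1) by (simp add: sum.remove[of J i])
      then show False using i nz by auto
    qed
    then show ?thesis using that p(1) by (metis DiffE insertCI order_le_less)
  qed
  \<comment> \<open>Up to sign the determinant of \<open>w i\<close> and \<open>w j\<close> as real
    vectors; \<open>\<alpha>\<close> and \<open>\<beta>\<close> are the coordinates in this basis by
    Cramer's rule.\<close>
  define d where "d = Im (w i * cnj (w j))"
  have d: "d \<noteq> 0" using gen i j by (auto simp: d_def)
  define \<alpha> where "\<alpha> k = Im (w k * cnj (w j)) / d" for k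
  define \<beta> where "\<beta> k = Im (w i * cnj (w k)) / d" for k
  have comb: "w k = of_real (\<alpha> k) * w i + of_real (\<beta> k) * w j" for k
  proof -
    have "of_real d * w k = of_real (Im (w k * cnj (w j))) * w i + of_real (Im (w i * cnj (w k))) * w j"
      by (simp add: complex_eq_iff d_def algebra_simps)
    moreover have "z = of_real (P / d) * x + of_real (Q / d) * y"
      if "of_real d * z = of_real P * x + of_real Q * y" for z x y :: complex and P Q
    proof -
      have "z = (of_real P * x + of_real Q * y) / of_real d"
        using that d by (simp add: nonzero_eq_divide_eq mult.commute)
      then show ?thesis by (simp add: add_divide_distrib)
    qed
    ultimately show ?thesis unfolding \<alpha>_def \<beta>_def by blast
  qed
  define SA where "SA = (\<Sum>k\<in>J. \<alpha> k)"
  define SB where "SB = (\<Sum>k\<in>J. \<beta> k)"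
  \<comment> \<open>Half the size at which the correction could exhaust the positive coefficient of
    \<open>i\<close> or \<open>j\<close>.\<close>
  define \<epsilon> where "\<epsilon> = min (p i / (1 + \<bar>SA\<bar>)) (p j / (1 + \<bar>SB\<bar>)) / 2"
  have \<epsilon>: "\<epsilon> > 0" using i j by (auto simp: \<epsilon>_def)
  have bound: "p' - e * S > 0" if "e > 0" "e < p' / (1 + \<bar>S\<bar>)" for p' e S :: real
  proof -
    have "e * (1 + \<bar>S\<bar>) < p'" using that by (simp add: pos_less_divide_eq)
    moreover have "e * S \<le> e * \<bar>S\<bar>" using that by (intro mult_left_mono) auto
    ultimately show ?thesis using that(1) unfolding distrib_left mult_1_right by linarith
  qed
  have "\<epsilon> < p i / (1 + \<bar>SA\<bar>)" "\<epsilon> < p j / (1 + \<bar>SB\<bar>)"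
  proof -
    have "min x y / 2 < x" "min x y / 2 < y" if "x > 0" "y > 0" for x y :: real
      using that by (auto simp: min_def)
    from this[of "p i / (1 + \<bar>SA\<bar>)" "p j / (1 + \<bar>SB\<bar>)"]
    show "\<epsilon> < p i / (1 + \<bar>SA\<bar>)" "\<epsilon> < p j / (1 + \<bar>SB\<bar>)" using i j unfolding \<epsilon>_def by auto
  qed
  then have small: "p i - \<epsilon> * SA > 0" "p j - \<epsilon> * SB > 0"
    using bound[OF \<epsilon>] by auto
  \<comment> \<open>Every coefficient is raised by \<open>\<epsilon>\<close>, and the excess,
    expressed in the basis \<open>w i\<close>, \<open>w j\<close>, is taken off these two.\<close>
  define r where "r k = p k + \<epsilon> - (if k = i then \<epsilon> * SA else 0) - (if k = j then \<epsilon> * SB else 0)" for k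
  have "r k > 0" if "k \<in> J" for k
    using p(1)[OF that] \<epsilon> small j(2) by (auto simp: r_def)
  moreover have "(\<Sum>k\<in>J. of_real (r k) * w k) = 0"
  proof -
    have "of_real (r k) * w k = of_real (p k) * w k + of_real \<epsilon> * w k
        - (if k = i then of_real (\<epsilon> * SA) * w i else 0) - (if k = j then of_real (\<epsilon> * SB) * w j else 0)" for k
      by (auto simp: r_def algebra_simps)
    then have "(\<Sum>k\<in>J. of_real (r k) * w k) = (\<Sum>k\<in>J. of_real (p k) * w k) + of_real \<epsilon> * (\<Sum>k\<in>J. w k)
        - of_real (\<epsilon> * SA) * w i - of_real (\<epsilon> * SB) * w j"
      using J i j by (simp add: sum.distrib sum_subtractf sum_distrib_left)
    moreover have "(\<Sum>k\<in>J. w k) = (\<Sum>k\<in>J. of_real (\<alpha> k) * w i + of_real (\<beta> k) * w j)"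
      by (intro sum.cong refl comb)
    moreover have "\<dots> = of_real SA * w i + of_real SB * w j"
      by (simp add: SA_def SB_def sum.distrib sum_distrib_right)
    ultimately show ?thesis using p(3) by (simp add: algebra_simps)
  qed
  ultimately show ?thesis by blast
qed


section \<open>Half planes and consistent lifts of the phases\<close>

text \<open>Rotation by the midpoint of the extreme angles brings all terms into the open right half
  plane.\<close>

lemma sum_cis_nonzero:
  assumes "finite A" "A \<noteq> {}" and p: "\<And>i. i \<in> A \<Longrightarrow> p i > 0"
    and close: "\<And>i j. i \<in> A \<Longrightarrow> j \<in> A \<Longrightarrow> \<bar>y i - y j\<bar> < pi"
  shows "(\<Sum>i\<in>A. of_real (p i) * cis (y i)) \<noteq> 0"
proof
  assume 0: "(\<Sum>i\<in>A. of_real (p i) * cis (y i)) = 0"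
  define l where "l = Min (y ` A)"
  define u where "u = Max (y ` A)"
  have "l \<in> y ` A" "u \<in> y ` A" using assms by (auto simp: l_def u_def)
  then have lu: "u - l < pi" using close by fastforce
  have "cos (y i - (l + u) / 2) > 0" if "i \<in> A" for i
  proof (intro cos_gt_zero_pi)
    have "l \<le> y i" "y i \<le> u" using \<open>i \<in> A\<close> assms(1) by (auto simp: l_def u_def)
    with lu show "- (pi / 2) < y i - (l + u) / 2" "y i - (l + u) / 2 < pi / 2"
      by (simp_all add: field_simps)
  qed
  then have "(\<Sum>i\<in>A. p i * cos (y i - (l + u) / 2)) > 0"
    using assms p by (intro sum_pos) auto
  also have "(\<Sum>i\<in>A. p i * cos (y i - (l + u) / 2)) =
      Re (cis (- ((l + u) / 2)) * (\<Sum>i\<in>A. of_real (p i) * cis (y i)))"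
    by (simp add: sum_distrib_left mult.left_commute cis_mult del: cis.simps(2))
  finally show False by (simp add: 0)
qed

text \<open>After multiplication by \<open>u\<close> all three arguments lie in (-pi/2, pi/2), so
  principal arguments relative to \<open>z\<close> are honest differences, without
  wrap-around.\<close>

lemma Arg_diff_halfplane:
  assumes "Re (u * cis x) > 0" "Re (u * cis y) > 0" "Re (u * cis z) > 0"
  shows "\<bar>Arg (cis (x - z)) - Arg (cis (y - z))\<bar> < pi"
proof -
  define T where "T s = Arg (u * cis s)" for s
  have "u \<noteq> 0" using assms by auto
  have T: "\<bar>T s\<bar> < pi / 2" if "Re (u * cis s) > 0" for s
    using that Arg_Re_pos by (simp add: T_def)
  have "Arg (cis (s - z)) = T s - T z" if "Re (u * cis s) > 0" for s
  proof (rule cis_Arg_unique)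
    have polar: "u * cis r = of_real (norm u) * cis (T r)" for r
      using rcis_cmod_Arg[of "u * cis r"] by (simp add: T_def rcis_def norm_mult)
    have "cis (s - z) = (u * cis s) / (u * cis z)"
      using \<open>u \<noteq> 0\<close> by (simp add: cis_divide)
    also have "\<dots> = cis (T s - T z)"
      using \<open>u \<noteq> 0\<close> by (simp add: polar cis_divide)
    finally show "sgn (cis (s - z)) = cis (T s - T z)" by (simp add: sgn_div_norm)
    show "- pi < T s - T z" "T s - T z \<le> pi" using T[OF that] T[OF assms(3)] by linarith+
  qed
  then show ?thesis using assms T[of x] T[of y] by simp
qed

lemma exists_lift:
  "\<exists>k::int. x + 2 * pi * of_int k = z + Arg (cis (x - z))"
proof -
  have "cis (Arg (cis (x - z))) = cis (x - z)" by (simp add: cis_Arg sgn_div_norm)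
  then have "exp (\<i> * of_real (Arg (cis (x - z)))) = exp (\<i> * of_real (x - z))"
    by (simp only: cis_conv_exp)
  then obtain k :: int where "\<i> * of_real (Arg (cis (x - z))) = \<i> * of_real (x - z) + (of_int (2 * k) * pi) * \<i>"
    unfolding exp_eq by blast
  then have "Im (\<i> * of_real (Arg (cis (x - z)))) = Im (\<i> * of_real (x - z) + (of_int (2 * k) * pi) * \<i>)" by simp
  then have "Arg (cis (x - z)) = x - z + 2 * of_int k * pi" by simp
  then show ?thesis by (intro exI[of _ k]) (simp add: algebra_simps)
qed

context affine_relation
begin

lemma A_nonempty: "A \<noteq> {}" using ex_pos by blast

lemma lopsided_not_zero_args:
  assumes "\<And>i. i \<in> A \<Longrightarrow> c i \<noteq> 0"
  shows "lopsided_cell A a c m \<inter> zero_args A a c = {}"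
proof (rule ccontr)
  assume "lopsided_cell A a c m \<inter> zero_args A a c \<noteq> {}"
  then obtain \<theta> where \<theta>: "\<theta> \<in> lopsided_cell A a c m" "\<theta> \<in> zero_args A a c" by auto
  then obtain p where p: "\<And>i. i \<in> A \<Longrightarrow> p i > 0"
    "(\<Sum>i\<in>A. of_real (p i) * cis (phase a c i \<theta>)) = 0"
    using zero_args_iff[of c \<theta>, OF assms] by blast
  have "(\<Sum>i\<in>A. of_real (p i) * cis (lift_phase a c m i \<theta>)) \<noteq> 0"
    by (rule sum_cis_nonzero) (use finite_A A_nonempty p(1) \<theta> in \<open>auto simp: lopsided_cell_def\<close>)
  with p(2) show False by (simp add: cis_lift_phase)
qed

text \<open>All phases are lifted relative to one term \<open>o'\<close> with positive coefficient.
  An edge leaves out some \<open>k\<close> with negative coefficient, and the half plane of the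
  terms other than \<open>k\<close> contains both ends of the edge as well as \<open>o'\<close>, so
  their lifts are compatible.\<close>

lemma in_cell_of_halfplanes:
  assumes half: "\<And>k. k \<in> A \<Longrightarrow> b k < 0 \<Longrightarrow> \<exists>u. \<forall>i\<in>A - {k}. Re (u * cis (phase a c i \<theta>)) > 0"
  shows "\<exists>m. \<theta> \<in> cell A a b c m"
proof -
  obtain o' where o': "o' \<in> A" "b o' > 0" using ex_pos by blast
  define \<phi> where "\<phi> i = phase a c i \<theta>" for i
  have "\<forall>i. \<exists>k::int. \<phi> i + 2 * pi * of_int k = \<phi> o' + Arg (cis (\<phi> i - \<phi> o'))"
    by (intro allI exists_lift)
  from choice[OF this] obtain m :: "'i \<Rightarrow> int" where
    m: "\<And>i. \<phi> i + 2 * pi * of_int (m i) = \<phi> o' + Arg (cis (\<phi> i - \<phi> o'))" by blast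
  have "\<bar>lift_phase a c m i \<theta> - lift_phase a c m j \<theta>\<bar> < pi"
    if ij: "i \<in> A" "j \<in> A" "rel_edge A b i j" for i j
  proof -
    obtain k where k: "k \<in> A" "k \<noteq> i" "k \<noteq> j" "b k < 0" using ij(3) by (auto simp: rel_edge_def)
    then obtain u where u: "\<And>i. i \<in> A - {k} \<Longrightarrow> Re (u * cis (\<phi> i)) > 0"
      using half[OF k(1,4)] unfolding \<phi>_def by blast
    have "\<bar>Arg (cis (\<phi> i - \<phi> o')) - Arg (cis (\<phi> j - \<phi> o'))\<bar> < pi"
    proof (rule Arg_diff_halfplane[of u])
      have "o' \<noteq> k" using k o' by auto
      with o' show "Re (u * cis (\<phi> o')) > 0" by (intro u) simp
      show "Re (u * cis (\<phi> i)) > 0" "Re (u * cis (\<phi> j)) > 0" by (rule u; use k ij in blast)+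
    qed
    then show ?thesis using m[of i] m[of j] by (simp add: lift_phase_def \<phi>_def)
  qed
  then show ?thesis by (auto simp: cell_def)
qed

text \<open>Outside all cells, the terms other than some negative \<open>k\<close>, and likewise
  those other than some positive \<open>j\<close>, fail to lie in a half plane. Each failure is a
  positive relation with one exponent dropped, and the two together reach the required
  level.\<close>

lemma generic_in_cell:
  assumes c: "\<And>i. i \<in> A \<Longrightarrow> c i \<noteq> 0" and \<theta>: "\<theta> \<notin> zero_args A a c"
    and gen: "\<And>i j. i \<in> A \<Longrightarrow> j \<in> A \<Longrightarrow> i \<noteq> j \<Longrightarrow> sin (phase a c i \<theta> - phase a c j \<theta>) \<noteq> 0"
  shows "\<exists>m. \<theta> \<in> cell A a b c m"
proof (rule ccontr)
  assume no: "\<nexists>m. \<theta> \<in> cell A a b c m"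
  define w where "w i = cis (phase a c i \<theta>)" for i
  have im: "Im (w i * cnj (w j)) = sin (phase a c i \<theta> - phase a c j \<theta>)" for i j
    by (simp add: w_def sin_diff)
  obtain k where k: "k \<in> A" "b k < 0" "\<nexists>u. \<forall>i\<in>A - {k}. Re (u * w i) > 0"
    using in_cell_of_halfplanes[of c \<theta>] no unfolding w_def by blast
  interpret neg: affine_relation A a "\<lambda>i. - b i" by (rule affine_relation_uminus) unfold_locales
  obtain j where j: "j \<in> A" "b j > 0" "\<nexists>u. \<forall>i\<in>A - {j}. Re (u * w i) > 0"
    using neg.in_cell_of_halfplanes[of c \<theta>] no unfolding w_def cell_uminus neg_less_0_iff_less by blast
  have del: "\<exists>q. (\<forall>i\<in>A - {k}. q i > 0) \<and> q k = 0 \<and> (\<Sum>i\<in>A. of_real (q i) * w i) = 0"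
    if "k \<in> A" "\<nexists>u. \<forall>i\<in>A - {k}. Re (u * w i) > 0" for k
  proof -
    have "\<exists>p. (\<forall>i\<in>A - {k}. p i > 0) \<and> (\<Sum>i\<in>A - {k}. of_real (p i) * w i) = 0"
    proof (rule positive_relation_or_halfplane)
      show "finite (A - {k})" using finite_A by simp
      show "w i \<noteq> 0" for i by (simp add: w_def)
      show "Im (w i * cnj (w j)) \<noteq> 0" if "i \<in> A - {k}" "j \<in> A - {k}" "i \<noteq> j" for i j
        unfolding im using gen that by blast
    qed (rule that(2))
    then obtain p where p: "\<forall>i\<in>A - {k}. p i > 0" "(\<Sum>i\<in>A - {k}. of_real (p i) * w i) = 0" by blast
    define q where "q = p(k := 0)"
    have "(\<Sum>i\<in>A. of_real (q i) * w i) = (\<Sum>i\<in>A - {k}. of_real (q i) * w i)"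
      using finite_A that by (simp add: sum.remove[of A k] q_def)
    also have "\<dots> = (\<Sum>i\<in>A - {k}. of_real (p i) * w i)" by (intro sum.cong) (auto simp: q_def)
    finally show ?thesis using p by (intro exI[of _ q]) (auto simp: q_def)
  qed
  obtain q where q: "\<And>i. i \<in> A - {k} \<Longrightarrow> q i > 0" "q k = 0" "(\<Sum>i\<in>A. of_real (q i) * w i) = 0"
    using del[OF k(1,3)] by blast
  obtain r where r: "\<And>i. i \<in> A - {j} \<Longrightarrow> r i > 0" "r j = 0" "(\<Sum>i\<in>A. of_real (r i) * w i) = 0"
    using del[OF j(1,3)] by blast
  have kj: "k \<noteq> j" using k j by auto
  \<comment> \<open>\<open>q\<close> vanishes only at \<open>k\<close> and \<open>r\<close> only at
    \<open>j\<close>, so the sum is positive everywhere.\<close>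
  define p where "p i = q i + r i" for i
  have p: "p i > 0" if "i \<in> A" for i
  proof -
    have "q i \<ge> 0" "r i \<ge> 0" using q(1)[of i] q(2) r(1)[of i] r(2) that by (cases "i = k"; cases "i = j"; force)+
    moreover have "q i > 0 \<or> r i > 0" using q(1)[of i] r(1)[of i] that kj by blast
    ultimately show ?thesis by (auto simp: p_def)
  qed
  have p0: "(\<Sum>i\<in>A. of_real (p i) * w i) = 0" using q(3) r(3) by (simp add: p_def distrib_right sum.distrib)
  define l where "l = (\<Sum>i\<in>A. b i * ln (norm (c i)))"
  have "\<exists>r. (\<forall>i\<in>A. r i > 0) \<and> (\<Sum>i\<in>A. of_real (r i) * w i) = 0 \<and> (\<Sum>i\<in>A. b i * ln (r i)) = l"
  \<comment> \<open>The level is approached from above by moving towards \<open>r\<close>, where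
    \<open>j\<close> is dropped, and from below by moving towards \<open>q\<close>, where
    \<open>k\<close> is dropped.\<close>
  proof (cases "(\<Sum>i\<in>A. b i * ln (p i)) \<ge> l")
    case True
    then show ?thesis using positive_relation_level[of A j b p w l r] finite_A j(1,2) p p0 r by blast
  next
    case False
    then show ?thesis using positive_relation_level_neg[of A k b p w l q] finite_A k(1,2) p p0 q by simp
  qed
  then show False using \<theta> zero_args_iff[of c \<theta>, OF c] by (simp add: w_def l_def)
qed

text \<open>Distinct exponents give nonzero normals, so countably many hyperplanes cover the
  set.\<close>

lemma negligible_nongeneric:
  "negligible {\<theta>. \<exists>i\<in>A. \<exists>j\<in>A. i \<noteq> j \<and> sin (phase a c i \<theta> - phase a c j \<theta>) = 0}"
proof -
  have "negligible {\<theta>. sin (phase a c i \<theta> - phase a c j \<theta>) = 0}" if "i \<in> A" "j \<in> A" "i \<noteq> j" for i j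
  proof -
    have "a i - a j \<noteq> 0" using inj_a that by (auto dest: inj_onD)
    then have "negligible (\<Union>k::int. {\<theta>. (a i - a j) \<bullet> \<theta> = of_int k * pi - (Arg (c i) - Arg (c j))})"
      by (intro negligible_countable_Union) (auto intro!: negligible_hyperplane)
    then show ?thesis
      by (rule negligible_subset) (auto simp: sin_zero_iff_int2 phase_def algebra_simps)
  qed
  then have "negligible (\<Union>i\<in>A. \<Union>j\<in>A - {i}. {\<theta>. sin (phase a c i \<theta> - phase a c j \<theta>) = 0})"
    using finite_A by (intro negligible_Union finite_imageI) (auto intro!: negligible_Union finite_imageI)
  then show ?thesis by (rule negligible_subset) auto
qed

lemma exists_generic:
  assumes "open S" "S \<noteq> {}"
  shows "\<exists>\<theta>\<in>S. \<forall>i\<in>A. \<forall>j\<in>A. i \<noteq> j \<longrightarrow> sin (phase a c i \<theta> - phase a c j \<theta>) \<noteq> 0"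
proof (rule ccontr)
  assume "\<not> ?thesis"
  then have "S \<subseteq> {\<theta>. \<exists>i\<in>A. \<exists>j\<in>A. i \<noteq> j \<and> sin (phase a c i \<theta> - phase a c j \<theta>) = 0}" by blast
  then show False
    using negligible_nongeneric negligible_subset open_not_negligible[OF assms] by blast
qed

end

section \<open>The complement of the closure and the cells\<close>

context affine_relation
begin

lemma exists_edge_functional:
  assumes "i \<in> A" "j \<in> A" "rel_edge A b i j"
  obtains y s where "a i \<bullet> y + s = 0" "a j \<bullet> y + s = 0"
    "\<And>k. k \<in> A \<Longrightarrow> k \<noteq> i \<Longrightarrow> k \<noteq> j \<Longrightarrow> a k \<bullet> y + s \<le> -1"
proof -
  obtain k1 where k1: "k1 \<in> A" "k1 \<noteq> i" "k1 \<noteq> j" "b k1 > 0" using assms by (auto simp: rel_edge_def)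
  obtain k2 where k2: "k2 \<in> A" "k2 \<noteq> i" "k2 \<noteq> j" "b k2 < 0" using assms by (auto simp: rel_edge_def)
  \<comment> \<open>The values 0 on the pair and -1 elsewhere pair with \<open>b\<close> to
    \<open>- B\<close>. Lowering the value at \<open>k1\<close> or at \<open>k2\<close>, according
    to the sign of \<open>B\<close>, makes them orthogonal to \<open>b\<close>.\<close>
  define B where "B = (\<Sum>k\<in>A. if k = i \<or> k = j then 0 else b k)"
  define u where "u = (if B \<le> 0 then - B / b k1 else 0)"
  define v where "v = (if B \<le> 0 then 0 else - B / b k2)"
  have uv: "u \<ge> 0" "v \<ge> 0" "b k1 * u + b k2 * v = - B"
    using k1 k2 by (auto simp: u_def v_def divide_nonpos_pos divide_nonneg_neg zero_le_divide_iff)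
  define x where "x k = (if k = i \<or> k = j then 0 else -1) - (if k = k1 then u else 0) - (if k = k2 then v else 0)" for k
  have "b k * x k = - (if k = i \<or> k = j then 0 else b k) - (if k = k1 then b k1 * u else 0)
      - (if k = k2 then b k2 * v else 0)" for k
    by (auto simp: x_def algebra_simps)
  then have "(\<Sum>k\<in>A. b k * x k) = - B - b k1 * u - b k2 * v"
    using finite_A k1 k2 by (simp add: sum_subtractf sum_negf B_def)
  then have "(\<Sum>k\<in>A. b k * x k) = 0" using uv(3) by simp
  from interpolation[OF this] obtain y s where y: "\<And>k. k \<in> A \<Longrightarrow> a k \<bullet> y + s = x k" by auto
  show ?thesis
  proof
    show "a i \<bullet> y + s = 0" "a j \<bullet> y + s = 0" using y assms k1 k2 by (auto simp: x_def)
    show "a k \<bullet> y + s \<le> -1" if "k \<in> A" "k \<noteq> i" "k \<noteq> j" for k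
      using y that uv by (auto simp: x_def)
  qed
qed

text \<open>An edge of the Newton polytope is exposed by a linear functional; far out in its direction the
  equation is a perturbation of a binomial, and the perturbed zero is a Brouwer fixed point.\<close>

lemma edge_wall_in_closure:
  assumes c: "\<And>i. i \<in> A \<Longrightarrow> c i \<noteq> 0"
    and ij: "i \<in> A" "j \<in> A" "i \<noteq> j" "rel_edge A b i j"
    and opp: "cis (phase a c i \<theta>) = - cis (phase a c j \<theta>)"
  shows "\<theta> \<in> closure (zero_args A a c)"
  unfolding closure_approachable
proof (intro allI impI)
  fix e :: real assume "e > 0"
  obtain \<delta> s where \<delta>: "a i \<bullet> \<delta> + s = 0" "a j \<bullet> \<delta> + s = 0"
    "\<And>k. k \<in> A \<Longrightarrow> k \<noteq> i \<Longrightarrow> k \<noteq> j \<Longrightarrow> a k \<bullet> \<delta> + s \<le> -1"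
    using exists_edge_functional[OF ij(1,2,4)] by blast
  define u where "u = a i - a j"
  have u: "u \<noteq> 0" using inj_a ij by (auto simp: u_def dest: inj_onD)
  define q where "q = u \<bullet> u"
  have q: "q > 0" using u by (simp add: q_def)
  \<comment> \<open>At \<open>y0\<close> the two edge terms have equal modulus, and being opposite
    they cancel exactly.\<close>
  define y0 where "y0 = (ln (norm (c j) / norm (c i)) / q) *\<^sub>R u"
  define d where "d k = c k * exp (Complex (a k \<bullet> y0) (a k \<bullet> \<theta>))" for k
  have nz: "d k \<noteq> 0" if "k \<in> A" for k using c[OF that] by (simp add: d_def)
  have "u \<bullet> y0 = ln (norm (c j) / norm (c i))" using q by (simp add: y0_def q_def)
  then have "a i \<bullet> y0 = ln (norm (c j) / norm (c i)) + a j \<bullet> y0" by (simp add: u_def inner_diff_left)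
  then have "norm (c i) * exp (a i \<bullet> y0) = norm (c j) * exp (a j \<bullet> y0)"
    using c[OF ij(1)] c[OF ij(2)] by (simp add: exp_add)
  then have dij: "d i = - d j"
    unfolding d_def exp_term_polar[of c i a y0 \<theta>, OF c[OF ij(1)]] exp_term_polar[of c j a y0 \<theta>, OF c[OF ij(2)]]
    by (simp add: opp)
  define A' where "A' = A - {i} - {j}"
  \<comment> \<open>The terms off the edge relative to term \<open>j\<close>, at distance
    \<open>R\<close> along \<open>\<delta>\<close> and with moduli and arguments displaced along
    \<open>u\<close> by the real and imaginary part of \<open>\<zeta>\<close>.\<close>
  define H where "H R \<zeta> = (\<Sum>k\<in>A'. of_real (exp (R * (a k \<bullet> \<delta> + s))) * (d k / d j) *
      exp (\<zeta> * of_real ((a k - a j) \<bullet> u)))" for R :: real and \<zeta>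
  define M where "M = (\<Sum>k\<in>A'. norm (d k / d j) * exp \<bar>(a k - a j) \<bullet> u\<bar>)"
  have "M \<ge> 0" by (auto simp: M_def intro!: sum_nonneg)
  have H_bound: "norm (H R \<zeta>) \<le> exp (- R) * M" if "R \<ge> 0" "norm \<zeta> \<le> 1" for R \<zeta>
    unfolding H_def M_def sum_distrib_left
  proof (rule sum_norm_le)
    fix k assume k: "k \<in> A'"
    then have "R * (a k \<bullet> \<delta> + s) \<le> R * (-1)" using \<delta>(3)[of k] that by (intro mult_left_mono) (auto simp: A'_def)
    then have 1: "exp (R * (a k \<bullet> \<delta> + s)) \<le> exp (- R)" by simp
    have "\<bar>Re \<zeta>\<bar> \<le> 1" using abs_Re_le_cmod[of \<zeta>] that by simp
    then have "\<bar>Re \<zeta>\<bar> * \<bar>(a k - a j) \<bullet> u\<bar> \<le> 1 * \<bar>(a k - a j) \<bullet> u\<bar>" by (intro mult_right_mono) auto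
    then have "Re \<zeta> * ((a k - a j) \<bullet> u) \<le> \<bar>(a k - a j) \<bullet> u\<bar>"
      by (metis abs_le_D1 abs_mult mult_1)
    then have 2: "norm (exp (\<zeta> * of_real ((a k - a j) \<bullet> u))) \<le> exp \<bar>(a k - a j) \<bullet> u\<bar>"
      by (simp add: norm_exp_eq_Re)
    have "norm (of_real (exp (R * (a k \<bullet> \<delta> + s))) * (d k / d j) * exp (\<zeta> * of_real ((a k - a j) \<bullet> u)))
      = exp (R * (a k \<bullet> \<delta> + s)) * (norm (d k / d j) * norm (exp (\<zeta> * of_real ((a k - a j) \<bullet> u))))"
      by (simp only: norm_mult norm_of_real abs_exp_cancel mult.assoc)
    also have "\<dots> \<le> exp (- R) * (norm (d k / d j) * exp \<bar>(a k - a j) \<bullet> u\<bar>)"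
      by (intro mult_mono 1 2 mult_left_mono) auto
    finally show "norm (of_real (exp (R * (a k \<bullet> \<delta> + s))) * (d k / d j) * exp (\<zeta> * of_real ((a k - a j) \<bullet> u)))
      \<le> exp (- R) * (norm (d k / d j) * exp \<bar>(a k - a j) \<bullet> u\<bar>)" .
  qed
  \<comment> \<open>The argument moves by \<open>Im \<zeta> *\<^sub>R u\<close>, so
    \<open>norm \<zeta> <= r\<close> keeps it within \<open>e\<close>; the bound 1 makes
    \<open>H_bound\<close> applicable.\<close>
  define r where "r = min 1 (e / (2 * norm u))"
  have r: "0 < r" "r \<le> 1" "r * norm u < e"
    using u \<open>e > 0\<close> by (auto simp: r_def min_def field_simps)
  have "isCont Ln 1" by (rule continuous_at_Ln) auto
  then have "\<exists>d>0. \<forall>z. dist z 1 < d \<longrightarrow> dist (Ln z) (Ln 1) < q * r"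
    unfolding continuous_at_eps_delta using mult_pos_pos[OF q r(1)] by blast
  then obtain \<eta> where \<eta>: "\<eta> > 0" "\<And>z. norm (z - 1) < \<eta> \<Longrightarrow> norm (Ln z) < q * r"
    by (auto simp: dist_norm)
  \<comment> \<open>Chosen for \<open>exp (- R) * M < min 1 \<eta>\<close>: smallness below 1 keeps
    \<open>1 + H R \<zeta>\<close> off the branch cut of \<open>Ln\<close>, smallness below
    \<open>\<eta>\<close> makes \<open>f\<close> map the disc into itself.\<close>
  define R where "R = \<bar>ln ((M + 1) / min 1 \<eta>)\<bar>"
  have "exp (- R) * M < min 1 \<eta>"
  proof -
    have "(M + 1) / min 1 \<eta> > 0" using \<eta>(1) \<open>M \<ge> 0\<close> by simp
    then have "(M + 1) / min 1 \<eta> = exp (ln ((M + 1) / min 1 \<eta>))" by (rule exp_ln[symmetric])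
    also have "\<dots> \<le> exp R" unfolding R_def exp_le_cancel_iff by (rule abs_ge_self)
    finally have "(M + 1) / min 1 \<eta> \<le> exp R" .
    then have "M + 1 \<le> min 1 \<eta> * exp R" using \<eta>(1) by (simp add: pos_divide_le_eq mult.commute)
    then have "M < min 1 \<eta> * exp R" by simp
    then have "exp (- R) * M < exp (- R) * (min 1 \<eta> * exp R)" by (rule mult_strict_left_mono) simp
    also have "\<dots> = min 1 \<eta> * (exp (- R) * exp R)" by (simp only: mult_ac)
    also have "exp (- R) * exp R = 1" by (simp add: exp_minus)
    finally show ?thesis by simp
  qed
  then have H_small: "norm (H R \<zeta>) < min 1 \<eta>" if "norm \<zeta> \<le> 1" for \<zeta>
    using H_bound[of R \<zeta>] that by (simp add: R_def)
  have Re_pos: "Re (1 + H R \<zeta>) > 0" if "norm \<zeta> \<le> 1" for \<zeta>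
  proof -
    have "\<bar>Re (H R \<zeta>)\<bar> < 1" using H_small[OF that] abs_Re_le_cmod[of "H R \<zeta>"] by simp
    then show ?thesis by (simp add: abs_less_iff)
  qed
  \<comment> \<open>The equation for the displacement is
    \<open>exp (\<zeta> * q) = 1 + H R \<zeta>\<close>; its logarithm is a fixed point
    equation.\<close>
  define f where "f \<zeta> = Ln (1 + H R \<zeta>) / of_real q" for \<zeta>
  have "continuous_on (cball 0 r) (\<lambda>\<zeta>. 1 + H R \<zeta>)" unfolding H_def by (intro continuous_intros)
  moreover have "1 + H R \<zeta> \<notin> \<real>\<^sub>\<le>\<^sub>0" if "\<zeta> \<in> cball 0 r" for \<zeta>
    using Re_pos[of \<zeta>] that r by (auto simp: complex_nonpos_Reals_iff)
  ultimately have "continuous_on (cball 0 r) (\<lambda>\<zeta>. Ln (1 + H R \<zeta>))"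
    by (rule continuous_on_Ln')
  then have "continuous_on (cball 0 r) f"
    unfolding f_def using q by (intro continuous_on_divide continuous_on_const) auto
  moreover have "f \<in> cball 0 r \<rightarrow> cball 0 r"
  proof
    fix \<zeta> :: complex assume "\<zeta> \<in> cball 0 r"
    then have "norm (H R \<zeta>) < \<eta>" using H_small[of \<zeta>] r by simp
    then have "norm (Ln (1 + H R \<zeta>)) < q * r" by (intro \<eta>(2)) simp
    then show "f \<zeta> \<in> cball 0 r" using q by (simp add: f_def norm_divide pos_divide_le_eq mult.commute)
  qed
  ultimately obtain \<zeta> where \<zeta>: "\<zeta> \<in> cball 0 r" "f \<zeta> = \<zeta>"
    using brouwer_ball[OF r(1)] by blast
  have "Re (1 + H R \<zeta>) > 0" using Re_pos[of \<zeta>] \<zeta>(1) r(2) by simp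
  then have "1 + H R \<zeta> \<noteq> 0" by (metis zero_complex.sel(1) less_irrefl)
  moreover have "Ln (1 + H R \<zeta>) = \<zeta> * of_real q" using \<zeta>(2) q by (simp add: f_def divide_eq_eq)
  ultimately have fp: "exp (\<zeta> * of_real q) = 1 + H R \<zeta>" by (metis exp_Ln)
  define \<theta>' where "\<theta>' = \<theta> + Im \<zeta> *\<^sub>R u"
  define x where "x = y0 + R *\<^sub>R \<delta> + Re \<zeta> *\<^sub>R u"
  \<comment> \<open>The factor common to all terms. Without it, term \<open>j\<close> is 1 and term
    \<open>i\<close> is \<open>- exp (\<zeta> * q)\<close>, by \<open>dij\<close>.\<close>
  define E where "E = of_real (exp (- R * s)) * d j * exp (\<zeta> * of_real (a j \<bullet> u))"
  have term_eq: "c k * exp (Complex (a k \<bullet> x) (a k \<bullet> \<theta>')) =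
      E * (of_real (exp (R * (a k \<bullet> \<delta> + s))) * (d k / d j) * exp (\<zeta> * of_real ((a k - a j) \<bullet> u)))" for k
  proof -
    have "Complex (a k \<bullet> x) (a k \<bullet> \<theta>') = Complex (a k \<bullet> y0) (a k \<bullet> \<theta>) +
        (of_real (- R * s) + (\<zeta> * of_real (a j \<bullet> u) + (of_real (R * (a k \<bullet> \<delta> + s)) + \<zeta> * of_real ((a k - a j) \<bullet> u))))"
      by (simp add: complex_eq_iff x_def \<theta>'_def inner_add_right inner_diff_left algebra_simps)
    then have "c k * exp (Complex (a k \<bullet> x) (a k \<bullet> \<theta>')) = d k *
        (exp (of_real (- R * s)) * (exp (\<zeta> * of_real (a j \<bullet> u)) * (exp (of_real (R * (a k \<bullet> \<delta> + s))) * exp (\<zeta> * of_real ((a k - a j) \<bullet> u)))))"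
      by (simp only: exp_add d_def mult.assoc)
    then show ?thesis using nz[OF ij(2)] by (simp only: exp_of_real E_def) (simp add: field_simps)
  qed
  have "(\<Sum>k\<in>A. c k * exp (Complex (a k \<bullet> x) (a k \<bullet> \<theta>'))) =
      E * (\<Sum>k\<in>A. of_real (exp (R * (a k \<bullet> \<delta> + s))) * (d k / d j) * exp (\<zeta> * of_real ((a k - a j) \<bullet> u)))"
    by (simp only: term_eq sum_distrib_left)
  also have "(\<Sum>k\<in>A. of_real (exp (R * (a k \<bullet> \<delta> + s))) * (d k / d j) * exp (\<zeta> * of_real ((a k - a j) \<bullet> u)))
     = - exp (\<zeta> * of_real q) + (1 + H R \<zeta>)"
    using finite_A ij nz[OF ij(2)]
    by (simp add: sum.remove[of A i] sum.remove[of "A - {i}" j] H_def A'_def \<delta> dij q_def u_def[symmetric])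
  finally have "\<theta>' \<in> zero_args A a c" by (auto simp: zero_args_def fp)
  moreover have "dist \<theta>' \<theta> < e"
  proof -
    have "\<bar>Im \<zeta>\<bar> \<le> r" using \<zeta>(1) abs_Im_le_cmod[of \<zeta>] by simp
    then have "\<bar>Im \<zeta>\<bar> * norm u \<le> r * norm u" by (intro mult_right_mono) auto
    then show ?thesis using r(3) by (simp add: \<theta>'_def dist_norm)
  qed
  ultimately show "\<exists>z\<in>zero_args A a c. dist z \<theta> < e" by blast
qed

lemma continuous_lift_phase [continuous_intros]: "continuous_on S (lift_phase a c m i)"
  unfolding lift_phase_def phase_def by (intro continuous_intros)

lemma open_cell: "open (cell A a b c m)"
proof -
  have "cell A a b c m = (\<Inter>i\<in>A. \<Inter>j\<in>A. {\<theta>. rel_edge A b i j \<longrightarrow> \<bar>lift_phase a c m i \<theta> - lift_phase a c m j \<theta>\<bar> < pi})"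
    by (auto simp: cell_def)
  moreover have "open {\<theta>. rel_edge A b i j \<longrightarrow> \<bar>lift_phase a c m i \<theta> - lift_phase a c m j \<theta>\<bar> < pi}" for i j
    by (cases "rel_edge A b i j") (auto intro!: open_Collect_less continuous_intros)
  ultimately show ?thesis using finite_A by (simp add: open_INT)
qed

lemma open_lopsided_cell: "open (lopsided_cell A a c m)"
proof -
  have "lopsided_cell A a c m = (\<Inter>i\<in>A. \<Inter>j\<in>A. {\<theta>. \<bar>lift_phase a c m i \<theta> - lift_phase a c m j \<theta>\<bar> < pi})"
    by (auto simp: lopsided_cell_def)
  then show ?thesis using finite_A
    by (auto intro!: open_INT open_Collect_less continuous_intros)
qed

lemma closure_cell_le:
  assumes "\<theta> \<in> closure (cell A a b c m)" "i \<in> A" "j \<in> A" "rel_edge A b i j"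
  shows "\<bar>lift_phase a c m i \<theta> - lift_phase a c m j \<theta>\<bar> \<le> pi"
proof -
  have "closed {\<theta>. \<bar>lift_phase a c m i \<theta> - lift_phase a c m j \<theta>\<bar> \<le> pi}"
    by (intro closed_Collect_le continuous_intros)
  moreover have "cell A a b c m \<subseteq> {\<theta>. \<bar>lift_phase a c m i \<theta> - lift_phase a c m j \<theta>\<bar> \<le> pi}"
    using assms(2-4) by (auto simp: cell_def less_imp_le)
  ultimately show ?thesis using closure_minimal assms(1) by blast
qed

text \<open>A generic point of a small ball that misses the closure lies in some cell. If the centre
  did not, the ball would meet the frontier of that cell, where the terms of some edge are exactly
  opposite; but such points lie in the closure.\<close>

lemma complement_subset_cells:
  assumes c: "\<And>i. i \<in> A \<Longrightarrow> c i \<noteq> 0" and \<theta>: "\<theta> \<notin> closure (zero_args A a c)"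
  shows "\<exists>m. \<theta> \<in> cell A a b c m"
proof -
  have "open (- closure (zero_args A a c))" by auto
  then obtain r where r: "r > 0" "ball \<theta> r \<subseteq> - closure (zero_args A a c)"
    using \<theta> by (meson ComplI open_contains_ball)
  obtain \<phi> where \<phi>: "\<phi> \<in> ball \<theta> r" "\<And>i j. i \<in> A \<Longrightarrow> j \<in> A \<Longrightarrow> i \<noteq> j \<Longrightarrow> sin (phase a c i \<phi> - phase a c j \<phi>) \<noteq> 0"
    using exists_generic[of "ball \<theta> r" c] r(1) by auto
  then have "\<phi> \<notin> zero_args A a c" using r(2) closure_subset by blast
  then obtain m where m: "\<phi> \<in> cell A a b c m" using generic_in_cell[OF c _ \<phi>(2)] by blast
  have "\<theta> \<in> cell A a b c m"
  proof (rule ccontr)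
    assume "\<theta> \<notin> cell A a b c m"
    then have "ball \<theta> r - cell A a b c m \<noteq> {}" using r(1) by (auto intro: centre_in_ball[THEN iffD2])
    from connected_Int_frontier[OF connected_ball _ this] obtain z where z: "z \<in> ball \<theta> r" "z \<in> frontier (cell A a b c m)"
      using \<phi>(1) m by blast
    then have "z \<in> closure (cell A a b c m)" "z \<notin> cell A a b c m"
      using open_cell[of c m] by (auto simp: frontier_def interior_open)
    then obtain i j where ij: "i \<in> A" "j \<in> A" "rel_edge A b i j"
      "\<not> \<bar>lift_phase a c m i z - lift_phase a c m j z\<bar> < pi"
      by (auto simp: cell_def)
    moreover have "\<bar>lift_phase a c m i z - lift_phase a c m j z\<bar> \<le> pi"
      by (rule closure_cell_le[OF \<open>z \<in> closure _\<close> ij(1-3)])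
    ultimately have abs: "\<bar>lift_phase a c m i z - lift_phase a c m j z\<bar> = pi" by simp
    then have "i \<noteq> j" by auto
    have "lift_phase a c m i z = lift_phase a c m j z + pi \<or> lift_phase a c m i z = lift_phase a c m j z - pi"
      using abs by linarith
    then have "cis (lift_phase a c m i z) = - cis (lift_phase a c m j z)"
      by (auto simp: complex_eq_iff)
    then have "z \<in> closure (zero_args A a c)"
      using edge_wall_in_closure[of c i j z] c ij \<open>i \<noteq> j\<close> by (simp add: cis_lift_phase)
    then show False using z(1) r(2) by blast
  qed
  then show ?thesis by blast
qed

end

section \<open>Connectedness of the complement inside a cell\<close>

lemma DERIV_ln_sin_affine:
  fixes w g t :: real
  assumes "sin (w + g * t) > 0"
  shows "DERIV (\<lambda>t. ln (sin (w + g * t))) t :> g * (cos (w + g * t) / sin (w + g * t))"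
proof -
  have "DERIV (\<lambda>t. w + g * t) t :> g" by (auto intro!: derivative_eq_intros)
  from DERIV_fun_sin[OF this] have "DERIV (\<lambda>t. sin (w + g * t)) t :> cos (w + g * t) * g" .
  from DERIV_chain2[OF DERIV_ln[OF assms] this] show ?thesis
    by (rule back_subst) (simp add: divide_inverse mult_ac)
qed

text \<open>By the law of sines the quotients of sines are the coefficients with which two
  directions balance a fixed resultant. Writing S, T, W for the sines of x, y, x + y and C for cos
  (x + y), the derivative is \<open>((\<alpha> T - \<beta> S)^2 + 2 \<alpha> \<beta> S T (1 - C)) /
  (S T W)\<close>, which is nonnegative.\<close>

lemma sin_log_quotient_mono:
  fixes \<alpha> \<beta> u v s :: real
  assumes "\<alpha> > 0" "\<beta> > 0" "u > 0" "v > 0" "s \<ge> 0" and lt: "u + v + (\<alpha> + \<beta>) * s < pi"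
  shows "\<alpha> * ln (sin u) + \<beta> * ln (sin v) - (\<alpha> + \<beta>) * ln (sin (u + v))
    \<le> \<alpha> * ln (sin (u + \<alpha> * s)) + \<beta> * ln (sin (v + \<beta> * s)) - (\<alpha> + \<beta>) * ln (sin (u + v + (\<alpha> + \<beta>) * s))"
proof -
  define F where "F t = \<alpha> * ln (sin (u + \<alpha> * t)) + \<beta> * ln (sin (v + \<beta> * t))
    - (\<alpha> + \<beta>) * ln (sin (u + v + (\<alpha> + \<beta>) * t))" for t
  have deriv: "\<exists>y. DERIV F t :> y \<and> y \<ge> 0" if t: "0 \<le> t" "t \<le> s" for t
  proof -
    define x where "x = u + \<alpha> * t"
    define y where "y = v + \<beta> * t"
    have "\<alpha> * t \<ge> 0" "\<beta> * t \<ge> 0" using assms t by auto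
    then have xy: "x > 0" "y > 0" using assms by (auto simp: x_def y_def)
    have "(\<alpha> + \<beta>) * t \<le> (\<alpha> + \<beta>) * s" using assms t by (intro mult_left_mono) auto
    then have xy2: "x + y < pi" using lt by (simp add: x_def y_def distrib_right)
    have sum: "u + v + (\<alpha> + \<beta>) * t = x + y" by (simp add: x_def y_def distrib_right)
    have pos: "sin x > 0" "sin y > 0" "sin (x + y) > 0" using xy xy2 by (auto intro!: sin_gt_zero)
    define D where "D = \<alpha> * (\<alpha> * (cos x / sin x)) + \<beta> * (\<beta> * (cos y / sin y))
      - (\<alpha> + \<beta>) * ((\<alpha> + \<beta>) * (cos (x + y) / sin (x + y)))"
    have "DERIV (\<lambda>t. ln (sin (u + \<alpha> * t))) t :> \<alpha> * (cos x / sin x)"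
      using DERIV_ln_sin_affine[of u \<alpha> t] pos(1) unfolding x_def .
    moreover have "DERIV (\<lambda>t. ln (sin (v + \<beta> * t))) t :> \<beta> * (cos y / sin y)"
      using DERIV_ln_sin_affine[of v \<beta> t] pos(2) unfolding y_def .
    moreover have "DERIV (\<lambda>t. ln (sin (u + v + (\<alpha> + \<beta>) * t))) t :> (\<alpha> + \<beta>) * (cos (x + y) / sin (x + y))"
      using DERIV_ln_sin_affine[of "u + v" "\<alpha> + \<beta>" t] pos(3) unfolding sum .
    ultimately have "DERIV F t :> D"
      unfolding F_def D_def by (intro DERIV_diff DERIV_add DERIV_cmult)
    moreover have "D \<ge> 0"
    proof -
      have quot: "C1 / S = C2 / W + T / (S * W)"
        if "C1 * W - S * C2 = T" "S > 0" "W > 0" for C1 C2 S T W :: real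
        using that by (simp add: field_simps)
      have cx: "cos x / sin x = cos (x + y) / sin (x + y) + sin y / (sin x * sin (x + y))"
        by (rule quot) (use pos sin_diff[of "x + y" x] in \<open>simp_all add: mult.commute\<close>)
      have cy: "cos y / sin y = cos (x + y) / sin (x + y) + sin x / (sin y * sin (x + y))"
        by (rule quot) (use pos sin_diff[of "x + y" y] in \<open>simp_all add: mult.commute\<close>)
      define S T W C where "S = sin x" "T = sin y" "W = sin (x + y)" "C = cos (x + y)"
      have STW: "S > 0" "T > 0" "W > 0" "C \<le> 1" using pos by (simp_all add: S_T_W_C_def)
      have "D = \<alpha> * (\<alpha> * (C / W + T / (S * W))) + \<beta> * (\<beta> * (C / W + S / (T * W)))
          - (\<alpha> + \<beta>) * ((\<alpha> + \<beta>) * (C / W))"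
        by (simp add: D_def cx cy S_T_W_C_def)
      also have "\<dots> = ((\<alpha> * T - \<beta> * S)\<^sup>2 + 2 * \<alpha> * \<beta> * S * T * (1 - C)) / (S * T * W)"
        using STW by (simp add: field_simps power2_eq_square)
      finally have "D = ((\<alpha> * T - \<beta> * S)\<^sup>2 + 2 * \<alpha> * \<beta> * S * T * (1 - C)) / (S * T * W)" .
      then show ?thesis using STW assms by simp
    qed
    ultimately show ?thesis by blast
  qed
  have "F 0 \<le> F s" by (rule DERIV_nonneg_imp_nondecreasing[OF assms(5)]) (rule deriv)
  then show ?thesis by (simp add: F_def)
qed

lemma complex_eq_0_of_projections:
  assumes "Im (Z * cis (- x)) = 0" "Im (Z * cis (- y)) = 0" "sin (x - y) \<noteq> 0"
  shows "Z = 0"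
proof -
  have 1: "Im Z * cos x = Re Z * sin x" "Im Z * cos y = Re Z * sin y"
    using assms(1,2) by (auto simp: algebra_simps)
  have "Re Z * sin (x - y) = (Re Z * sin x) * cos y - cos x * (Re Z * sin y)"
    by (simp add: sin_diff algebra_simps)
  also have "\<dots> = 0" by (simp add: 1[symmetric])
  finally have "Re Z = 0" using assms(3) by simp
  have "Im Z * sin (x - y) = sin x * (Im Z * cos y) - (Im Z * cos x) * sin y"
    by (simp add: sin_diff algebra_simps)
  also have "\<dots> = 0" by (simp only: 1 \<open>Re Z = 0\<close> mult_zero_left mult_zero_right diff_self)
  finally have "Im Z = 0" using assms(3) by simp
  with \<open>Re Z = 0\<close> show ?thesis by (simp add: complex_eq_iff)
qed

lemma Im_sum_cis: "Im ((\<Sum>k\<in>J. of_real (p k) * cis (y k)) * cis t) = (\<Sum>k\<in>J. p k * sin (y k + t))"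
proof -
  have "(\<Sum>k\<in>J. of_real (p k) * cis (y k)) * cis t = (\<Sum>k\<in>J. of_real (p k) * cis (y k + t))"
    by (simp only: sum_distrib_right mult.assoc cis_mult)
  then show ?thesis by simp
qed

text \<open>If \<open>n1\<close> and \<open>n2\<close> are the only negative coefficients and the remaining terms point into the
  opposite of the sector spanned by the terms \<open>n1\<close> and \<open>n2\<close>, then closing the sector
  (with the relation between the phases preserved) can only destroy zeros.\<close>

lemma shifted_relation_imp_relation:
  fixes b p y :: "'i \<Rightarrow> real"
  assumes A: "finite A" and n: "n1 \<in> A" "n2 \<in> A" "n1 \<noteq> n2" "b n1 < 0" "b n2 < 0"
    and j: "j0 \<in> A" "b j0 > 0" "j1 \<in> A" "j1 \<noteq> j0" "b j1 > 0"
    and y1: "\<And>k. k \<in> A - {n1, n2} \<Longrightarrow> y k < y n1 + pi"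
    and y2: "\<And>k. k \<in> A - {n1, n2} \<Longrightarrow> y n2 - pi < y k"
    and s: "s \<ge> 0" "y n2 - y n1 - (- b n1 - b n2) * s > pi"
    and p: "\<And>k. k \<in> A \<Longrightarrow> p k > 0"
    and p0: "(\<Sum>k\<in>A. of_real (p k) * cis ((y(n1 := y n1 - b n2 * s, n2 := y n2 + b n1 * s)) k)) = 0"
    and l: "(\<Sum>k\<in>A. b k * ln (p k)) = l"
  shows "\<exists>r. (\<forall>k\<in>A. r k > 0) \<and> (\<Sum>k\<in>A. of_real (r k) * cis (y k)) = 0 \<and> (\<Sum>k\<in>A. b k * ln (r k)) = l"
proof -
  define J where "J = A - {n1, n2}"
  have finJ: "finite J" using A by (simp add: J_def)
  have jJ: "j0 \<in> J" "j1 \<in> J" using j n by (auto simp: J_def)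
  have split: "(\<Sum>k\<in>A. f k) = (\<Sum>k\<in>J. f k) + f n1 + f n2" for f :: "'i \<Rightarrow> 'b::comm_monoid_add"
  proof -
    have "(\<Sum>k\<in>A. f k) = f n1 + (f n2 + (\<Sum>k\<in>A - {n1} - {n2}. f k))"
      using A n by (subst sum.remove[of A n1], simp, simp, subst sum.remove[of "A - {n1}" n2]) auto
    moreover have "A - {n1} - {n2} = J" by (auto simp: J_def)
    ultimately show ?thesis by (simp only: add_ac)
  qed
  define a1 a2 where "a1 = - b n1" "a2 = - b n2"
  have a: "a1 > 0" "a2 > 0" using n by (simp_all add: a1_a2_def)
  \<comment> \<open>The angle from direction \<open>n2\<close> on to direction \<open>n1\<close>,
    past a full turn; it is below pi because the lifted phases differ by more than pi.\<close>
  define d where "d = 2 * pi - (y n2 - y n1)"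
  have as: "(a1 + a2) * s \<ge> 0" using a s by simp
  have ds: "d + (a1 + a2) * s < pi" using s(2) by (simp add: d_def a1_a2_def algebra_simps)
  have "y n2 - pi < y n1 + pi" using y1[of j0] y2[of j0] jJ by (simp add: J_def)
  then have d: "d > 0" "d < pi" using ds as by (auto simp: d_def)
  have sind: "sin d > 0" using d by (rule sin_gt_zero)
  have sd: "sin (y n1 - y n2) = sin d" "sin (y n2 - y n1) = - sin d"
    by (simp_all add: d_def sin_diff)
  have X_pos: "sin (y n2 - y k) > 0" and Y_pos: "sin (y k - y n1) > 0" if "k \<in> J" for k
    using y1[of k] y2[of k] that d by (auto simp: J_def d_def intro!: sin_gt_zero)
  \<comment> \<open>Cramer's rule determines the coefficients at \<open>n1\<close> and
    \<open>n2\<close> that complete given coefficients on \<open>J\<close> to a relation at the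
    phases \<open>y\<close>.\<close>
  define compl where "compl g = g(n1 := (\<Sum>k\<in>J. g k * sin (y n2 - y k)) / sin d,
    n2 := (\<Sum>k\<in>J. g k * sin (y k - y n1)) / sin d)" for g
  have compl_J: "compl g k = g k" if "k \<in> J" for g k using that by (auto simp: compl_def J_def)
  have compl_rel: "(\<Sum>k\<in>A. of_real (compl g k) * cis (y k)) = 0" for g
  proof (rule complex_eq_0_of_projections)
    have im: "Im ((\<Sum>k\<in>A. of_real (compl g k) * cis (y k)) * cis t) =
       (\<Sum>k\<in>J. g k * sin (y k + t)) + compl g n1 * sin (y n1 + t) + compl g n2 * sin (y n2 + t)" for t
      unfolding Im_sum_cis split[of "\<lambda>k. compl g k * sin (y k + t)"] by (simp add: compl_J)
    have neg: "(\<Sum>k\<in>J. g k * sin (y k - y n2)) = - (\<Sum>k\<in>J. g k * sin (y n2 - y k))"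
      unfolding sum_negf[symmetric] mult_minus_right[symmetric] sin_minus[symmetric] by simp
    show "Im ((\<Sum>k\<in>A. of_real (compl g k) * cis (y k)) * cis (- y n1)) = 0"
      unfolding im using n sind sd by (simp add: compl_def)
    show "Im ((\<Sum>k\<in>A. of_real (compl g k) * cis (y k)) * cis (- y n2)) = 0"
      unfolding im using n sind sd by (simp add: compl_def neg)
    show "sin (y n1 - y n2) \<noteq> 0" using sd sind by simp
  qed
  have wsum_pos: "(\<Sum>k\<in>J. g k * h k) > 0"
    if "\<And>k. k \<in> J \<Longrightarrow> g k \<ge> 0" "g k0 > 0" "k0 \<in> J" "\<And>k. k \<in> J \<Longrightarrow> h k > 0" for g h :: "'i \<Rightarrow> real" and k0
    by (rule sum_pos2[OF finJ that(3)]) (use that in \<open>auto intro: mult_nonneg_nonneg less_imp_le\<close>)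
  have compl_pos: "compl g n1 > 0" "compl g n2 > 0"
    if "\<And>k. k \<in> J \<Longrightarrow> g k \<ge> 0" "g k0 > 0" "k0 \<in> J" for g k0
  proof -
    have "(\<Sum>k\<in>J. g k * sin (y n2 - y k)) > 0" "(\<Sum>k\<in>J. g k * sin (y k - y n1)) > 0"
      by (rule wsum_pos[of g k0]; use that X_pos Y_pos in blast)+
    then show "compl g n1 > 0" "compl g n2 > 0" using sind n by (auto simp: compl_def)
  qed
  have pJ: "p k > 0" "p k \<ge> 0" if "k \<in> J" for k using p[of k] that by (auto simp: J_def)
  \<comment> \<open>The vector that the terms \<open>n1\<close> and \<open>n2\<close> must produce,
    in coordinates where \<open>n2\<close> is the positive real axis; \<open>u\<close> and
    \<open>v\<close> are its angles to \<open>n2\<close> and to \<open>n1\<close>.\<close>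
  define K where "K = - (\<Sum>k\<in>J. of_real (p k) * cis (y k - y n2))"
  define R where "R = norm K"
  define u where "u = Arg K"
  define v where "v = d - u"
  have K: "K = of_real R * cis u" using rcis_cmod_Arg[of K] by (simp add: R_def u_def rcis_def)
  have ImK: "R * sin (u + t) = (\<Sum>k\<in>J. p k * sin (y n2 - t - y k))" for t
  proof -
    have "R * sin (u + t) = Im (K * cis t)" by (simp add: K sin_add algebra_simps)
    also have "\<dots> = - (\<Sum>k\<in>J. p k * sin (y k - y n2 + t))"
      by (simp only: K_def mult_minus_left uminus_complex.sel Im_sum_cis)
    also have "\<dots> = (\<Sum>k\<in>J. p k * sin (y n2 - t - y k))"
      unfolding sum_negf[symmetric] mult_minus_right[symmetric] sin_minus[symmetric] by (simp add: algebra_simps)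
    finally show ?thesis .
  qed
  have ImK': "R * sin (v + t) = (\<Sum>k\<in>J. p k * sin (y k - (y n1 + t)))" for t
  proof -
    have "v + t = 2 * pi - (u + (y n2 - y n1 - t))" by (simp add: v_def d_def)
    then have "sin (v + t) = - sin (u + (y n2 - y n1 - t))" by (simp only: sin_2pi_minus)
    then have "R * sin (v + t) = - (R * sin (u + (y n2 - y n1 - t)))" by simp
    also have "\<dots> = (\<Sum>k\<in>J. p k * sin (y k - (y n1 + t)))"
      unfolding ImK sum_negf[symmetric] mult_minus_right[symmetric] sin_minus[symmetric] by (simp add: algebra_simps)
    finally show ?thesis .
  qed
  have Rsinu: "R * sin u = (\<Sum>k\<in>J. p k * sin (y n2 - y k))" using ImK[of 0] by simp
  have Rsinv: "R * sin v = (\<Sum>k\<in>J. p k * sin (y k - y n1))" using ImK'[of 0] by simp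
  have "R * sin u > 0" "R * sin v > 0" unfolding Rsinu Rsinv
    by (rule wsum_pos[of p j0]; use pJ jJ X_pos Y_pos in blast)+
  moreover have "R \<ge> 0" by (simp add: R_def)
  ultimately have R: "R > 0" "sin u > 0" and sv: "sin v > 0"
    by (auto simp: zero_less_mult_iff)
  have u: "0 < u" "u < pi"
  proof -
    have "Im K > 0" using R K by simp
    then show "0 < u" "u < pi" using Arg_lt_pi[of K] by (auto simp: u_def)
  qed
  have v: "0 < v"
  proof (rule ccontr)
    assume "\<not> 0 < v"
    then have "0 \<le> sin (- v)" using u d by (intro sin_ge_zero) (auto simp: v_def)
    with sv show False by simp
  qed
  have uv: "u + v = d" by (simp add: v_def)
  have uvs: "u + v + (a1 + a2) * s < pi" using ds by (simp add: uv)
  have as': "0 \<le> a1 * s" "0 \<le> a2 * s" "(a1 + a2) * s = a1 * s + a2 * s" using a s by (auto simp: distrib_right)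
  \<comment> \<open>The sector angle at the shifted phases. The shift adds \<open>a1 * s\<close> to
    the angle \<open>u\<close> and \<open>a2 * s\<close> to \<open>v\<close>, while the resultant of
    \<open>J\<close> stays fixed.\<close>
  define e where "e = u + v + (a1 + a2) * s"
  have e: "0 < e" "e < pi" using u v as uvs by (auto simp: e_def)
  have sine: "sin e > 0" using e by (rule sin_gt_zero)
  have us: "sin (u + a1 * s) > 0" "sin (v + a2 * s) > 0"
    by (rule sin_gt_zero; use u v as' uvs in linarith)+
  define y' where "y' = y(n1 := y n1 + a2 * s, n2 := y n2 - a1 * s)"
  have p0': "(\<Sum>k\<in>A. of_real (p k) * cis (y' k)) = 0" using p0 by (simp add: y'_def a1_a2_def)
  have y'J: "y' k = y k" if "k \<in> J" for k using that by (auto simp: y'_def J_def)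
  have y'n: "y' n1 = y n1 + a2 * s" "y' n2 = y n2 - a1 * s" using n by (auto simp: y'_def)
  have proj: "(\<Sum>k\<in>J. p k * sin (y k - w)) + p n1 * sin (y n1 + a2 * s - w) + p n2 * sin (y n2 - a1 * s - w) = 0" for w
  proof -
    have "Im ((\<Sum>k\<in>A. of_real (p k) * cis (y' k)) * cis (- w)) = (\<Sum>k\<in>A. p k * sin (y' k + - w))"
      by (rule Im_sum_cis)
    then have "(\<Sum>k\<in>A. p k * sin (y' k - w)) = 0" by (simp add: p0')
    then show ?thesis unfolding split[of "\<lambda>k. p k * sin (y' k - w)"] by (simp add: y'J y'n)
  qed
  have se: "sin (y n1 + a2 * s - (y n2 - a1 * s)) = sin e" "sin (y n2 - a1 * s - (y n1 + a2 * s)) = - sin e"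
  proof -
    have "e = 2 * pi - (y n2 - a1 * s - (y n1 + a2 * s))" by (simp add: e_def uv d_def algebra_simps)
    then have "sin e = - sin (y n2 - a1 * s - (y n1 + a2 * s))" by (simp only: sin_2pi_minus)
    then show *: "sin (y n2 - a1 * s - (y n1 + a2 * s)) = - sin e" by simp
    show "sin (y n1 + a2 * s - (y n2 - a1 * s)) = sin e"
      using * sin_minus[of "y n2 - a1 * s - (y n1 + a2 * s)"] by (simp only: minus_diff_eq minus_minus)
  qed
  have pn1: "p n1 * sin e = R * sin (u + a1 * s)"
  proof -
    have "R * sin (u + a1 * s) = - (\<Sum>k\<in>J. p k * sin (y k - (y n2 - a1 * s)))"
      unfolding ImK sum_negf[symmetric] mult_minus_right[symmetric] sin_minus[symmetric] by simp
    then show ?thesis using proj[of "y n2 - a1 * s"] unfolding se diff_self sin_zero mult_zero_right by linarith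
  qed
  have pn2: "p n2 * sin e = R * sin (v + a2 * s)"
    using proj[of "y n1 + a2 * s"] unfolding ImK' se diff_self sin_zero mult_zero_right mult_minus_right by linarith
  \<comment> \<open>The same coefficients on \<open>J\<close>, now balanced at the unshifted
    phases.\<close>
  define P where "P = compl p"
  have PJ: "P k = p k" if "k \<in> J" for k using that by (simp add: P_def compl_J)
  have P1: "P n1 * sin (u + v) = R * sin u" "P n2 * sin (u + v) = R * sin v"
    unfolding Rsinu Rsinv uv using sind n by (simp_all add: P_def compl_def)
  have Pn: "P n1 > 0" "P n2 > 0"
    unfolding P_def by (rule compl_pos[of p j0]; use pJ jJ in blast)+
  have Ppos: "P k > 0" if "k \<in> A" for k
    using Pn PJ[of k] pJ[of k] that by (cases "k \<in> J") (auto simp: J_def)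
  have suv: "sin (u + v) > 0" using sind by (simp add: uv)
  have lnq: "t * ln x = t * ln R + t * ln z - t * ln w" if "x * w = R * z" "x > 0" "z > 0" "w > 0" for t x z w
  proof -
    have "ln (x * w) = ln x + ln w" "ln (R * z) = ln R + ln z" using that(2-4) R(1) by (simp_all add: ln_mult)
    then have "ln x = ln R + ln z - ln w" using that(1) by simp
    then show ?thesis by (simp only: distrib_left right_diff_distrib)
  qed
  \<comment> \<open>The law of sines writes all four coefficients as \<open>R\<close> times a
    quotient of sines; the terms with \<open>ln R\<close> cancel and the monotonicity estimate
    compares the rest.\<close>
  have le: "a1 * ln (P n1) + a2 * ln (P n2) \<le> a1 * ln (p n1) + a2 * ln (p n2)"
  proof -
    note lnq[OF P1(1) Pn(1) R(2) suv, of a1] lnq[OF P1(2) Pn(2) sv suv, of a2]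
      lnq[OF pn1 p[OF n(1)] us(1) sine, of a1] lnq[OF pn2 p[OF n(2)] us(2) sine, of a2]
    moreover have "a1 * ln (sin u) + a2 * ln (sin v) - (a1 * ln (sin (u + v)) + a2 * ln (sin (u + v)))
      \<le> a1 * ln (sin (u + a1 * s)) + a2 * ln (sin (v + a2 * s)) - (a1 * ln (sin e) + a2 * ln (sin e))"
      using sin_log_quotient_mono[OF a u(1) v s(1) uvs, folded e_def] by (simp only: distrib_right)
    ultimately show ?thesis by linarith
  qed
  have "(\<Sum>k\<in>A. b k * ln (P k)) = (\<Sum>k\<in>J. b k * ln (p k)) - a1 * ln (P n1) - a2 * ln (P n2)"
    unfolding split[of "\<lambda>k. b k * ln (P k)"] by (simp add: PJ a1_a2_def)
  moreover have "l = (\<Sum>k\<in>J. b k * ln (p k)) - a1 * ln (p n1) - a2 * ln (p n2)"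
    unfolding l[symmetric] split[of "\<lambda>k. b k * ln (p k)"] by (simp add: a1_a2_def)
  ultimately have Pl: "(\<Sum>k\<in>A. b k * ln (P k)) \<ge> l" using le by linarith
  \<comment> \<open>With \<open>j0\<close> dropped, \<open>j1\<close> still contributes, which keeps
    the completed coefficients at \<open>n1\<close> and \<open>n2\<close> positive.\<close>
  define q where "q = compl (p(j0 := 0))"
  have qj: "q j0 = 0" using jJ(1) compl_J by (simp add: q_def)
  have qn: "q n1 > 0" "q n2 > 0"
    unfolding q_def by (rule compl_pos[of _ j1]; use pJ jJ j in auto)+
  have qpos: "q k > 0" if "k \<in> A - {j0}" for k
  proof (cases "k \<in> J")
    case True
    then show ?thesis using that pJ by (simp add: q_def compl_J)
  next
    case False
    then show ?thesis using that qn by (auto simp: J_def)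
  qed
  show ?thesis
    by (rule positive_relation_level[of A j0 b P "\<lambda>k. cis (y k)" l q])
      (use A j Ppos Pl qj qpos compl_rel in \<open>auto simp: P_def q_def\<close>)
qed

context affine_relation
begin

lemma shift_bounds:
  fixes y :: "'i \<Rightarrow> real"
  assumes "y k < y n1 + pi" "y n2 - pi < y k" "\<alpha> \<ge> 0" "\<beta> \<ge> 0" "y n2 - \<alpha> - (y n1 + \<beta>) > 0"
  shows "\<bar>y k - (y n1 + \<beta>)\<bar> < pi" "\<bar>y k - (y n2 - \<alpha>)\<bar> < pi"
  using assms by (auto simp: abs_less_iff)

text \<open>Three cases by the remaining gap \<open>D\<close>. Below pi all terms lie in an open
  half plane; at pi the terms \<open>n1\<close>, \<open>n2\<close> are opposite and all others lie
  strictly on one side of their line; above pi a relation could be carried back to the unshifted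
  phases.\<close>

lemma shifted_not_zero:
  fixes y p :: "'i \<Rightarrow> real"
  assumes n: "n1 \<in> A" "n2 \<in> A" "n1 \<noteq> n2" "b n1 < 0" "b n2 < 0"
    and y1: "\<And>k. k \<in> A - {n1, n2} \<Longrightarrow> y k < y n1 + pi"
    and y2: "\<And>k. k \<in> A - {n1, n2} \<Longrightarrow> y n2 - pi < y k"
    and y3: "\<And>k j. k \<in> A - {n1, n2} \<Longrightarrow> j \<in> A - {n1, n2} \<Longrightarrow> \<bar>y k - y j\<bar> < pi"
    and s: "s \<ge> 0" "y n2 - y n1 - (- b n1 - b n2) * s > 0"
    and no: "\<nexists>r. (\<forall>k\<in>A. r k > 0) \<and> (\<Sum>k\<in>A. of_real (r k) * cis (y k)) = 0 \<and> (\<Sum>k\<in>A. b k * ln (r k)) = l"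
    and p: "\<And>k. k \<in> A \<Longrightarrow> p k > 0" "(\<Sum>k\<in>A. b k * ln (p k)) = l"
  shows "(\<Sum>k\<in>A. of_real (p k) * cis ((y(n1 := y n1 - b n2 * s, n2 := y n2 + b n1 * s)) k)) \<noteq> 0"
proof
  define y' where "y' = y(n1 := y n1 - b n2 * s, n2 := y n2 + b n1 * s)"
  define D where "D = y n2 - y n1 - (- b n1 - b n2) * s"
  assume "(\<Sum>k\<in>A. of_real (p k) * cis ((y(n1 := y n1 - b n2 * s, n2 := y n2 + b n1 * s)) k)) = 0"
  then have 0: "(\<Sum>k\<in>A. of_real (p k) * cis (y' k)) = 0" by (simp add: y'_def)
  have nn: "- b n1 * s \<ge> 0" "- b n2 * s \<ge> 0" using n s mult_nonneg_nonneg[of "- b n1" s] mult_nonneg_nonneg[of "- b n2" s] by auto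
  have y'n: "y' n1 = y n1 + - b n2 * s" "y' n2 = y n2 - - b n1 * s" using n by (auto simp: y'_def)
  have y'J: "y' k = y k" if "k \<in> A - {n1, n2}" for k using that by (auto simp: y'_def)
  have D: "D = y' n2 - y' n1" by (simp add: D_def y'n algebra_simps)
  have bd: "\<bar>y k - y' n1\<bar> < pi" "\<bar>y k - y' n2\<bar> < pi" if "k \<in> A - {n1, n2}" for k
    unfolding y'n using shift_bounds[of y k n1 n2, OF y1[OF that] y2[OF that] nn] s D
    unfolding D_def[symmetric] y'n by auto
  obtain j0 where j0: "j0 \<in> A" "b j0 > 0" using ex_pos by blast
  obtain j1 where j1: "j1 \<in> A" "j1 \<noteq> j0" "b j1 > 0" using ex_pos by blast
  have j0J: "j0 \<in> A - {n1, n2}" using j0 n by auto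
  consider "D < pi" | "D = pi" | "D > pi" by linarith
  then show False
  proof cases
    case 1
    have "\<bar>y' i - y' j\<bar> < pi" if "i \<in> A" "j \<in> A" for i j
    proof -
      have "\<bar>y' n2 - y' n1\<bar> < pi" using 1 s(2) unfolding D_def[symmetric] D by simp
      moreover have "i = n1 \<or> i = n2 \<or> i \<in> A - {n1, n2}" "j = n1 \<or> j = n2 \<or> j \<in> A - {n1, n2}"
        using that by auto
      ultimately show ?thesis using bd[of i] bd[of j] y3[of i j] y'J[of i] y'J[of j]
        by (auto simp: abs_minus_commute)
    qed
    then have "(\<Sum>k\<in>A. of_real (p k) * cis (y' k)) \<noteq> 0"
      by (intro sum_cis_nonzero finite_A A_nonempty p(1)) auto
    with 0 show False by simp
  next
    case 2
    have pos: "sin (y k - y' n1) > 0" if "k \<in> A - {n1, n2}" for k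
      using bd[OF that] 2 y1[OF that] y2[OF that] nn unfolding D y'n by (intro sin_gt_zero) linarith+
    have "Im ((\<Sum>k\<in>A. of_real (p k) * cis (y' k)) * cis (- y' n1)) = (\<Sum>k\<in>A. p k * sin (y' k + - y' n1))"
      by (rule Im_sum_cis)
    then have eq: "(\<Sum>k\<in>A. p k * sin (y' k - y' n1)) = 0" by (simp add: 0)
    have sn2: "sin (y' n2 - y' n1) = 0" using 2 D by simp
    have "(\<Sum>k\<in>A. p k * sin (y' k - y' n1)) > 0"
    proof (rule sum_pos2[OF finite_A j0(1)])
      show "0 < p j0 * sin (y' j0 - y' n1)" using pos[OF j0J] y'J[OF j0J] p(1) j0 by simp
      fix k assume k: "k \<in> A"
      show "0 \<le> p k * sin (y' k - y' n1)"
      proof (cases "k = n1 \<or> k = n2")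
        case True
        then show ?thesis using sn2 by auto
      next
        case False
        then have "k \<in> A - {n1, n2}" using k by auto
        then show ?thesis using pos[of k] y'J[of k] p(1)[OF k] by simp
      qed
    qed
    with eq show False by simp
  next
    case 3
    have "\<exists>r. (\<forall>k\<in>A. r k > 0) \<and> (\<Sum>k\<in>A. of_real (r k) * cis (y k)) = 0 \<and> (\<Sum>k\<in>A. b k * ln (r k)) = l"
      by (rule shifted_relation_imp_relation[of A n1 n2 b j0 j1 y s p l])
        (use finite_A n j0 j1 y1 y2 s p 0 3 in \<open>auto simp: y'_def D_def\<close>)
    with no show False by blast
  qed
qed

text \<open>The increments \<open>- b n2\<close> at \<open>n1\<close> and \<open>b n1\<close> at
  \<open>n2\<close> are orthogonal to \<open>b\<close>, hence values of an affine function; its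
  constant \<open>\<sigma>\<close> only rotates all terms together.\<close>

lemma exists_shift_direction:
  assumes n: "n1 \<in> A" "n2 \<in> A" "n1 \<noteq> n2"
  obtains \<delta> \<sigma> where "\<And>\<phi> t k. k \<in> A \<Longrightarrow> lift_phase a c m k (\<phi> + t *\<^sub>R \<delta>) =
    ((\<lambda>k. lift_phase a c m k \<phi>)(n1 := lift_phase a c m n1 \<phi> - b n2 * t, n2 := lift_phase a c m n2 \<phi> + b n1 * t)) k - t * \<sigma>"
proof -
  define x where "x k = (if k = n1 then - b n2 else 0) + (if k = n2 then b n1 else 0)" for k
  have "b k * x k = (if k = n1 then - (b n1 * b n2) else 0) + (if k = n2 then b n1 * b n2 else 0)" for k
    by (auto simp: x_def)
  then have "(\<Sum>k\<in>A. b k * x k) = 0" using finite_A n by (simp add: sum.distrib)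
  from interpolation[OF this] obtain \<delta> \<sigma> where \<delta>: "\<And>k. k \<in> A \<Longrightarrow> a k \<bullet> \<delta> + \<sigma> = x k" by auto
  show ?thesis
  proof (rule that[of \<delta> \<sigma>])
    fix \<phi> t k assume "k \<in> A"
    then have "a k \<bullet> (\<phi> + t *\<^sub>R \<delta>) = a k \<bullet> \<phi> + t * (x k - \<sigma>)"
      using \<delta>[of k] by (simp add: inner_add_right algebra_simps flip: \<delta>)
    then show "lift_phase a c m k (\<phi> + t *\<^sub>R \<delta>) = ((\<lambda>k. lift_phase a c m k \<phi>)(n1 := lift_phase a c m n1 \<phi> - b n2 * t,
        n2 := lift_phase a c m n2 \<phi> + b n1 * t)) k - t * \<sigma>"
      using n by (auto simp: lift_phase_def phase_def x_def algebra_simps)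
  qed
qed

text \<open>As \<open>n1\<close> and \<open>n2\<close> carry all negative coefficients, they are not
  an edge, and the cell allows their phases to be pi or more apart. The path narrows this gap to pi
  / 2 and, up to a common rotation, leaves the other phases alone.\<close>

lemma path_to_lopsided_cell_directed:
  assumes c: "\<And>i. i \<in> A \<Longrightarrow> c i \<noteq> 0"
    and \<theta>: "\<theta> \<in> cell A a b c m" "\<theta> \<notin> closure (zero_args A a c)"
    and n: "n1 \<in> A" "n2 \<in> A" "n1 \<noteq> n2" "b n1 < 0" "b n2 < 0"
    and far: "lift_phase a c m n2 \<theta> - lift_phase a c m n1 \<theta> \<ge> pi"
    and only: "\<And>k. k \<in> A \<Longrightarrow> b k < 0 \<Longrightarrow> k = n1 \<or> k = n2"
  shows "\<exists>T. connected T \<and> \<theta> \<in> T \<and> T \<subseteq> cell A a b c m - closure (zero_args A a c) \<and>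
    T \<inter> lopsided_cell A a c m \<noteq> {}"
proof -
  define J where "J = A - {n1, n2}"
  have finJ: "finite J" using finite_A by (simp add: J_def)
  define y where "y \<phi> k = lift_phase a c m k \<phi>" for \<phi> k
  have cont: "continuous_on UNIV (\<lambda>\<phi>. y \<phi> k)" for k unfolding y_def by (intro continuous_intros)
  obtain \<delta> \<sigma> where \<delta>: "\<And>\<phi> t k. k \<in> A \<Longrightarrow>
      y (\<phi> + t *\<^sub>R \<delta>) k = ((y \<phi>)(n1 := y \<phi> n1 - b n2 * t, n2 := y \<phi> n2 + b n1 * t)) k - t * \<sigma>"
    using exists_shift_direction[OF n(1-3), of c m] unfolding y_def by blast
  define D0 where "D0 = y \<theta> n2 - y \<theta> n1"
  define \<beta> where "\<beta> = - b n1 - b n2"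
  have \<beta>: "\<beta> > 0" using n by (simp add: \<beta>_def)
  define W where "W = (\<Inter>k\<in>J. {\<phi>. y \<phi> k < y \<phi> n1 + pi} \<inter> {\<phi>. y \<phi> n2 - pi < y \<phi> k}) \<inter>
    (\<Inter>k\<in>J. \<Inter>j\<in>J. {\<phi>. \<bar>y \<phi> k - y \<phi> j\<bar> < pi})"
  have "open W"
    unfolding W_def by (intro open_Int open_INT finJ ballI open_Collect_less continuous_intros cont)
  have WD: "y \<phi> k < y \<phi> n1 + pi" "y \<phi> n2 - pi < y \<phi> k" "j \<in> J \<Longrightarrow> \<bar>y \<phi> k - y \<phi> j\<bar> < pi"
    if "\<phi> \<in> W" "k \<in> J" for \<phi> k j using that by (auto simp: W_def)
  \<comment> \<open>When \<open>k\<close> is paired with one of \<open>n1\<close>,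
    \<open>n2\<close>, the other one supplies the negative coefficient off the pair, and a positive
    one besides \<open>k\<close> always remains.\<close>
  have edge: "rel_edge A b n1 k" "rel_edge A b n2 k" if "k \<in> J" for k
    using ex_pos[of k] n that unfolding rel_edge_def J_def
    by (metis Diff_iff insertCI less_asym)+
  have \<theta>W: "\<theta> \<in> W"
  proof -
    have 1: "\<bar>y \<theta> n1 - y \<theta> k\<bar> < pi" "\<bar>y \<theta> n2 - y \<theta> k\<bar> < pi" if "k \<in> J" for k
      using \<theta>(1) edge[OF that] n that by (auto simp: cell_def y_def J_def)
    have 2: "y \<theta> k < y \<theta> n1 + pi" "y \<theta> n2 - pi < y \<theta> k" if "k \<in> J" for k
      using 1[OF that] by (auto simp: abs_less_iff)
    \<comment> \<open>Both phases lie strictly between \<open>y \<theta> n2 - pi\<close> and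
      \<open>y \<theta> n1 + pi\<close>, an interval of length at most pi by
      \<open>far\<close>.\<close>
    have "\<bar>y \<theta> k - y \<theta> j\<bar> < pi" if "k \<in> J" "j \<in> J" for k j
      using 2[OF that(1)] 2[OF that(2)] far by (auto simp: abs_less_iff y_def)
    with 2 show ?thesis by (auto simp: W_def)
  qed
  have not_zero: "\<phi> + t *\<^sub>R \<delta> \<notin> zero_args A a c"
    if \<phi>: "\<phi> \<in> W" "\<phi> \<notin> zero_args A a c" "t \<ge> 0" "y \<phi> n2 - y \<phi> n1 - \<beta> * t > 0" for \<phi> t
  proof
    assume "\<phi> + t *\<^sub>R \<delta> \<in> zero_args A a c"
    then obtain p where p: "\<And>k. k \<in> A \<Longrightarrow> p k > 0" "(\<Sum>i\<in>A. of_real (p i) * cis (phase a c i (\<phi> + t *\<^sub>R \<delta>))) = 0"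
      "(\<Sum>i\<in>A. b i * ln (p i)) = (\<Sum>i\<in>A. b i * ln (norm (c i)))"
      using zero_args_iff[of c "\<phi> + t *\<^sub>R \<delta>", OF c] by blast
    define y' where "y' = (y \<phi>)(n1 := y \<phi> n1 - b n2 * t, n2 := y \<phi> n2 + b n1 * t)"
    have "0 = (\<Sum>i\<in>A. of_real (p i) * cis (y (\<phi> + t *\<^sub>R \<delta>) i))"
      using p(2) by (simp add: y_def cis_lift_phase)
    also have "\<dots> = (\<Sum>i\<in>A. cis (- (t * \<sigma>)) * (of_real (p i) * cis (y' i)))"
    proof (intro sum.cong refl)
      fix i assume "i \<in> A"
      then have "y (\<phi> + t *\<^sub>R \<delta>) i = - (t * \<sigma>) + y' i" by (simp add: \<delta> y'_def)
      then show "of_real (p i) * cis (y (\<phi> + t *\<^sub>R \<delta>) i) = cis (- (t * \<sigma>)) * (of_real (p i) * cis (y' i))"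
        by (simp only: cis_mult[symmetric] mult_ac)
    qed
    also have "\<dots> = cis (- (t * \<sigma>)) * (\<Sum>i\<in>A. of_real (p i) * cis (y' i))" by (simp only: sum_distrib_left)
    finally have "(\<Sum>i\<in>A. of_real (p i) * cis (y' i)) = 0" by (simp del: cis.simps)
    moreover have "(\<Sum>i\<in>A. of_real (p i) * cis (y' i)) \<noteq> 0"
      unfolding y'_def
    proof (rule shifted_not_zero[OF n])
      show "\<nexists>r. (\<forall>k\<in>A. r k > 0) \<and> (\<Sum>k\<in>A. of_real (r k) * cis (y \<phi> k)) = 0 \<and>
          (\<Sum>k\<in>A. b k * ln (r k)) = (\<Sum>i\<in>A. b i * ln (norm (c i)))"
        using \<phi>(2) zero_args_iff[of c \<phi>, OF c] by (simp add: y_def cis_lift_phase)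
    qed (use WD[OF \<phi>(1)] \<phi>(3,4) p in \<open>auto simp: J_def \<beta>_def\<close>)
    ultimately show False by simp
  qed
  have near: "\<bar>y (\<phi> + t *\<^sub>R \<delta>) i - y (\<phi> + t *\<^sub>R \<delta>) j\<bar> < pi"
    if \<phi>: "\<phi> \<in> W" "t \<ge> 0" "y \<phi> n2 - y \<phi> n1 - \<beta> * t > 0" and ij: "i \<in> A" "j \<in> A"
      and ne: "{i, j} = {n1, n2} \<Longrightarrow> y \<phi> n2 - y \<phi> n1 - \<beta> * t < pi" for \<phi> t i j
  proof -
    define y' where "y' = (y \<phi>)(n1 := y \<phi> n1 - b n2 * t, n2 := y \<phi> n2 + b n1 * t)"
    have nn: "- b n1 * t \<ge> 0" "- b n2 * t \<ge> 0"
      using n \<phi>(2) mult_nonneg_nonneg[of "- b n1" t] mult_nonneg_nonneg[of "- b n2" t] by auto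
    have y'n: "y' n1 = y \<phi> n1 + - b n2 * t" "y' n2 = y \<phi> n2 - - b n1 * t" using n by (auto simp: y'_def)
    have y'J: "y' k = y \<phi> k" if "k \<in> J" for k using that by (auto simp: y'_def J_def)
    have D: "y' n2 - y' n1 = y \<phi> n2 - y \<phi> n1 - \<beta> * t" unfolding y'n \<beta>_def by (simp add: algebra_simps)
    have bd: "\<bar>y' k - y' n1\<bar> < pi" "\<bar>y' k - y' n2\<bar> < pi" if "k \<in> J" for k
    proof -
      have "y \<phi> n2 - - b n1 * t - (y \<phi> n1 + - b n2 * t) > 0" using D \<phi>(3) unfolding y'n by simp
      from shift_bounds[of "y \<phi>" k n1 n2, OF WD(1,2)[OF \<phi>(1) that] nn this]
      show "\<bar>y' k - y' n1\<bar> < pi" "\<bar>y' k - y' n2\<bar> < pi" unfolding y'n y'J[OF that] .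
    qed
    have "i = n1 \<or> i = n2 \<or> i \<in> J" "j = n1 \<or> j = n2 \<or> j \<in> J" using ij by (auto simp: J_def)
    then have "\<bar>y' i - y' j\<bar> < pi"
      using bd[of i] bd[of j] WD(3)[OF \<phi>(1), of i j] y'J[of i] y'J[of j] D \<phi>(3) ne
      by (auto simp: abs_minus_commute insert_commute)
    moreover have "y (\<phi> + t *\<^sub>R \<delta>) i - y (\<phi> + t *\<^sub>R \<delta>) j = y' i - y' j" using ij by (simp add: \<delta> y'_def)
    ultimately show ?thesis by simp
  qed
  \<comment> \<open>To avoid the closure of the zeros, a whole zero-free neighbourhood of
    \<open>\<theta>\<close> is moved along. The slack \<open>pi / 4\<close> keeps the gap positive
    for all its points until that of \<open>\<theta>\<close> has shrunk to
    \<open>pi / 2\<close>.\<close>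
  define O' where "O' = W \<inter> - closure (zero_args A a c) \<inter> {\<phi>. D0 - pi / 4 < y \<phi> n2 - y \<phi> n1}"
  have "open O'"
    unfolding O'_def using \<open>open W\<close> by (intro open_Int open_Collect_less continuous_intros cont) auto
  have "\<theta> \<in> O'" using \<theta>W \<theta>(2) by (auto simp: O'_def D0_def)
  \<comment> \<open>The gap shrinks at rate \<open>\<beta>\<close>; at time \<open>s\<close> it is
    \<open>pi / 2\<close>.\<close>
  define s where "s = (D0 - pi / 2) / \<beta>"
  have D0: "D0 \<ge> pi" using far by (simp add: D0_def y_def)
  have "D0 - pi / 2 \<ge> 0" using D0 pi_gt_zero by linarith
  then have s: "s \<ge> 0" "\<beta> * s = D0 - pi / 2" using \<beta> by (simp_all add: s_def)
  define T where "T = (\<lambda>t. \<theta> + t *\<^sub>R \<delta>) ` {0..s}"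
  have bt: "\<beta> * t \<le> D0 - pi / 2" if "t \<le> s" for t
    using mult_left_mono[OF that, of \<beta>] \<beta> s(2) by simp
  have "connected T" unfolding T_def by (intro connected_continuous_image continuous_intros) auto
  moreover have "\<theta> \<in> T" unfolding T_def using s by (intro image_eqI[of _ _ 0]) auto
  moreover have "T \<subseteq> cell A a b c m - closure (zero_args A a c)"
  proof
    fix z assume "z \<in> T"
    then obtain t where t: "0 \<le> t" "t \<le> s" "z = \<theta> + t *\<^sub>R \<delta>" by (auto simp: T_def)
    have "z \<in> cell A a b c m"
      unfolding cell_def
    proof (intro CollectI ballI impI)
      fix i j assume ij: "i \<in> A" "j \<in> A" "rel_edge A b i j"
      have "\<not> rel_edge A b n1 n2" "\<not> rel_edge A b n2 n1" using only by (auto simp: rel_edge_def)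
      then have "{i, j} \<noteq> {n1, n2}" using ij(3) by (auto simp: doubleton_eq_iff)
      moreover have "y \<theta> n2 - y \<theta> n1 - \<beta> * t > 0" using bt[OF t(2)] pi_gt_zero unfolding D0_def by linarith
      ultimately show "\<bar>lift_phase a c m i z - lift_phase a c m j z\<bar> < pi"
        using near[OF \<theta>W t(1) _ ij(1,2)] t(3) by (simp add: y_def)
    qed
    moreover have "z \<notin> closure (zero_args A a c)"
    proof -
      have "(+) (t *\<^sub>R \<delta>) ` O' \<inter> zero_args A a c = {}"
      proof (rule ccontr)
        assume "(+) (t *\<^sub>R \<delta>) ` O' \<inter> zero_args A a c \<noteq> {}"
        then obtain \<phi> where \<phi>: "\<phi> \<in> O'" "\<phi> + t *\<^sub>R \<delta> \<in> zero_args A a c" by (auto simp: add.commute)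
        then have "\<phi> \<in> W" "\<phi> \<notin> zero_args A a c" "D0 - pi / 4 < y \<phi> n2 - y \<phi> n1"
          using closure_subset[of "zero_args A a c"] by (auto simp: O'_def)
        moreover have "y \<phi> n2 - y \<phi> n1 - \<beta> * t > 0"
          using \<open>D0 - pi / 4 < _\<close> bt[OF t(2)] pi_gt_zero by linarith
        ultimately show False using not_zero[of \<phi> t] t(1) \<phi>(2) by blast
      qed
      moreover have "open ((+) (t *\<^sub>R \<delta>) ` O')" using \<open>open O'\<close> by (rule open_translation)
      ultimately have "(+) (t *\<^sub>R \<delta>) ` O' \<inter> closure (zero_args A a c) = {}"
        using open_Int_closure_eq_empty by blast
      moreover have "z \<in> (+) (t *\<^sub>R \<delta>) ` O'" using \<open>\<theta> \<in> O'\<close> t(3) by (auto simp: add.commute)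
      ultimately show ?thesis by blast
    qed
    ultimately show "z \<in> cell A a b c m - closure (zero_args A a c)" by blast
  qed
  moreover have "T \<inter> lopsided_cell A a c m \<noteq> {}"
  proof -
    have "\<theta> + s *\<^sub>R \<delta> \<in> lopsided_cell A a c m"
      unfolding lopsided_cell_def
    proof (intro CollectI ballI)
      fix i j assume ij: "i \<in> A" "j \<in> A"
      show "\<bar>lift_phase a c m i (\<theta> + s *\<^sub>R \<delta>) - lift_phase a c m j (\<theta> + s *\<^sub>R \<delta>)\<bar> < pi"
        using near[OF \<theta>W s(1) _ ij] s(2) pi_gt_zero unfolding D0_def y_def by simp
    qed
    moreover have "\<theta> + s *\<^sub>R \<delta> \<in> T" unfolding T_def using s(1) by auto
    ultimately show ?thesis by blast
  qed
  ultimately show ?thesis by blast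
qed

lemma path_to_lopsided_cell_neg:
  assumes c: "\<And>i. i \<in> A \<Longrightarrow> c i \<noteq> 0"
    and \<theta>: "\<theta> \<in> cell A a b c m" "\<theta> \<notin> closure (zero_args A a c)"
    and ij: "i \<in> A" "j \<in> A" "\<bar>lift_phase a c m i \<theta> - lift_phase a c m j \<theta>\<bar> \<ge> pi"
    and only: "\<And>k. k \<in> A \<Longrightarrow> b k < 0 \<Longrightarrow> k = i \<or> k = j"
  shows "\<exists>T. connected T \<and> \<theta> \<in> T \<and> T \<subseteq> cell A a b c m - closure (zero_args A a c) \<and>
    T \<inter> lopsided_cell A a c m \<noteq> {}"
proof -
  have n: "b i < 0" "b j < 0" "i \<noteq> j" using ex_neg[of i] ex_neg[of j] only by auto
  show ?thesis
  proof (cases "lift_phase a c m j \<theta> - lift_phase a c m i \<theta> \<ge> pi")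
    case True
    then show ?thesis using path_to_lopsided_cell_directed[of c \<theta> m i j] c \<theta> ij n only by blast
  next
    case False
    then have "lift_phase a c m i \<theta> - lift_phase a c m j \<theta> \<ge> pi" using ij(3) by linarith
    then show ?thesis using path_to_lopsided_cell_directed[of c \<theta> m j i] c \<theta> ij n only by blast
  qed
qed

text \<open>Inside the cell only a pair that is not an edge can violate lopsidedness, and such a
  pair contains all exponents of one sign. Negating \<open>b\<close> exchanges the two
  signs.\<close>

lemma path_to_lopsided_cell:
  assumes c: "\<And>i. i \<in> A \<Longrightarrow> c i \<noteq> 0"
    and \<theta>: "\<theta> \<in> cell A a b c m - closure (zero_args A a c)"
  shows "\<exists>T. connected T \<and> \<theta> \<in> T \<and> T \<subseteq> cell A a b c m - closure (zero_args A a c) \<and>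
    T \<inter> lopsided_cell A a c m \<noteq> {}"
proof (cases "\<theta> \<in> lopsided_cell A a c m")
  case True
  then show ?thesis using \<theta> by (intro exI[of _ "{\<theta>}"]) auto
next
  case False
  then obtain i j where ij: "i \<in> A" "j \<in> A" "\<bar>lift_phase a c m i \<theta> - lift_phase a c m j \<theta>\<bar> \<ge> pi"
    by (auto simp: lopsided_cell_def not_less)
  then have "\<not> rel_edge A b i j" using \<theta> by (force simp: cell_def)
  then consider "\<And>k. k \<in> A \<Longrightarrow> b k < 0 \<Longrightarrow> k = i \<or> k = j" | "\<And>k. k \<in> A \<Longrightarrow> - b k < 0 \<Longrightarrow> k = i \<or> k = j"
    unfolding rel_edge_def by auto
  then show ?thesis
  proof cases
    case 1
    then show ?thesis using path_to_lopsided_cell_neg[of c \<theta> m i j] c \<theta> ij by blast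
  next
    case 2
    interpret neg: affine_relation A a "\<lambda>i. - b i" by (rule affine_relation_uminus) unfold_locales
    show ?thesis using neg.path_to_lopsided_cell_neg[of c \<theta> m i j] c \<theta> ij 2 unfolding cell_uminus by blast
  qed
qed

lemma convex_lopsided_cell: "convex (lopsided_cell A a c m)"
proof -
  have "lopsided_cell A a c m = (\<Inter>i\<in>A. \<Inter>j\<in>A.
      {\<theta>. (a i - a j) \<bullet> \<theta> < pi - (Arg (c i) + 2 * pi * of_int (m i) - Arg (c j) - 2 * pi * of_int (m j))})"
    (is "_ = ?R")
  proof (intro equalityI subsetI)
    fix \<theta> assume "\<theta> \<in> lopsided_cell A a c m"
    then show "\<theta> \<in> ?R"
      by (fastforce simp: lopsided_cell_def lift_phase_def phase_def inner_diff_left abs_less_iff)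
  next
    fix \<theta> assume \<theta>: "\<theta> \<in> ?R"
    show "\<theta> \<in> lopsided_cell A a c m"
      unfolding lopsided_cell_def
    proof (intro CollectI ballI)
      fix i j assume "i \<in> A" "j \<in> A"
      then have "(a i - a j) \<bullet> \<theta> < pi - (Arg (c i) + 2 * pi * of_int (m i) - Arg (c j) - 2 * pi * of_int (m j))"
        "(a j - a i) \<bullet> \<theta> < pi - (Arg (c j) + 2 * pi * of_int (m j) - Arg (c i) - 2 * pi * of_int (m i))"
        using \<theta> by blast+
      then show "\<bar>lift_phase a c m i \<theta> - lift_phase a c m j \<theta>\<bar> < pi"
        by (simp add: lift_phase_def phase_def inner_diff_left abs_less_iff)
    qed
  qed
  moreover have "convex ?R" by (intro convex_INT convex_halfspace_lt)
  ultimately show ?thesis by simp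
qed

lemma lopsided_cell_subset:
  assumes "\<And>i. i \<in> A \<Longrightarrow> c i \<noteq> 0"
  shows "lopsided_cell A a c m \<subseteq> cell A a b c m - closure (zero_args A a c)"
proof -
  have "lopsided_cell A a c m \<inter> closure (zero_args A a c) = {}"
    using open_Int_closure_eq_empty[OF open_lopsided_cell] lopsided_not_zero_args[of c m] assms by blast
  then show ?thesis by (auto simp: lopsided_cell_def cell_def)
qed

lemma connected_cell_complement:
  assumes c: "\<And>i. i \<in> A \<Longrightarrow> c i \<noteq> 0"
  shows "connected (cell A a b c m - closure (zero_args A a c))" (is "connected ?S")
proof -
  have L: "lopsided_cell A a c m \<subseteq> ?S" "connected (lopsided_cell A a c m)"
    using lopsided_cell_subset[of c m] c convex_lopsided_cell convex_connected by blast+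
  have "connected_component ?S x z" if x: "x \<in> ?S" and z: "z \<in> ?S" for x z
  proof -
    obtain T1 where T1: "connected T1" "x \<in> T1" "T1 \<subseteq> ?S" "T1 \<inter> lopsided_cell A a c m \<noteq> {}"
      using path_to_lopsided_cell[of c x m] c x by blast
    obtain T2 where T2: "connected T2" "z \<in> T2" "T2 \<subseteq> ?S" "T2 \<inter> lopsided_cell A a c m \<noteq> {}"
      using path_to_lopsided_cell[of c z m] c z by blast
    have "connected (T1 \<union> lopsided_cell A a c m)" by (rule connected_Un) (use T1 L in auto)
    then have "connected (T1 \<union> lopsided_cell A a c m \<union> T2)" by (rule connected_Un) (use T2 L in auto)
    moreover have "T1 \<union> lopsided_cell A a c m \<union> T2 \<subseteq> ?S" using T1 T2 L by blast
    ultimately show ?thesis unfolding connected_component_def using T1(2) T2(2) by blast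
  qed
  then show ?thesis by (simp add: connected_iff_connected_component)
qed

section \<open>Which cells survive, and when two cells meet\<close>

lemma sum_b_neg: "(\<Sum>i\<in>{i \<in> A. b i < 0}. - b i) = (\<Sum>i\<in>{i \<in> A. b i > 0}. b i)"
proof -
  have "(\<Sum>i\<in>A. b i) = (\<Sum>i\<in>A. (if b i > 0 then b i else 0) + (if b i < 0 then b i else 0))"
    by (intro sum.cong) auto
  also have "\<dots> = (\<Sum>i\<in>{i \<in> A. b i > 0}. b i) + (\<Sum>i\<in>{i \<in> A. b i < 0}. b i)"
    using finite_A by (simp add: sum.distrib sum.If_cases Int_def conj_commute)
  finally show ?thesis by (simp add: sum_negf sum_b)
qed

text \<open>The lifted phases lie in a window \<open>[l, l + pi)\<close>, and \<open>b\<close>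
  annihilates both \<open>l\<close> and the dependence on \<open>\<theta>\<close>. Relative to
  \<open>l\<close>, a positive coefficient contributes less than \<open>pi * b i\<close>, the others
  at most 0.\<close>

lemma sum_lift_less:
  assumes "\<theta> \<in> lopsided_cell A a c m"
  shows "(\<Sum>i\<in>A. b i * (Arg (c i) + 2 * pi * of_int (m i))) < pi * (\<Sum>i\<in>{i \<in> A. b i > 0}. b i)"
proof -
  define y where "y i = lift_phase a c m i \<theta>" for i
  define l where "l = Min (y ` A)"
  have l: "l \<in> y ` A" using finite_A A_nonempty by (simp add: l_def)
  have y: "0 \<le> y i - l" "y i - l < pi" if "i \<in> A" for i
  proof -
    show "0 \<le> y i - l" using finite_A that by (simp add: l_def)
    obtain k where "k \<in> A" "l = y k" using l by auto
    then show "y i - l < pi" using assms that by (force simp: lopsided_cell_def y_def abs_less_iff)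
  qed
  have "(\<Sum>i\<in>A. b i * (Arg (c i) + 2 * pi * of_int (m i))) = (\<Sum>i\<in>A. b i * (y i - l) - b i * (a i \<bullet> \<theta> + (- l)))"
    by (intro sum.cong refl) (simp add: y_def lift_phase_def phase_def algebra_simps)
  also have "\<dots> = (\<Sum>i\<in>A. b i * (y i - l))" using sum_b_affine[of \<theta> "- l"] by (simp add: sum_subtractf)
  also have "\<dots> < (\<Sum>i\<in>A. if b i > 0 then b i * pi else 0)"
  proof (rule sum_strict_mono_ex1[OF finite_A])
    show "\<forall>i\<in>A. b i * (y i - l) \<le> (if b i > 0 then b i * pi else 0)"
      using y by (auto intro!: mult_left_mono mult_nonpos_nonneg simp: less_imp_le not_less)
    obtain j where "j \<in> A" "b j > 0" using ex_pos by blast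
    then show "\<exists>i\<in>A. b i * (y i - l) < (if b i > 0 then b i * pi else 0)" using y by (intro bexI[of _ j]) auto
  qed
  also have "\<dots> = pi * (\<Sum>i\<in>{i \<in> A. b i > 0}. b i)"
    using finite_A by (simp add: sum.If_cases Int_def conj_commute sum_distrib_left mult.commute)
  finally show ?thesis .
qed

lemma lopsided_cell_nonempty_iff:
  "lopsided_cell A a c m \<noteq> {} \<longleftrightarrow>
    \<bar>\<Sum>i\<in>A. b i * (Arg (c i) + 2 * pi * of_int (m i))\<bar> < pi * (\<Sum>i\<in>{i \<in> A. b i > 0}. b i)"
    (is "_ \<longleftrightarrow> \<bar>?\<kappa>\<bar> < pi * ?N")
proof
  assume "lopsided_cell A a c m \<noteq> {}"
  then obtain \<theta> where \<theta>: "\<theta> \<in> lopsided_cell A a c m" by blast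
  interpret neg: affine_relation A a "\<lambda>i. - b i" by (rule affine_relation_uminus) unfold_locales
  have 1: "(\<Sum>i\<in>A. - b i * (Arg (c i) + 2 * pi * of_int (m i))) = - ?\<kappa>" by (simp add: sum_negf)
  have 2: "{i \<in> A. - b i > 0} = {i \<in> A. b i < 0}" by auto
  have "- ?\<kappa> < pi * ?N" using neg.sum_lift_less[OF \<theta>] unfolding 1 2 sum_b_neg .
  then show "\<bar>?\<kappa>\<bar> < pi * ?N" using sum_lift_less[OF \<theta>] by linarith
next
  assume less: "\<bar>?\<kappa>\<bar> < pi * ?N"
  obtain j where j: "j \<in> A" "b j > 0" using ex_pos by blast
  have N: "?N > 0" using finite_A j by (intro sum_pos) auto
  \<comment> \<open>The phases \<open>\<tau>\<close> on positive exponents and 0 on all others have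
    the prescribed pairing with \<open>b\<close>; \<open>less\<close> says precisely that they
    differ by less than pi.\<close>
  define \<tau> where "\<tau> = ?\<kappa> / ?N"
  have \<tau>: "\<bar>\<tau>\<bar> < pi" "\<tau> * ?N = ?\<kappa>" using less N by (simp_all add: \<tau>_def abs_divide pos_divide_less_eq)
  define x where "x i = (if b i > 0 then \<tau> else 0)" for i
  have "(\<Sum>i\<in>A. b i * x i) = (\<Sum>i\<in>A. if b i > 0 then b i * \<tau> else 0)" by (intro sum.cong) (auto simp: x_def)
  also have "\<dots> = \<tau> * ?N" using finite_A by (simp add: sum.If_cases Int_def conj_commute sum_distrib_left mult.commute)
  finally have "(\<Sum>i\<in>A. b i * (x i - (Arg (c i) + 2 * pi * of_int (m i)))) = 0"
    using \<tau>(2) by (simp add: right_diff_distrib sum_subtractf)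
  from interpolation[OF this] obtain \<theta> s where
    \<theta>: "\<And>i. i \<in> A \<Longrightarrow> a i \<bullet> \<theta> + s = x i - (Arg (c i) + 2 * pi * of_int (m i))" by auto
  have "lift_phase a c m i \<theta> = x i - s" if "i \<in> A" for i
    using \<theta>[OF that] by (simp add: lift_phase_def phase_def)
  then have "\<theta> \<in> lopsided_cell A a c m" using \<tau>(1) by (auto simp: lopsided_cell_def x_def)
  then show "lopsided_cell A a c m \<noteq> {}" by blast
qed

lemma cell_complement_nonempty_iff:
  assumes "\<And>i. i \<in> A \<Longrightarrow> c i \<noteq> 0"
  shows "cell A a b c m - closure (zero_args A a c) \<noteq> {} \<longleftrightarrow> lopsided_cell A a c m \<noteq> {}"
  using path_to_lopsided_cell[of c _ m] lopsided_cell_subset[of c m] assms by blast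

text \<open>Across an edge the two lifts differ by the same integer, since both phase differences
  are below pi in modulus. Every pair with \<open>b i \<ge> 0\<close> and \<open>b k \<le> 0\<close>
  is an edge, and such edges connect all exponents.\<close>

lemma cells_disjoint:
  assumes "\<theta> \<in> cell A a b c m" "\<theta> \<in> cell A a b c m'"
  shows "\<exists>k. \<forall>i\<in>A. m' i = m i + k"
proof -
  have edge: "m' i - m i = m' j - m j" if "i \<in> A" "j \<in> A" "rel_edge A b i j" for i j
  proof -
    have "\<bar>lift_phase a c m i \<theta> - lift_phase a c m j \<theta>\<bar> < pi" "\<bar>lift_phase a c m' i \<theta> - lift_phase a c m' j \<theta>\<bar> < pi"
      using assms that by (auto simp: cell_def)
    moreover have "lift_phase a c m' i \<theta> - lift_phase a c m' j \<theta> - (lift_phase a c m i \<theta> - lift_phase a c m j \<theta>)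
      = 2 * pi * of_int ((m' i - m i) - (m' j - m j))" by (simp add: lift_phase_def algebra_simps)
    ultimately have "\<bar>2 * pi * of_int ((m' i - m i) - (m' j - m j))\<bar> < 2 * pi" by linarith
    then have "\<bar>of_int ((m' i - m i) - (m' j - m j)) :: real\<bar> < 1"
      by (simp add: abs_mult)
    then have "\<bar>(m' i - m i) - (m' j - m j)\<bar> < 1" by linarith
    then show ?thesis by simp
  qed
  obtain j where j: "j \<in> A" "b j > 0" using ex_pos by blast
  obtain n where n: "n \<in> A" "b n < 0" using ex_neg by blast
  have pn: "rel_edge A b i k" if "b i \<ge> 0" "b k \<le> 0" for i k
    using ex_pos[of i] ex_neg[of k] that unfolding rel_edge_def by (metis less_le_not_le)
  have "m' i - m i = m' j - m j" if "i \<in> A" for i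
  proof (cases "b i \<ge> 0")
    case True
    then show ?thesis using edge[OF that n(1) pn] edge[OF j(1) n(1) pn] j n by simp
  next
    case False
    then show ?thesis using edge[OF j(1) that pn] j by simp
  qed
  then have "m' i = m i + (m' j - m j)" if "i \<in> A" for i using that by fastforce
  then show ?thesis by blast
qed

end

section \<open>Integer circuits\<close>

lemma inj_of_int_vec: "inj (of_int_vec :: int ^ 'n \<Rightarrow> real ^ 'n)"
  by (auto simp: inj_def of_int_vec_def vec_eq_iff)

lemma det_in_Ints:
  fixes M :: "real ^ 'n ^ 'n"
  assumes "\<And>i j. M $ i $ j \<in> \<int>"
  shows "det M \<in> \<int>"
  unfolding det_def by (intro Ints_sum Ints_mult Ints_of_int Ints_prod) (use assms in auto)

lemma affine_hull_UNIV_inner_const: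
  fixes S :: "'a::euclidean_space set"
  assumes "affine hull S = UNIV" "\<And>x. x \<in> S \<Longrightarrow> x \<bullet> t = r"
  shows "t = 0"
proof -
  have "S \<subseteq> {x. t \<bullet> x = r}" using assms(2) by (auto simp: inner_commute)
  then have "affine hull S \<subseteq> {x. t \<bullet> x = r}" by (rule hull_minimal) (rule affine_hyperplane)
  then have "t \<bullet> 0 = r" "t \<bullet> t = r" using assms(1) by blast+
  then show ?thesis by simp
qed

lemma convex_hull_image_iff:
  fixes f :: "'i \<Rightarrow> 'a::real_vector"
  assumes "finite T" "inj_on f T"
  shows "x \<in> convex hull (f ` T) \<longleftrightarrow>
    (\<exists>l. (\<forall>i\<in>T. l i \<ge> 0) \<and> sum l T = 1 \<and> (\<Sum>i\<in>T. l i *\<^sub>R f i) = x)"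
proof
  assume "x \<in> convex hull (f ` T)"
  then obtain u where "\<forall>z\<in>f ` T. 0 \<le> u z" "sum u (f ` T) = 1" "(\<Sum>z\<in>f ` T. u z *\<^sub>R z) = x"
    using assms by (auto simp: convex_hull_finite)
  then show "\<exists>l. (\<forall>i\<in>T. l i \<ge> 0) \<and> sum l T = 1 \<and> (\<Sum>i\<in>T. l i *\<^sub>R f i) = x"
    using assms(2) by (intro exI[of _ "u \<circ> f"]) (simp add: sum.reindex)
next
  assume "\<exists>l. (\<forall>i\<in>T. l i \<ge> 0) \<and> sum l T = 1 \<and> (\<Sum>i\<in>T. l i *\<^sub>R f i) = x"
  then obtain l where l: "\<forall>i\<in>T. l i \<ge> 0" "sum l T = 1" "(\<Sum>i\<in>T. l i *\<^sub>R f i) = x" by blast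
  have "(\<Sum>i\<in>T. l i *\<^sub>R f i) \<in> convex hull (f ` T)"
    by (rule convex_sum[OF assms(1) convex_convex_hull l(2)]) (use l(1) in \<open>auto intro: hull_inc\<close>)
  then show "x \<in> convex hull (f ` T)" by (simp add: l)
qed

text \<open>The coefficients of the relation are the minors given by Cramer's rule.\<close>

lemma exists_integer_affine_relation:
  fixes A :: "(int ^ 'n) set"
  assumes "finite A" and card_A: "card A = CARD('n) + 2" and full: "affine hull (of_int_vec ` A) = (UNIV :: (real ^ 'n) set)"
  obtains \<nu> :: "int ^ 'n \<Rightarrow> int" where "(\<Sum>p\<in>A. \<nu> p) = 0"
    "(\<Sum>p\<in>A. real_of_int (\<nu> p) *\<^sub>R of_int_vec p) = 0" "\<exists>p\<in>A. \<nu> p \<noteq> 0"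
proof -
  let ?v = "of_int_vec :: int ^ 'n \<Rightarrow> real ^ 'n"
  obtain B where B: "B \<subseteq> ?v ` A" "\<not> affine_dependent B" "affine hull (?v ` A) = affine hull B"
    using affine_basis_exists by blast
  have "aff_dim B = int CARD('n)"
    using B(3) full aff_dim_eq_full[of B] by simp
  then have cardB: "card B = CARD('n) + 1" using aff_dim_affine_independent[OF B(2)] by simp
  define A' where "A' = {p \<in> A. ?v p \<in> B}"
  have B_eq: "B = ?v ` A'" using B(1) by (auto simp: A'_def)
  have cardA': "card A' = CARD('n) + 1"
    using cardB card_image[OF inj_on_subset[OF inj_of_int_vec subset_UNIV], of A'] by (simp add: B_eq)
  have "finite A'" "A' \<subseteq> A" using assms(1) by (auto simp: A'_def)
  then have "card (A - A') = 1" using card_A cardA' assms(1) by (simp add: card_Diff_subset)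
  then obtain q where q: "A - A' = {q}" by (auto simp: card_1_singleton_iff)
  have "A' \<noteq> {}" using cardA' by (metis card.empty add_is_0 one_neq_zero)
  then obtain p0 where p0: "p0 \<in> A'" by blast
  have "card (A' - {p0}) = CARD('n)" using cardA' p0 by simp
  then obtain e :: "'n \<Rightarrow> int ^ 'n" where e: "bij_betw e UNIV (A' - {p0})"
    using finite_same_card_bij[of "UNIV :: 'n set" "A' - {p0}"] \<open>finite A'\<close> by auto
  have e_inj: "inj e" and e_range: "range e = A' - {p0}" using e by (auto simp: bij_betw_def)
  have sum_A: "(\<Sum>p\<in>A. f p) = f q + (f p0 + (\<Sum>k\<in>UNIV. f (e k)))" for f :: "int ^ 'n \<Rightarrow> 'b::comm_monoid_add"
  proof -
    have "A = insert q (insert p0 (range e))" "q \<notin> insert p0 (range e)" "p0 \<notin> range e"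
      using q p0 e_range \<open>A' \<subseteq> A\<close> by auto
    then show ?thesis using e_inj by (simp add: sum.reindex)
  qed
  define D :: "real ^ 'n ^ 'n" where "D = (\<chi> i k. of_int (e k $ i) - of_int (p0 $ i))"
  have "t = 0" if "transpose D *v t = 0" for t
  proof (rule affine_hull_UNIV_inner_const)
    show "affine hull B = UNIV" using B(3) full by simp
    have "?v (e k) \<bullet> t = ?v p0 \<bullet> t" for k
    proof -
      have "(transpose D *v t) $ k = ?v (e k) \<bullet> t - ?v p0 \<bullet> t"
        by (simp add: matrix_vector_mult_def transpose_def D_def of_int_vec_def inner_vec_def
            left_diff_distrib sum_subtractf)
      then show ?thesis using that by simp
    qed
    moreover have "A' = insert p0 (range e)" using e_range p0 by auto
    ultimately show "x \<bullet> t = ?v p0 \<bullet> t" if "x \<in> B" for x using that by (auto simp: B_eq)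
  qed
  then have "det (transpose D) \<noteq> 0"
    using matrix_left_invertible_ker[of "transpose D"] invertible_left_inverse[of "transpose D"]
      invertible_det_nz[of "transpose D"] by blast
  then have detD: "det D \<noteq> 0" by (simp add: det_transpose)
  define w where "w = ?v q - ?v p0"
  define d where "d k = det (\<chi> i j. if j = k then w $ i else D $ i $ j)" for k
  have "D *v (\<chi> k. d k / det D) = w" using cramer[OF detD] unfolding d_def by blast
  then have Dd: "(\<Sum>k\<in>UNIV. d k * (of_int (e k $ i) - of_int (p0 $ i))) = det D * (of_int (q $ i) - of_int (p0 $ i))" for i
  proof -
    assume *: "D *v (\<chi> k. d k / det D) = w"
    have "det D * (D *v (\<chi> k. d k / det D)) $ i = (\<Sum>k\<in>UNIV. d k * (of_int (e k $ i) - of_int (p0 $ i)))"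
      using detD by (simp add: matrix_vector_mult_def D_def sum_distrib_left mult.commute)
    then show ?thesis unfolding * by (simp add: w_def of_int_vec_def)
  qed
  have "det D \<in> \<int>" by (rule det_in_Ints) (simp add: D_def)
  then obtain dd where dd: "det D = of_int dd" by (auto elim: Ints_cases)
  have "d k \<in> \<int>" for k unfolding d_def by (rule det_in_Ints) (simp add: D_def w_def of_int_vec_def)
  then have "\<forall>k. \<exists>z. d k = of_int z" by (meson Ints_cases)
  then obtain dn where dn: "\<And>k. d k = of_int (dn k)" by metis
  \<comment> \<open>Read off from \<open>det D (q - p0) = sum d k (e k - p0)\<close>; the
    coefficient at \<open>p0\<close> makes the total vanish.\<close>
  define \<nu> where "\<nu> p = (if p = q then - dd else if p = p0 then dd - (\<Sum>k\<in>UNIV. dn k) else dn (inv e p))" for p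
  have "q \<noteq> p0" "e k \<noteq> q" "e k \<noteq> p0" for k using q p0 e_range by auto
  then have \<nu>: "\<nu> q = - dd" "\<nu> p0 = dd - (\<Sum>k\<in>UNIV. dn k)" "\<nu> (e k) = dn k" for k
    using e_inj by (auto simp: \<nu>_def)
  show ?thesis
  proof
    show "(\<Sum>p\<in>A. \<nu> p) = 0" unfolding sum_A[of \<nu>] \<nu> by simp
    have "(\<Sum>p\<in>A. real_of_int (\<nu> p) *\<^sub>R ?v p) $ i = 0" for i
    proof -
      have "(\<Sum>p\<in>A. real_of_int (\<nu> p) *\<^sub>R ?v p) $ i = (\<Sum>p\<in>A. real_of_int (\<nu> p) * of_int (p $ i))"
        by (simp add: of_int_vec_def)
      also have "\<dots> = - of_int dd * of_int (q $ i) + ((of_int dd - (\<Sum>k\<in>UNIV. d k)) * of_int (p0 $ i) + (\<Sum>k\<in>UNIV. d k * of_int (e k $ i)))"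
        unfolding sum_A[of "\<lambda>p. real_of_int (\<nu> p) * of_int (p $ i)"] \<nu> by (simp add: dn)
      also have "\<dots> = 0"
        using Dd[of i] by (simp add: dd right_diff_distrib sum_subtractf left_diff_distrib sum_distrib_right)
      finally show ?thesis .
    qed
    then show "(\<Sum>p\<in>A. real_of_int (\<nu> p) *\<^sub>R ?v p) = 0" by (simp add: vec_eq_iff)
    show "\<exists>p\<in>A. \<nu> p \<noteq> 0" using \<nu>(1) q detD dd by (intro bexI[of _ q]) auto
  qed
qed

text \<open>A vertex is not a convex combination of the others, so the relation has at least two
  coefficients of each sign.\<close>

lemma exists_two_positive:
  fixes f :: "'i \<Rightarrow> 'a::real_vector" and b :: "'i \<Rightarrow> real"
  assumes A: "finite A" "inj_on f A" and rel: "(\<Sum>i\<in>A. b i) = 0" "(\<Sum>i\<in>A. b i *\<^sub>R f i) = 0"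
    and nz: "\<exists>i\<in>A. b i \<noteq> 0" and vert: "\<And>i. i \<in> A \<Longrightarrow> f i \<notin> convex hull (f ` (A - {i}))"
  shows "\<exists>j\<in>A. j \<noteq> i \<and> b j > 0"
proof (rule ccontr)
  assume "\<not> ?thesis"
  then have neg: "\<And>j. j \<in> A - {i} \<Longrightarrow> b j \<le> 0" by force
  have i: "i \<in> A"
  proof (rule ccontr)
    assume "i \<notin> A"
    then have "(\<Sum>j\<in>A. - b j) = 0" "\<And>j. j \<in> A \<Longrightarrow> - b j \<ge> 0" using rel neg by (auto simp: sum_negf)
    then have "\<forall>j\<in>A. - b j = 0" using A by (simp add: sum_nonneg_eq_0_iff)
    with nz show False by simp
  qed
  have bi: "b i = (\<Sum>j\<in>A - {i}. - b j)" using rel(1) A i by (simp add: sum.remove[of A i] sum_negf)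
  have "b i \<noteq> 0"
  proof
    assume "b i = 0"
    then have "\<forall>j\<in>A - {i}. - b j = 0" using bi neg A by (subst sum_nonneg_eq_0_iff[symmetric]) auto
    with nz \<open>b i = 0\<close> show False by auto
  qed
  then have bpos: "b i > 0" using bi neg by (metis (no_types, lifting) neg_0_le_iff_le order_le_less sum_nonneg)
  have "f i \<in> convex hull (f ` (A - {i}))"
    unfolding convex_hull_image_iff[OF finite_Diff[OF A(1)] inj_on_subset[OF A(2) Diff_subset]]
  proof (intro exI conjI ballI)
    show "0 \<le> - b j / b i" if "j \<in> A - {i}" for j using neg[OF that] bpos by (simp add: divide_nonpos_pos)
    show "(\<Sum>j\<in>A - {i}. - b j / b i) = 1" unfolding sum_divide_distrib[symmetric] bi[symmetric] using bpos by simp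
    have "b i *\<^sub>R f i = (\<Sum>j\<in>A - {i}. (- b j) *\<^sub>R f j)"
      using rel(2) A i by (simp add: sum.remove[of A i] sum_negf eq_neg_iff_add_eq_0)
    then have "(1 / b i) *\<^sub>R (b i *\<^sub>R f i) = (1 / b i) *\<^sub>R (\<Sum>j\<in>A - {i}. (- b j) *\<^sub>R f j)" by simp
    then show "(\<Sum>j\<in>A - {i}. (- b j / b i) *\<^sub>R f j) = f i"
      using bpos by (simp add: scaleR_sum_right)
  qed
  with vert[OF i] show False by blast
qed

section \<open>Integer lifts up to periods\<close>

text \<open>Equivalent lifts describe the same piece of the torus: \<open>t\<close> stands for a
  translation by a period, \<open>k\<close> for a common change of all lifts. Values off
  \<open>A\<close> are free.\<close>

definition phase_class :: "(int ^ 'n) set \<Rightarrow> (int ^ 'n \<Rightarrow> int) \<Rightarrow> (int ^ 'n \<Rightarrow> int) set" where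
  "phase_class A m = {m'. \<exists>t k. \<forall>p\<in>A. m' p = m p + (\<Sum>j\<in>UNIV. p $ j * t $ j) + k}"

lemma phase_class_eq_iff: "phase_class A m = phase_class A m' \<longleftrightarrow> m' \<in> phase_class A m"
proof
  assume "phase_class A m = phase_class A m'"
  moreover have "m' \<in> phase_class A m'"
    unfolding phase_class_def by (auto intro!: exI[of _ 0])
  ultimately show "m' \<in> phase_class A m" by simp
next
  assume "m' \<in> phase_class A m"
  then obtain t k where t: "\<And>p. p \<in> A \<Longrightarrow> m' p = m p + (\<Sum>j\<in>UNIV. p $ j * t $ j) + k"
    by (auto simp: phase_class_def)
  have "x \<in> phase_class A m \<longleftrightarrow> x \<in> phase_class A m'" for x
  proof
    assume "x \<in> phase_class A m"
    then obtain s l where s: "\<And>p. p \<in> A \<Longrightarrow> x p = m p + (\<Sum>j\<in>UNIV. p $ j * s $ j) + l"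
      by (auto simp: phase_class_def)
    have "\<forall>p\<in>A. x p = m' p + (\<Sum>j\<in>UNIV. p $ j * (s - t) $ j) + (l - k)"
      by (simp add: s t right_diff_distrib sum_subtractf)
    then show "x \<in> phase_class A m'" unfolding phase_class_def by blast
  next
    assume "x \<in> phase_class A m'"
    then obtain s l where s: "\<And>p. p \<in> A \<Longrightarrow> x p = m' p + (\<Sum>j\<in>UNIV. p $ j * s $ j) + l"
      by (auto simp: phase_class_def)
    have "\<forall>p\<in>A. x p = m p + (\<Sum>j\<in>UNIV. p $ j * (s + t) $ j) + (l + k)"
      by (simp add: s t distrib_left sum.distrib)
    then show "x \<in> phase_class A m" unfolding phase_class_def by blast
  qed
  then show "phase_class A m = phase_class A m'" by blast
qed

locale integer_circuit =
  fixes A :: "(int ^ 'n) set" and \<nu> :: "int ^ 'n \<Rightarrow> int"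
  assumes finite_support: "finite A"
    and card_support: "card A = CARD('n) + 2"
    and full_dim: "affine hull (of_int_vec ` A) = (UNIV :: (real ^ 'n) set)"
    and sum_coeffs: "(\<Sum>p\<in>A. \<nu> p) = 0"
    and sum_points: "(\<Sum>p\<in>A. real_of_int (\<nu> p) *\<^sub>R of_int_vec p) = (0 :: real ^ 'n)"
    and two_pos: "\<And>i. \<exists>j\<in>A. j \<noteq> i \<and> \<nu> j > 0"
    and two_neg: "\<And>i. \<exists>j\<in>A. j \<noteq> i \<and> \<nu> j < 0"
begin

abbreviation b :: "int ^ 'n \<Rightarrow> real" where
  "b \<equiv> \<lambda>p. real_of_int (\<nu> p)"

abbreviation weight :: "(int ^ 'n \<Rightarrow> int) \<Rightarrow> int" where
  "weight m \<equiv> (\<Sum>p\<in>A. \<nu> p * m p)"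

lemma sum_affine:
  "(\<Sum>p\<in>A. b p * (of_int_vec p \<bullet> y + s)) = 0"
proof -
  have "(\<Sum>p\<in>A. b p * (of_int_vec p \<bullet> y + s)) =
      (\<Sum>p\<in>A. b p *\<^sub>R of_int_vec p) \<bullet> y + of_int (\<Sum>p\<in>A. \<nu> p) * s"
    by (simp add: distrib_left sum.distrib inner_sum_left sum_distrib_right)
  then show ?thesis by (simp add: sum_coeffs sum_points)
qed

text \<open>The relation makes the point \<open>q\<close> an affine combination of the others, so a
  functional constant on those is constant on a spanning set.\<close>

lemma nondegenerate:
  assumes q: "q \<in> A" "\<nu> q \<noteq> 0" and const: "\<And>p. p \<in> A - {q} \<Longrightarrow> of_int_vec p \<bullet> t = r"
  shows "t = (0 :: real ^ 'n)"
proof (rule affine_hull_UNIV_inner_const[OF full_dim])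
  have "0 = (\<Sum>p\<in>A. b p * (of_int_vec p \<bullet> t + - r))" by (rule sum_affine[symmetric])
  also have "\<dots> = b q * (of_int_vec q \<bullet> t + - r)"
    using finite_support q const by (simp add: sum.remove[of A q])
  finally have "of_int_vec q \<bullet> t = r" using q(2) by simp
  then show "x \<bullet> t = r" if "x \<in> of_int_vec ` A" for x using that const by (cases "x = of_int_vec q") auto
qed

text \<open>A base vertex of the simplex on \<open>A - {q}\<close>, with the remaining vertices
  numbered by the coordinates so that the edge vectors form a square matrix.\<close>

lemma exists_frame:
  assumes "q \<in> A"
  obtains p0 and e :: "'n \<Rightarrow> int ^ 'n" where "p0 \<in> A - {q}" "inj e" "range e = A - {q} - {p0}"
proof -
  have "card (A - {q}) = CARD('n) + 1" using assms card_support finite_support by simp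
  then have "A - {q} \<noteq> {}" by (metis card.empty add_is_0 one_neq_zero)
  then obtain p0 where p0: "p0 \<in> A - {q}" by blast
  then have "card (A - {q} - {p0}) = CARD('n)" using \<open>card (A - {q}) = _\<close> by simp
  then obtain e :: "'n \<Rightarrow> int ^ 'n" where "bij_betw e UNIV (A - {q} - {p0})"
    using finite_same_card_bij[of "UNIV :: 'n set" "A - {q} - {p0}"] finite_support by auto
  then show ?thesis using that[of p0 e] p0 by (auto simp: bij_betw_def)
qed

lemma frame_nondegenerate:
  fixes e :: "'n \<Rightarrow> int ^ 'n"
  assumes q: "q \<in> A" "\<nu> q \<noteq> 0" and e: "range e = A - {q} - {p0}"
    and t: "\<And>k. of_int_vec (e k - p0) \<bullet> t = 0"
  shows "t = (0 :: real ^ 'n)"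
proof (rule nondegenerate[OF q])
  have diff: "(of_int_vec (e k - p0) :: real ^ 'n) = of_int_vec (e k) - of_int_vec p0" for k
    by (simp add: of_int_vec_def vec_eq_iff)
  fix p assume "p \<in> A - {q}"
  then have "p = p0 \<or> p \<in> range e" using e by auto
  then show "of_int_vec p \<bullet> t = of_int_vec p0 \<bullet> t" using t unfolding diff inner_diff_left by auto
qed

text \<open>Off \<open>q\<close> the exponents are the vertices of a simplex, where any values can
  be interpolated; orthogonality to \<open>b\<close> then forces the value at
  \<open>q\<close>.\<close>

lemma interpolate:
  assumes "(\<Sum>p\<in>A. b p * x p) = 0"
  shows "\<exists>(y :: real ^ 'n) s. \<forall>p\<in>A. of_int_vec p \<bullet> y + s = x p"
proof -
  obtain q where q: "q \<in> A" "\<nu> q > 0" using two_pos by blast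
  obtain p0 and e :: "'n \<Rightarrow> int ^ 'n" where p0: "p0 \<in> A - {q}" "inj e" "range e = A - {q} - {p0}"
    using exists_frame[OF q(1)] by blast
  define D :: "real ^ 'n ^ 'n" where "D = (\<chi> k. of_int_vec (e k - p0))"
  have row: "(D *v t) $ k = of_int_vec (e k - p0) \<bullet> t" for t k
    by (simp add: D_def matrix_vector_mult_def inner_vec_def)
  have "t = 0" if "D *v t = 0" for t
    by (rule frame_nondegenerate[OF q(1) _ p0(3)]) (use q(2) that row[of t] in auto)
  then have "det D \<noteq> 0"
    using matrix_left_invertible_ker[of D] invertible_left_inverse[of D] invertible_det_nz[of D] by blast
  then have "D *v (\<chi> k. det (\<chi> i j. if j = k then (\<chi> k. x (e k) - x p0) $ i else D $ i $ j) / det D) = (\<chi> k. x (e k) - x p0)"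
    using cramer by blast
  then obtain y where "D *v y = (\<chi> k. x (e k) - x p0)" by blast
  then have y: "of_int_vec (e k - p0) \<bullet> y = x (e k) - x p0" for k using row[of y k] by simp
  have diff: "(of_int_vec (e k - p0) :: real ^ 'n) = of_int_vec (e k) - of_int_vec p0" for k
    by (simp add: of_int_vec_def vec_eq_iff)
  define s where "s = x p0 - of_int_vec p0 \<bullet> y"
  have off: "of_int_vec p \<bullet> y + s = x p" if "p \<in> A - {q}" for p
  proof -
    have "p = p0 \<or> p \<in> range e" using that p0 by auto
    then consider "p = p0" | k where "p = e k" by auto
    then show ?thesis
    proof cases
      case (2 k)
      then show ?thesis using y[of k] unfolding s_def diff inner_diff_left by simp
    qed (simp add: s_def)
  qed
  have "(\<Sum>p\<in>A. b p * (of_int_vec p \<bullet> y + s - x p)) = 0"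
    using assms sum_affine[of y s] by (simp add: right_diff_distrib sum_subtractf)
  then have "b q * (of_int_vec q \<bullet> y + s - x q) = 0"
    using finite_support q off by (simp add: sum.remove[of A q])
  then have "of_int_vec q \<bullet> y + s = x q" using q by simp
  with off show ?thesis by (intro exI[of _ y] exI[of _ s]) auto
qed

sublocale affine_relation A "of_int_vec :: int ^ 'n \<Rightarrow> real ^ 'n" b
proof
  show "inj_on (of_int_vec :: int ^ 'n \<Rightarrow> real ^ 'n) A" using inj_of_int_vec inj_on_subset by blast
  show "(\<Sum>i\<in>A. b i) = 0" using sum_coeffs by (metis of_int_0 of_int_sum)
qed (use finite_support sum_points interpolate two_pos two_neg in auto)

text \<open>By duality \<open>g\<close> annihilates every vector orthogonal to \<open>b\<close>. The
  test vector \<open>x\<close>, supported on \<open>p\<close> and \<open>q\<close>, then fixes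
  \<open>g p\<close> in terms of \<open>g q\<close>.\<close>

lemma affine_relation_unique:
  assumes g: "(\<Sum>p\<in>A. g p) = 0" "(\<Sum>p\<in>A. g p *\<^sub>R of_int_vec p) = (0 :: real ^ 'n)"
  obtains \<tau> where "\<And>p. p \<in> A \<Longrightarrow> g p = \<tau> * b p"
proof -
  obtain q where q: "q \<in> A" "\<nu> q > 0" using two_pos by blast
  define \<tau> where "\<tau> = g q / \<nu> q"
  have "g p = \<tau> * b p" if p: "p \<in> A" for p
  proof (cases "p = q")
    case False
    define x where "x \<gamma> = (if \<gamma> = p then 1 else 0) + (if \<gamma> = q then - b p / \<nu> q else 0)" for \<gamma>
    have sx: "(\<Sum>\<gamma>\<in>A. h \<gamma> * x \<gamma>) = h p - h q * \<nu> p / \<nu> q" for h :: "int ^ 'n \<Rightarrow> real"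
    proof -
      have "h \<gamma> * x \<gamma> = (if \<gamma> = p then h p else 0) + (if \<gamma> = q then - (h q * \<nu> p / \<nu> q) else 0)" for \<gamma>
        by (auto simp: x_def distrib_left)
      then show ?thesis using finite_support p q by (simp add: sum.distrib)
    qed
    have "(\<Sum>\<gamma>\<in>A. b \<gamma> * x \<gamma>) = 0" using sx[of "\<lambda>\<gamma>. b \<gamma>"] q by simp
    from interpolate[OF this] obtain y :: "real ^ 'n" and s where y: "\<And>\<gamma>. \<gamma> \<in> A \<Longrightarrow> of_int_vec \<gamma> \<bullet> y + s = x \<gamma>" by blast
    have "(\<Sum>\<gamma>\<in>A. g \<gamma> * x \<gamma>) = (\<Sum>\<gamma>\<in>A. g \<gamma> * (of_int_vec \<gamma> \<bullet> y + s))" by (simp add: y)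
    also have "\<dots> = (\<Sum>\<gamma>\<in>A. g \<gamma> *\<^sub>R of_int_vec \<gamma>) \<bullet> y + (\<Sum>\<gamma>\<in>A. g \<gamma>) * s"
      by (simp add: distrib_left sum.distrib inner_sum_left sum_distrib_right)
    finally have "g p = g q * \<nu> p / \<nu> q" using sx[of g] by (simp add: g)
    then show ?thesis by (simp add: \<tau>_def)
  qed (use q in \<open>simp add: \<tau>_def\<close>)
  then show ?thesis by (rule that)
qed

text \<open>The circuit triangulation: from a point, move along the relation until a coordinate with
  positive coefficient vanishes.\<close>

lemma convex_hull_cover:
  "convex hull (of_int_vec ` A) =
    (\<Union>q\<in>{q \<in> A. \<nu> q > 0}. convex hull (of_int_vec ` (A - {q}) :: (real ^ 'n) set))"
proof (intro equalityI subsetI)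
  fix x :: "real ^ 'n" assume "x \<in> convex hull (of_int_vec ` A)"
  then obtain l where l: "\<And>p. p \<in> A \<Longrightarrow> l p \<ge> 0" "sum l A = 1" "(\<Sum>p\<in>A. l p *\<^sub>R of_int_vec p) = x"
    using convex_hull_image_iff[OF finite_support inj_a] by blast
  define I where "I = {q \<in> A. \<nu> q > 0}"
  have I: "finite I" "I \<noteq> {}" using finite_support two_pos by (auto simp: I_def)
  \<comment> \<open>The largest step that keeps the coordinates with positive coefficient
    nonnegative; \<open>q\<close> is one that reaches 0. As \<open>t \<ge> 0\<close>, the other
    coordinates do not decrease.\<close>
  define t where "t = Min ((\<lambda>p. l p / \<nu> p) ` I)"
  have "t \<in> (\<lambda>p. l p / \<nu> p) ` I" using I by (simp add: t_def)
  then obtain q where q: "q \<in> I" "t = l q / \<nu> q" by auto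
  have t_le: "t \<le> l p / \<nu> p" if "p \<in> I" for p using I that by (simp add: t_def)
  have "t \<ge> 0" using q l(1) by (simp add: I_def)
  define k where "k p = l p - t * \<nu> p" for p
  have k0: "k p \<ge> 0" if "p \<in> A" for p
  proof (cases "\<nu> p > 0")
    case True
    then show ?thesis using t_le[of p] that by (simp add: k_def I_def pos_le_divide_eq)
  next
    case False
    then have "t * \<nu> p \<le> 0" using \<open>t \<ge> 0\<close> by (simp add: mult_nonneg_nonpos)
    then show ?thesis using l(1)[OF that] by (simp add: k_def)
  qed
  have kq: "k q = 0" using q by (simp add: k_def I_def)
  have k1: "sum k A = 1" using l(2) sum_b by (simp add: k_def sum_subtractf sum_distrib_left[symmetric])
  have kx: "(\<Sum>p\<in>A. k p *\<^sub>R of_int_vec p) = x"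
  proof -
    have "(\<Sum>p\<in>A. k p *\<^sub>R of_int_vec p) = x - t *\<^sub>R (\<Sum>p\<in>A. b p *\<^sub>R of_int_vec p)"
      unfolding l(3)[symmetric] by (simp add: k_def scaleR_diff_left sum_subtractf scaleR_sum_right)
    then show ?thesis by (simp add: sum_points)
  qed
  have "q \<in> A" using q by (simp add: I_def)
  have "x \<in> convex hull (of_int_vec ` (A - {q}))"
    unfolding convex_hull_image_iff[OF finite_Diff[OF finite_support] inj_on_subset[OF inj_a Diff_subset]]
    by (rule exI[of _ k])
      (use k0 k1 kx kq finite_support \<open>q \<in> A\<close> in \<open>simp add: sum.remove[of A q]\<close>)
  then show "x \<in> (\<Union>q\<in>{q \<in> A. \<nu> q > 0}. convex hull (of_int_vec ` (A - {q})))" using q(1) by (auto simp: I_def)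
next
  fix x :: "real ^ 'n" assume "x \<in> (\<Union>q\<in>{q \<in> A. \<nu> q > 0}. convex hull (of_int_vec ` (A - {q})))"
  then obtain q where "x \<in> convex hull (of_int_vec ` (A - {q}))" by blast
  moreover have "convex hull (of_int_vec ` (A - {q})) \<subseteq> convex hull (of_int_vec ` A :: (real ^ 'n) set)"
    by (intro hull_mono image_mono) auto
  ultimately show "x \<in> convex hull (of_int_vec ` A)" by blast
qed

text \<open>Two barycentric representations of a point differ by \<open>\<tau> * b\<close>.
  Vanishing of one at \<open>q\<close> gives \<open>\<tau> \<ge> 0\<close>, vanishing of the other
  at \<open>\<gamma>\<close> gives \<open>\<tau> \<le> 0\<close>, so they coincide and vanish at
  both.\<close>

lemma convex_hull_overlap:
  assumes q: "q \<in> A" "\<nu> q > 0" and \<gamma>: "\<gamma> \<in> A" "\<nu> \<gamma> > 0" and "q \<noteq> \<gamma>"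
  shows "convex hull (of_int_vec ` (A - {q})) \<inter> convex hull (of_int_vec ` (A - {\<gamma>}))
    \<subseteq> convex hull (of_int_vec ` (A - {q} - {\<gamma>}) :: (real ^ 'n) set)"
proof
  fix x :: "real ^ 'n"
  assume x: "x \<in> convex hull (of_int_vec ` (A - {q})) \<inter> convex hull (of_int_vec ` (A - {\<gamma>}))"
  have hull: "\<exists>l. (\<forall>p\<in>A. l p \<ge> 0) \<and> l q = 0 \<and> sum l A = 1 \<and> (\<Sum>p\<in>A. l p *\<^sub>R of_int_vec p) = x"
    if h: "x \<in> convex hull (of_int_vec ` (A - {q}))" "q \<in> A" for q
  proof -
    obtain l where l: "\<forall>p\<in>A - {q}. l p \<ge> 0" "sum l (A - {q}) = 1" "(\<Sum>p\<in>A - {q}. l p *\<^sub>R of_int_vec p) = x"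
      using h(1) unfolding convex_hull_image_iff[OF finite_Diff[OF finite_support] inj_on_subset[OF inj_a Diff_subset]]
      by blast
    define k where "k = l(q := 0)"
    have eq: "sum k (A - {q}) = sum l (A - {q})"
      "(\<Sum>p\<in>A - {q}. k p *\<^sub>R of_int_vec p) = (\<Sum>p\<in>A - {q}. l p *\<^sub>R of_int_vec p :: real ^ 'n)"
      by (auto simp: k_def intro!: sum.cong)
    have "k q = 0" by (simp add: k_def)
    then have "sum k A = 1" "(\<Sum>p\<in>A. k p *\<^sub>R of_int_vec p) = x"
      using l eq finite_support h(2) by (simp_all add: sum.remove[of A q])
    moreover have "\<forall>p\<in>A. k p \<ge> 0" using l(1) by (auto simp: k_def)
    ultimately show ?thesis using \<open>k q = 0\<close> by blast
  qed
  obtain l where l: "\<forall>p\<in>A. l p \<ge> 0" "l q = 0" "sum l A = 1" "(\<Sum>p\<in>A. l p *\<^sub>R of_int_vec p) = x"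
    using hull[of q] x q by blast
  obtain k where k: "\<forall>p\<in>A. k p \<ge> 0" "k \<gamma> = 0" "sum k A = 1" "(\<Sum>p\<in>A. k p *\<^sub>R of_int_vec p) = x"
    using hull[of \<gamma>] x \<gamma> by blast
  have "(\<Sum>p\<in>A. k p - l p) = 0" "(\<Sum>p\<in>A. (k p - l p) *\<^sub>R of_int_vec p) = (0 :: real ^ 'n)"
    using l k by (simp_all add: sum_subtractf scaleR_diff_left)
  then obtain \<tau> where \<tau>: "\<And>p. p \<in> A \<Longrightarrow> k p - l p = \<tau> * b p"
    using affine_relation_unique[of "\<lambda>p. k p - l p"] by blast
  have "k q \<ge> 0" "l \<gamma> \<ge> 0" using l k q \<gamma> by auto
  then have "\<tau> * b q \<ge> 0" "\<tau> * b \<gamma> \<le> 0"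
    using \<tau>[OF q(1)] \<tau>[OF \<gamma>(1)] l(2) k(2) by simp_all
  then have "\<tau> \<ge> 0" "\<tau> \<le> 0" using q \<gamma> by (auto simp: zero_le_mult_iff mult_le_0_iff)
  then have "\<tau> = 0" by simp
  then have "l \<gamma> = 0" using \<tau>[OF \<gamma>(1)] k(2) by simp
  have "A - {q} - {\<gamma>} \<subseteq> A" by blast
  show "x \<in> convex hull (of_int_vec ` (A - {q} - {\<gamma>}))"
    unfolding convex_hull_image_iff[OF finite_subset[OF \<open>A - {q} - {\<gamma>} \<subseteq> A\<close> finite_support] inj_on_subset[OF inj_a \<open>A - {q} - {\<gamma>} \<subseteq> A\<close>]]
    by (rule exI[of _ l])
      (use l \<open>l \<gamma> = 0\<close> finite_support q \<gamma> \<open>q \<noteq> \<gamma>\<close> in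
        \<open>simp add: sum.remove[of A q] sum.remove[of "A - {q}" \<gamma>]\<close>)
qed

lemma negligible_overlap:
  assumes "q \<in> A" "\<gamma> \<in> A" "q \<noteq> \<gamma>"
  shows "negligible (convex hull (of_int_vec ` (A - {q} - {\<gamma>})) :: (real ^ 'n) set)"
proof -
  let ?S = "of_int_vec ` (A - {q} - {\<gamma>}) :: (real ^ 'n) set"
  have "card (A - {q} - {\<gamma>}) = CARD('n)" using assms card_support finite_support by simp
  then have "card ?S \<le> CARD('n)" using card_image_le[of "A - {q} - {\<gamma>}"] finite_support by (metis finite_Diff)
  then have "aff_dim ?S < int DIM(real ^ 'n)"
    using aff_dim_le_card[of ?S] finite_support by simp
  then obtain u r where u: "u \<noteq> 0" "?S \<subseteq> {x. u \<bullet> x = r}" using aff_lowdim_subset_hyperplane by blast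
  then have "convex hull ?S \<subseteq> {x. u \<bullet> x = r}" by (intro hull_minimal convex_hyperplane)
  then show ?thesis using negligible_hyperplane[of u r] u(1) negligible_subset by blast
qed

lemma measure_convex_hull:
  "measure lebesgue (convex hull (of_int_vec ` A) :: (real ^ 'n) set) =
    (\<Sum>q\<in>{q \<in> A. \<nu> q > 0}. measure lebesgue (convex hull (of_int_vec ` (A - {q})) :: (real ^ 'n) set))"
  unfolding convex_hull_cover
proof (rule measure_negligible_finite_Union_image)
  show "finite {q \<in> A. \<nu> q > 0}" using finite_support by simp
  show "convex hull (of_int_vec ` (A - {q})) \<in> lmeasurable" for q
    using finite_support by (intro lmeasurable_compact finite_imp_compact_convex_hull) auto
  show "pairwise (\<lambda>q \<gamma>. negligible (convex hull (of_int_vec ` (A - {q})) \<inter>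
      convex hull (of_int_vec ` (A - {\<gamma>}) :: (real ^ 'n) set))) {q \<in> A. \<nu> q > 0}"
    unfolding pairwise_def
  proof (intro ballI impI)
    fix q \<gamma> assume "q \<in> {q \<in> A. \<nu> q > 0}" "\<gamma> \<in> {q \<in> A. \<nu> q > 0}" "q \<noteq> \<gamma>"
    then show "negligible (convex hull (of_int_vec ` (A - {q})) \<inter> convex hull (of_int_vec ` (A - {\<gamma>}) :: (real ^ 'n) set))"
      using negligible_subset[OF negligible_overlap[of q \<gamma>] convex_hull_overlap[of q \<gamma>]] by simp
  qed
qed

section \<open>Counting classes of lifts in a window of weights\<close>

lemma weight_phase_class:
  assumes "m' \<in> phase_class A m" shows "weight m' = weight m"
proof -
  obtain t k where t: "\<And>p. p \<in> A \<Longrightarrow> m' p = m p + (\<Sum>j\<in>UNIV. p $ j * t $ j) + k"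
    using assms by (auto simp: phase_class_def)
  have "real_of_int (weight m') = (\<Sum>p\<in>A. real_of_int (\<nu> p * m p) + b p * (of_int_vec p \<bullet> of_int_vec t + of_int k))"
    unfolding of_int_sum
    by (intro sum.cong refl) (simp add: t of_int_vec_def inner_vec_def algebra_simps)
  also have "\<dots> = real_of_int (weight m)" by (simp add: sum.distrib sum_affine)
  finally show ?thesis by (simp only: of_int_eq_iff)
qed

text \<open>Changing \<open>m q\<close> by one changes the weight by \<open>\<nu> q\<close>, so in a
  window of this length the other values determine \<open>m q\<close>. Classes are then values on
  the vertices of a simplex modulo integral affine functions; with the value at \<open>p0\<close>
  subtracted, these are the cosets of the lattice of the edge vectors.\<close>

lemma card_phase_classes_simplex:
  assumes q: "q \<in> A" "\<nu> q > 0"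
  shows "real (card (phase_class A ` {m. s \<le> weight m \<and> weight m < s + \<nu> q})) =
    fact CARD('n) * measure lebesgue (convex hull (of_int_vec ` (A - {q})) :: (real ^ 'n) set)"
proof -
  obtain p0 and e :: "'n \<Rightarrow> int ^ 'n" where p0: "p0 \<in> A - {q}" "inj e" "range e = A - {q} - {p0}"
    using exists_frame[OF q(1)] by blast
  define u where "u k = e k - p0" for k
  define M where "M = {m. s \<le> weight m \<and> weight m < s + \<nu> q}"
  define v where "v m k = m (e k) - m p0" for m :: "int ^ 'n \<Rightarrow> int" and k
  have eA: "e k \<in> A" "e k \<noteq> q" "e k \<noteq> p0" for k using p0(3) by blast+
  have kernel: "phase_class A m = phase_class A m' \<longleftrightarrow> lattice_coset u (v m) = lattice_coset u (v m')"
    if m: "m \<in> M" "m' \<in> M" for m m'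
    unfolding phase_class_eq_iff lattice_coset_eq_iff
  proof
    assume "m' \<in> phase_class A m"
    then obtain t k where t: "\<And>p. p \<in> A \<Longrightarrow> m' p = m p + (\<Sum>j\<in>UNIV. p $ j * t $ j) + k"
      by (auto simp: phase_class_def)
    have "\<forall>i. v m' i - v m i = (\<Sum>j\<in>UNIV. u i $ j * t $ j)"
      using p0(1) eA by (simp add: v_def u_def t left_diff_distrib sum_subtractf)
    then show "v m' \<in> lattice_coset u (v m)" unfolding lattice_coset_def by blast
  next
    assume "v m' \<in> lattice_coset u (v m)"
    then obtain t where t: "\<And>i. v m' i - v m i = (\<Sum>j\<in>UNIV. u i $ j * t $ j)" by (auto simp: lattice_coset_def)
    define k where "k = m' p0 - m p0 - (\<Sum>j\<in>UNIV. p0 $ j * t $ j)"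
    \<comment> \<open>Agrees with \<open>m'\<close> off \<open>q\<close> and has the weight of
      \<open>m\<close>; a discrepancy at \<open>q\<close> would change the weight by at least the
      length of the window.\<close>
    define m'' where "m'' p = m p + (\<Sum>j\<in>UNIV. p $ j * t $ j) + k" for p
    have "m'' \<in> phase_class A m" unfolding phase_class_def m''_def by blast
    then have w: "weight m'' = weight m" by (rule weight_phase_class)
    have off: "m'' p = m' p" if "p \<in> A - {q}" for p
    proof -
      have "p = p0 \<or> p \<in> range e" using that p0 by auto
      then show ?thesis
        using t by (auto simp: m''_def k_def v_def u_def left_diff_distrib sum_subtractf algebra_simps)
    qed
    have "weight m' - weight m = \<nu> q * (m' q - m'' q)"
      unfolding w[symmetric] using finite_support q off by (simp add: sum.remove[of A q] right_diff_distrib)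
    moreover have "\<bar>weight m' - weight m\<bar> < \<nu> q" using m by (auto simp: M_def)
    ultimately have "\<bar>\<nu> q * (m' q - m'' q)\<bar> < \<nu> q" by simp
    then have "\<bar>m' q - m'' q\<bar> < 1" using q(2) by (simp add: abs_mult)
    then have "m'' q = m' q" by simp
    then have "\<forall>p\<in>A. m' p = m p + (\<Sum>j\<in>UNIV. p $ j * t $ j) + k" using off by (metis m''_def Diff_iff singletonD)
    then show "m' \<in> phase_class A m" unfolding phase_class_def by blast
  qed
  have surj: "v ` M = UNIV"
  proof (intro equalityI subset_UNIV subsetI)
    fix f :: "'n \<Rightarrow> int"
    define g where "g p = (if p = p0 then 0 else f (inv e p))" for p
    define w0 where "w0 = (\<Sum>p\<in>A - {q}. \<nu> p * g p)"
    \<comment> \<open>The entry at \<open>q\<close> moves the weight to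
      \<open>s + (w0 - s) mod \<nu> q\<close>, inside the window.\<close>
    define m where "m = g(q := - ((w0 - s) div \<nu> q))"
    have "weight m = w0 - \<nu> q * ((w0 - s) div \<nu> q)"
      using finite_support q by (simp add: sum.remove[of A q] m_def w0_def cong: sum.cong_simp)
    also have "\<dots> = s + (w0 - s) mod \<nu> q" using mult_div_mod_eq[of "\<nu> q" "w0 - s"] by linarith
    finally have "m \<in> M" using q(2) by (simp add: M_def)
    moreover have "v m = f"
      using eA p0(1,2) by (auto simp: v_def m_def g_def fun_eq_iff)
    ultimately show "f \<in> v ` M" by blast
  qed
  have "card (phase_class A ` M) = card ((lattice_coset u \<circ> v) ` M)"
    by (rule card_image_cong_kernel) (simp add: kernel)
  also have "(lattice_coset u \<circ> v) ` M = range (lattice_coset u)" by (simp only: image_comp[symmetric] surj)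
  finally have "real (card (phase_class A ` M)) =
      fact CARD('n) * measure lebesgue (convex hull (insert 0 (range (\<lambda>k. of_int_vec (u k)))) :: (real ^ 'n) set)"
    using card_lattice_cosets_simplex[of u] frame_nondegenerate[OF q(1) _ p0(3)] q(2) by (simp add: u_def)
  also have "measure lebesgue (convex hull (insert 0 (range (\<lambda>k. of_int_vec (u k)))) :: (real ^ 'n) set)
    = measure lebesgue ((+) (of_int_vec p0) ` (convex hull (insert 0 (range (\<lambda>k. of_int_vec (u k)))) :: (real ^ 'n) set))"
    by (rule measure_translation[symmetric])
  also have "(+) (of_int_vec p0) ` (convex hull (insert 0 (range (\<lambda>k. of_int_vec (u k)))) :: (real ^ 'n) set)
    = convex hull ((+) (of_int_vec p0) ` insert 0 (range (\<lambda>k. of_int_vec (u k))))"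
    by (rule convex_hull_translation[symmetric])
  also have "(+) (of_int_vec p0) ` insert 0 (range (\<lambda>k. of_int_vec (u k) :: real ^ 'n)) = of_int_vec ` (A - {q})"
  proof -
    have "of_int_vec p0 + of_int_vec (u k) = (of_int_vec (e k) :: real ^ 'n)" for k
      by (simp add: u_def of_int_vec_def vec_eq_iff)
    then have "(+) (of_int_vec p0) ` insert 0 (range (\<lambda>k. of_int_vec (u k) :: real ^ 'n)) = of_int_vec ` insert p0 (range e)"
      by (simp add: image_image)
    moreover have "insert p0 (range e) = A - {q}" using p0 by auto
    ultimately show ?thesis by simp
  qed
  finally show ?thesis by (simp only: M_def)
qed

text \<open>The cardinality is a multiple of the volume of a nondegenerate simplex, hence nonzero,
  whereas \<open>card\<close> of an infinite set is 0.\<close>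

lemma finite_phase_classes:
  assumes q: "q \<in> A" "\<nu> q > 0"
  shows "finite (phase_class A ` {m. s \<le> weight m \<and> weight m < s + \<nu> q})"
proof -
  obtain p0 and e :: "'n \<Rightarrow> int ^ 'n" where p0: "p0 \<in> A - {q}" "inj e" "range e = A - {q} - {p0}"
    using exists_frame[OF q(1)] by blast
  let ?S = "convex hull (of_int_vec ` (A - {q})) :: (real ^ 'n) set"
  have "measure lebesgue ?S \<noteq> 0"
  proof
    assume "measure lebesgue ?S = 0"
    moreover have "?S \<in> lmeasurable"
      using finite_support by (intro lmeasurable_compact finite_imp_compact_convex_hull) auto
    ultimately have "negligible ?S" using negligible_iff_measure by blast
    then have "interior ?S = {}" 
      using negligible_subset[OF _ interior_subset] open_not_negligible[OF open_interior] by blast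
    then obtain t r where t: "t \<noteq> 0" "?S \<subseteq> {x. t \<bullet> x = r}"
      using empty_interior_subset_hyperplane[OF convex_convex_hull] by blast
    have "of_int_vec p \<bullet> t = r" if "p \<in> A - {q}" for p
      using t(2) hull_inc[of "of_int_vec p" "of_int_vec ` (A - {q})" convex] that by (auto simp: inner_commute)
    then have "t = 0" using nondegenerate[OF q(1), of t r] q(2) by auto
    with t(1) show False by simp
  qed
  then have "real (card (phase_class A ` {m. s \<le> weight m \<and> weight m < s + \<nu> q})) \<noteq> 0"
    unfolding card_phase_classes_simplex[OF q, of s] by simp
  then show ?thesis by (intro card_ge_0_finite) simp
qed

text \<open>The window is cut into consecutive ones of lengths \<open>\<nu> q\<close>. The weight is
  constant on a class, so no class is counted twice; \<open>s\<close> varies because each piece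
  starts where the previous one ends.\<close>

lemma card_phase_classes_partial:
  assumes "finite I" "I \<subseteq> {q \<in> A. \<nu> q > 0}"
  shows "finite (phase_class A ` {m. s \<le> weight m \<and> weight m < s + (\<Sum>q\<in>I. \<nu> q)}) \<and>
    real (card (phase_class A ` {m. s \<le> weight m \<and> weight m < s + (\<Sum>q\<in>I. \<nu> q)})) =
    fact CARD('n) * (\<Sum>q\<in>I. measure lebesgue (convex hull (of_int_vec ` (A - {q})) :: (real ^ 'n) set))"
  using assms
proof (induction I arbitrary: s rule: finite_induct)
  case empty
  have none: "{m. s \<le> weight m \<and> weight m < s + (\<Sum>q\<in>{}. \<nu> q)} = {}" by auto
  show ?case unfolding none by simp
next
  case (insert q I)
  have q: "q \<in> A" "\<nu> q > 0" using insert.prems by auto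
  have N: "(\<Sum>\<gamma>\<in>I. \<nu> \<gamma>) \<ge> 0" using insert.prems by (intro sum_nonneg) auto
  define M1 where "M1 = {m. s \<le> weight m \<and> weight m < s + \<nu> q}"
  define M2 where "M2 = {m. s + \<nu> q \<le> weight m \<and> weight m < s + \<nu> q + (\<Sum>\<gamma>\<in>I. \<nu> \<gamma>)}"
  have M: "{m. s \<le> weight m \<and> weight m < s + (\<Sum>\<gamma>\<in>insert q I. \<nu> \<gamma>)} = M1 \<union> M2"
    using insert.hyps q(2) N by (auto simp: M1_def M2_def)
  have 1: "finite (phase_class A ` M1)"
    "real (card (phase_class A ` M1)) = fact CARD('n) * measure lebesgue (convex hull (of_int_vec ` (A - {q})) :: (real ^ 'n) set)"
    unfolding M1_def by (rule finite_phase_classes[OF q], rule card_phase_classes_simplex[OF q])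
  have 2: "finite (phase_class A ` M2)"
    "real (card (phase_class A ` M2)) = fact CARD('n) * (\<Sum>q\<in>I. measure lebesgue (convex hull (of_int_vec ` (A - {q})) :: (real ^ 'n) set))"
    unfolding M2_def using insert.IH[of "s + \<nu> q"] insert.prems by auto
  have disj: "phase_class A ` M1 \<inter> phase_class A ` M2 = {}"
  proof (rule ccontr)
    assume "phase_class A ` M1 \<inter> phase_class A ` M2 \<noteq> {}"
    then obtain m m' where m: "m \<in> M1" "m' \<in> M2" "phase_class A m = phase_class A m'" by auto
    then have "weight m' = weight m" by (intro weight_phase_class) (simp add: phase_class_eq_iff)
    with m show False by (simp add: M1_def M2_def)
  qed
  show ?case
    unfolding M image_Un using 1 2 disj insert.hyps by (simp add: card_Un_disjoint distrib_left)
qed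

lemma card_phase_classes:
  "real (card (phase_class A ` {m. s \<le> weight m \<and> weight m < s + (\<Sum>q\<in>{q \<in> A. \<nu> q > 0}. \<nu> q)})) =
    fact CARD('n) * measure lebesgue (convex hull (of_int_vec ` A) :: (real ^ 'n) set)"
proof -
  have "finite {q \<in> A. \<nu> q > 0}" using finite_support by simp
  from card_phase_classes_partial[OF this order_refl, of s] show ?thesis
    unfolding measure_convex_hull by blast
qed

end

section \<open>Coamoebas\<close>

lemma abs_circle_eq_iff_cis: "abs_circle s = abs_circle t \<longleftrightarrow> cis s = cis t"
proof
  assume "abs_circle s = abs_circle t"
  then obtain k :: int where "s - t = 2 * pi * of_int k" by (auto simp: abs_circle_eq_iff)
  then have "s = t + 2 * pi * of_int k" by simp
  then show "cis s = cis t" by (simp add: cis_mult[symmetric])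
next
  assume eq: "cis s = cis t"
  obtain k :: int where k: "s + 2 * pi * of_int k = t + Arg (cis (s - t))" using exists_lift by blast
  have "cis (s - t) = 1" by (simp add: cis_divide[symmetric] eq del: cis.simps)
  then have "s - t = 2 * pi * of_int (- k)" using k by simp
  then show "abs_circle s = abs_circle t" unfolding abs_circle_eq_iff by blast
qed

lemma exp_Complex: "exp (Complex x t) = of_real (exp x) * cis t"
  by (simp add: exp_eq_polar)

lemma monomial_exp:
  fixes x \<theta> :: "real ^ 'n"
  shows "(\<Prod>i\<in>UNIV. exp (Complex (x $ i) (\<theta> $ i)) powi (p $ i)) =
    exp (Complex (of_int_vec p \<bullet> x) (of_int_vec p \<bullet> \<theta>))"
proof -
  have powi: "exp z powi n = exp (of_int n * z)" for z :: complex and n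
    by (cases "n \<ge> 0") (simp_all add: power_int_def exp_of_nat_mult[symmetric] exp_minus[symmetric])
  have "(\<Prod>i\<in>UNIV. exp (Complex (x $ i) (\<theta> $ i)) powi (p $ i)) =
      exp (\<Sum>i\<in>UNIV. of_int (p $ i) * Complex (x $ i) (\<theta> $ i))"
    by (simp add: powi exp_sum)
  also have "(\<Sum>i\<in>UNIV. of_int (p $ i) * Complex (x $ i) (\<theta> $ i)) = Complex (of_int_vec p \<bullet> x) (of_int_vec p \<bullet> \<theta>)"
    by (simp add: complex_eq_iff of_int_vec_def inner_vec_def)
  finally show ?thesis .
qed

lemma torus_proj_in_coamoeba_iff:
  fixes \<theta> :: "real ^ 'n"
  shows "torus_proj \<theta> \<in> coamoeba (laurent_poly A c) \<longleftrightarrow> \<theta> \<in> zero_args A of_int_vec c"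
proof
  assume "torus_proj \<theta> \<in> coamoeba (laurent_poly A c)"
  then obtain z where z: "torus_proj \<theta> = Arg_vec z" "\<And>i. z $ i \<noteq> 0" "laurent_poly A c z = 0"
    by (auto simp: coamoeba_def zero_locus_def)
  define x :: "real ^ 'n" where "x = (\<chi> i. ln (norm (z $ i)))"
  have "z $ i = exp (Complex (x $ i) (\<theta> $ i))" for i
  proof -
    have "abs_circle (\<theta> $ i) = abs_circle (Arg (z $ i))"
      using z(1) by (simp add: torus_proj_def Arg_vec_def vec_eq_iff)
    then have "cis (\<theta> $ i) = cis (Arg (z $ i))" by (simp only: abs_circle_eq_iff_cis)
    then have "exp (Complex (x $ i) (\<theta> $ i)) = of_real (norm (z $ i)) * cis (Arg (z $ i))"
      unfolding exp_Complex using z(2)[of i] by (simp add: x_def)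
    then show ?thesis by (metis rcis_cmod_Arg rcis_def)
  qed
  then have "(\<Sum>p\<in>A. c p * exp (Complex (of_int_vec p \<bullet> x) (of_int_vec p \<bullet> \<theta>))) = 0"
    using z(3) by (simp add: laurent_poly_def monomial_exp)
  then show "\<theta> \<in> zero_args A of_int_vec c" by (auto simp: zero_args_def)
next
  assume "\<theta> \<in> zero_args A of_int_vec c"
  then obtain x where x: "(\<Sum>p\<in>A. c p * exp (Complex (of_int_vec p \<bullet> x) (of_int_vec p \<bullet> \<theta>))) = 0"
    by (auto simp: zero_args_def)
  define z :: "complex ^ 'n" where "z = (\<chi> i. exp (Complex (x $ i) (\<theta> $ i)))"
  have "z \<in> zero_locus (laurent_poly A c)"
    using x by (simp add: zero_locus_def laurent_poly_def z_def monomial_exp)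
  moreover have "Arg_vec z = torus_proj \<theta>"
  proof -
    have "cis (Arg (z $ i)) = cis (\<theta> $ i)" for i
    proof -
      have "cis (Arg (z $ i)) = sgn (of_real (exp (x $ i)) * cis (\<theta> $ i))"
        by (subst cis_Arg) (simp_all add: z_def exp_Complex)
      also have "\<dots> = cis (\<theta> $ i)" by (simp add: sgn_mult sgn_of_real sgn_div_norm[of "cis _"])
      finally show ?thesis .
    qed
    then have "abs_circle (Arg (z $ i)) = abs_circle (\<theta> $ i)" for i by (simp only: abs_circle_eq_iff_cis)
    then show ?thesis by (simp add: Arg_vec_def torus_proj_def)
  qed
  ultimately show "torus_proj \<theta> \<in> coamoeba (laurent_poly A c)" unfolding coamoeba_def by (metis imageI)
qed

lemma torus_proj_in_closure_coamoeba_iff: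
  fixes \<theta> :: "real ^ 'n"
  shows "torus_proj \<theta> \<in> closure (coamoeba (laurent_poly A c)) \<longleftrightarrow> \<theta> \<in> closure (zero_args A of_int_vec c)"
proof -
  have "torus_proj -` coamoeba (laurent_poly A c) = (zero_args A of_int_vec c :: (real ^ 'n) set)"
    using torus_proj_in_coamoeba_iff by blast
  then show ?thesis using torus_proj_vimage_closure[of "coamoeba (laurent_poly A c)"] by auto
qed

text \<open>Translation by the period \<open>t\<close> changes the phase of the term
  \<open>p\<close> by 2 pi times an integer, which the lift absorbs.\<close>

lemma lift_phase_shift:
  fixes \<theta> :: "real ^ 'n"
  assumes "m' p = m p + (\<Sum>j\<in>UNIV. p $ j * t $ j) + k"
  shows "lift_phase of_int_vec c m' p \<theta> =
    lift_phase of_int_vec c m p (\<theta> + (2 * pi) *\<^sub>R of_int_vec t) + 2 * pi * of_int k"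
proof -
  have "of_int_vec p \<bullet> (of_int_vec t :: real ^ 'n) = of_int (\<Sum>j\<in>UNIV. p $ j * t $ j)"
    by (simp add: of_int_vec_def inner_vec_def)
  then show ?thesis
    unfolding lift_phase_def phase_def assms by (simp add: inner_add_right distrib_left)
qed

lemma cell_shift:
  fixes \<theta> :: "real ^ 'n"
  assumes "\<And>p. p \<in> A \<Longrightarrow> m' p = m p + (\<Sum>j\<in>UNIV. p $ j * t $ j) + k"
  shows "\<theta> \<in> cell A of_int_vec b c m' \<longleftrightarrow> \<theta> + (2 * pi) *\<^sub>R of_int_vec t \<in> cell A of_int_vec b c m"
proof -
  have "lift_phase of_int_vec c m' p \<theta> =
      lift_phase of_int_vec c m p (\<theta> + (2 * pi) *\<^sub>R of_int_vec t) + 2 * pi * of_int k" if "p \<in> A" for p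
    by (rule lift_phase_shift) (rule assms[OF that])
  then show ?thesis by (simp add: cell_def)
qed

definition component_of_class ::
    "(int ^ 'n) set \<Rightarrow> (int ^ 'n \<Rightarrow> real) \<Rightarrow> (int ^ 'n \<Rightarrow> complex) \<Rightarrow> (int ^ 'n \<Rightarrow> int) \<Rightarrow> (circle ^ 'n) set" where
  "component_of_class A b c m = torus_proj ` (cell A of_int_vec b c m - closure (zero_args A of_int_vec c))"

lemma component_of_class_subset:
  assumes "m' \<in> phase_class A m"
  shows "component_of_class A b c m' \<subseteq> component_of_class A b c m"
proof
  fix x assume "x \<in> component_of_class A b c m'"
  then obtain \<theta> where \<theta>: "x = torus_proj \<theta>" "\<theta> \<in> cell A of_int_vec b c m'" "\<theta> \<notin> closure (zero_args A of_int_vec c)"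
    by (auto simp: component_of_class_def)
  obtain t k where "\<And>p. p \<in> A \<Longrightarrow> m' p = m p + (\<Sum>j\<in>UNIV. p $ j * t $ j) + k"
    using assms by (auto simp: phase_class_def)
  from cell_shift[of A m' m t k, OF this] \<theta>(2)
  have "\<theta> + (2 * pi) *\<^sub>R of_int_vec t \<in> cell A of_int_vec b c m" by blast
  moreover have proj: "torus_proj (\<theta> + (2 * pi) *\<^sub>R of_int_vec t) = torus_proj \<theta>"
    unfolding torus_proj_eq_iff by blast
  moreover have "\<theta> + (2 * pi) *\<^sub>R of_int_vec t \<notin> closure (zero_args A of_int_vec c)"
    using \<theta>(3) proj by (metis torus_proj_in_closure_coamoeba_iff)
  ultimately show "x \<in> component_of_class A b c m" unfolding component_of_class_def \<theta>(1) by (metis DiffI imageI)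
qed

lemma component_of_class_eq:
  assumes "phase_class A m = phase_class A m'"
  shows "component_of_class A b c m = component_of_class A b c m'"
  using component_of_class_subset phase_class_eq_iff assms by (metis subset_antisym)

text \<open>Divided by 2 pi, the condition places \<open>w\<close> in an open interval of length
  \<open>N\<close>. If \<open>w\<close> is not its left end, this is the half-open integer window
  that starts at the ceiling of that end.\<close>

lemma abs_phase_less_iff:
  fixes w N :: int and \<kappa> :: real
  assumes "real_of_int w \<noteq> - (N / 2) - \<kappa> / (2 * pi)"
  shows "\<bar>\<kappa> + 2 * pi * w\<bar> < pi * N \<longleftrightarrow>
    \<lceil>- (N / 2) - \<kappa> / (2 * pi)\<rceil> \<le> w \<and> w < \<lceil>- (N / 2) - \<kappa> / (2 * pi)\<rceil> + N"
proof -
  define \<sigma> where "\<sigma> = - (N / 2) - \<kappa> / (2 * pi)"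
  have "\<kappa> + 2 * pi * w = 2 * pi * (w - \<sigma>) - pi * N" by (simp add: \<sigma>_def field_simps)
  then have "\<bar>\<kappa> + 2 * pi * w\<bar> < pi * N \<longleftrightarrow> 0 < 2 * pi * (w - \<sigma>) \<and> 2 * pi * (w - \<sigma>) < 2 * pi * N"
    by (auto simp: abs_less_iff)
  also have "\<dots> \<longleftrightarrow> \<sigma> < w \<and> w - \<sigma> < N" by (simp add: zero_less_mult_iff)
  also have "\<dots> \<longleftrightarrow> \<sigma> \<le> w \<and> of_int (w - N) < \<sigma>" using assms unfolding \<sigma>_def[symmetric] by auto
  also have "\<dots> \<longleftrightarrow> \<lceil>\<sigma>\<rceil> \<le> w \<and> w < \<lceil>\<sigma>\<rceil> + N"
    by (simp only: ceiling_le_iff less_ceiling_iff[symmetric] diff_less_eq)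
  finally show ?thesis by (simp only: \<sigma>_def)
qed

context integer_circuit
begin

text \<open>Points with the same projection differ by a period, which is traded for a change of lift
  within the class. Then two cells share a point, and their lifts differ by a constant.\<close>

lemma component_of_class_overlap:
  assumes "component_of_class A b c m \<inter> component_of_class A b c m' \<noteq> {}"
  shows "phase_class A m = phase_class A m'"
proof -
  obtain \<theta> \<theta>' where \<theta>: "\<theta> \<in> cell A of_int_vec b c m"
    "\<theta>' \<in> cell A of_int_vec b c m'" "torus_proj \<theta> = torus_proj \<theta>'"
    using assms by (auto simp: component_of_class_def)
  then obtain t where t: "\<theta> = \<theta>' + (2 * pi) *\<^sub>R of_int_vec t" by (auto simp: torus_proj_eq_iff)
  define m'' where "m'' p = m p + (\<Sum>j\<in>UNIV. p $ j * t $ j) + 0" for p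
  have "\<theta>' \<in> cell A of_int_vec b c m''"
    using cell_shift[of A m'' m t 0 \<theta>'] \<theta>(1) t by (simp add: m''_def)
  from cells_disjoint[OF this \<theta>(2)] obtain k where "\<forall>p\<in>A. m' p = m'' p + k" by blast
  then have "\<forall>p\<in>A. m' p = m p + (\<Sum>j\<in>UNIV. p $ j * t $ j) + k" by (simp add: m''_def)
  then have "m' \<in> phase_class A m" unfolding phase_class_def by blast
  then show ?thesis by (simp add: phase_class_eq_iff)
qed

abbreviation total_phase :: "(int ^ 'n \<Rightarrow> complex) \<Rightarrow> real" where
  "total_phase c \<equiv> (\<Sum>p\<in>A. b p * Arg (c p))"

abbreviation pos_weight :: int where
  "pos_weight \<equiv> (\<Sum>q\<in>{q \<in> A. \<nu> q > 0}. \<nu> q)"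

lemma component_of_class_nonempty_iff:
  assumes c: "\<And>p. p \<in> A \<Longrightarrow> c p \<noteq> 0"
  shows "component_of_class A b c m \<noteq> {} \<longleftrightarrow>
    \<bar>total_phase c + 2 * pi * weight m\<bar> < pi * pos_weight"
proof -
  have "(\<Sum>p\<in>A. b p * (Arg (c p) + 2 * pi * of_int (m p))) = total_phase c + 2 * pi * weight m"
    by (simp add: distrib_left sum.distrib sum_distrib_left mult_ac)
  moreover have "{i \<in> A. b i > 0} = {i \<in> A. \<nu> i > 0}" by auto
  ultimately show ?thesis
    using cell_complement_nonempty_iff[of c m] lopsided_cell_nonempty_iff[of c m] c
    by (simp add: component_of_class_def)
qed

lemma components_complement_coamoeba:
  assumes c: "\<And>p. p \<in> A \<Longrightarrow> c p \<noteq> 0"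
  shows "components (- closure (coamoeba (laurent_poly A c))) =
    component_of_class A b c ` {m. \<bar>total_phase c + 2 * pi * weight m\<bar> < pi * pos_weight}"
    (is "_ = ?C ` ?M")
proof (rule components_open_partition)
  show "\<Union> (?C ` ?M) = - closure (coamoeba (laurent_poly A c))"
  proof (intro equalityI subsetI)
    fix x assume "x \<in> \<Union> (?C ` ?M)"
    then obtain \<theta> where "x = torus_proj \<theta>" "\<theta> \<notin> closure (zero_args A of_int_vec c)"
      by (auto simp: component_of_class_def)
    then show "x \<in> - closure (coamoeba (laurent_poly A c))" by (simp add: torus_proj_in_closure_coamoeba_iff)
  next
    fix x assume x: "x \<in> - closure (coamoeba (laurent_poly A c))"
    obtain \<theta> where \<theta>: "x = torus_proj \<theta>" using surj_torus_proj by (metis surjD)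
    then have "\<theta> \<notin> closure (zero_args A of_int_vec c)" using x by (simp add: torus_proj_in_closure_coamoeba_iff)
    moreover from this obtain m where "\<theta> \<in> cell A of_int_vec b c m"
      using complement_subset_cells[of c \<theta>] c by blast
    ultimately have "x \<in> ?C m" unfolding \<theta> component_of_class_def by blast
    moreover from this have "m \<in> ?M" using component_of_class_nonempty_iff[of c m] c by blast
    ultimately show "x \<in> \<Union> (?C ` ?M)" by blast
  qed
  fix C assume "C \<in> ?C ` ?M"
  then obtain m where m: "m \<in> ?M" "C = ?C m" by blast
  show "open C" unfolding m(2) component_of_class_def
    by (intro open_torus_proj_image open_Diff open_cell closed_closure)
  show "connected C" unfolding m(2) component_of_class_def
    using c by (intro connected_continuous_image continuous_torus_proj connected_cell_complement)
  show "C \<noteq> {}" using m component_of_class_nonempty_iff[of c m] c by blast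
  fix D assume "D \<in> ?C ` ?M" "C \<inter> D \<noteq> {}"
  then obtain m' where "D = ?C m'" "?C m \<inter> ?C m' \<noteq> {}" using m(2) by blast
  then show "C = D" using m(2) component_of_class_eq[OF component_of_class_overlap] by blast
qed

lemma card_components_complement_coamoeba:
  assumes c: "\<And>p. p \<in> A \<Longrightarrow> c p \<noteq> 0"
    and generic: "cis (total_phase c) \<noteq> cis (pi * pos_weight)"
  shows "real (card (components (- closure (coamoeba (laurent_poly A c))))) =
    fact CARD('n) * measure lebesgue (convex hull (of_int_vec ` A) :: (real ^ 'n) set)"
proof -
  let ?M = "{m. \<bar>total_phase c + 2 * pi * weight m\<bar> < pi * pos_weight}"
  \<comment> \<open>The left end of the interval of admissible weights. It is an integer only if the
    total phase is congruent to \<open>pi * pos_weight\<close> modulo 2 pi, which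
    \<open>generic\<close> excludes.\<close>
  define \<sigma> where "\<sigma> = - (pos_weight / 2) - total_phase c / (2 * pi)"
  have ne: "real_of_int w \<noteq> \<sigma>" for w
  proof
    assume "real_of_int w = \<sigma>"
    then have "2 * pi * real_of_int w = 2 * pi * \<sigma>" by simp
    also have "\<dots> = - (pi * pos_weight) - total_phase c" by (simp add: \<sigma>_def field_simps)
    finally have eq: "total_phase c = pi * pos_weight + 2 * pi * real_of_int (- w - pos_weight)"
      by (simp add: algebra_simps)
    have "cis (total_phase c) = cis (pi * pos_weight) * cis (2 * pi * real_of_int (- w - pos_weight))"
      unfolding eq cis_mult ..
    also have "cis (2 * pi * real_of_int (- w - pos_weight)) = 1" by (rule cis_multiple_2pi) (rule Ints_of_int)
    finally show False using generic by simp
  qed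
  have "\<bar>total_phase c + 2 * pi * w\<bar> < pi * pos_weight \<longleftrightarrow> \<lceil>\<sigma>\<rceil> \<le> w \<and> w < \<lceil>\<sigma>\<rceil> + pos_weight" for w :: int
    using ne unfolding \<sigma>_def by (intro abs_phase_less_iff)
  then have M: "?M = {m. \<lceil>\<sigma>\<rceil> \<le> weight m \<and> weight m < \<lceil>\<sigma>\<rceil> + pos_weight}" by blast
  have "card (components (- closure (coamoeba (laurent_poly A c)))) =
      card (component_of_class A b c ` ?M)"
    using components_complement_coamoeba[of c] c by simp
  also have "\<dots> = card (phase_class A ` ?M)"
  proof (rule card_image_cong_kernel)
    fix m m' assume "m \<in> ?M" "m' \<in> ?M"
    then have "component_of_class A b c m \<noteq> {}"
      using component_of_class_nonempty_iff[of c m] c by blast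
    then show "component_of_class A b c m = component_of_class A b c m'
        \<longleftrightarrow> phase_class A m = phase_class A m'"
      using component_of_class_overlap[of c m m'] component_of_class_eq[of A m m'] by auto
  qed
  finally show ?thesis unfolding M using card_phase_classes[of "\<lceil>\<sigma>\<rceil>"] by simp
qed

section \<open>Genericity of the coefficients\<close>

text \<open>The value of \<open>cis (total_phase c)\<close> for nonzero coefficients, written
  without \<open>Arg\<close>, whose jump along the negative axis would hide the continuity in
  \<open>c\<close>.\<close>

definition phase_product :: "(int ^ 'n \<Rightarrow> complex) \<Rightarrow> complex" where
  "phase_product c = (\<Prod>p\<in>A. sgn (c p) powi \<nu> p)"

lemma cis_sum: "finite I \<Longrightarrow> cis (\<Sum>i\<in>I. f i) = (\<Prod>i\<in>I. cis (f i))"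
  by (induction I rule: finite_induct) (simp_all add: cis_mult[symmetric])

lemma phase_product_eq:
  assumes "\<And>p. p \<in> A \<Longrightarrow> c p \<noteq> 0"
  shows "phase_product c = cis (total_phase c)"
  unfolding phase_product_def cis_sum[OF finite_support]
  by (intro prod.cong refl) (simp add: cis_Arg[OF assms, symmetric] cis_power_int)

lemma continuous_map_phase_product:
  "continuous_map (coeff_space A) euclidean phase_product"
proof -
  have factor: "continuous_map (coeff_space A) euclidean (\<lambda>c. sgn (c p) powi \<nu> p)" if "p \<in> A" for p
  proof -
    have "continuous_map (coeff_space A) (top_of_set (- {0})) (\<lambda>c. c p)"
      unfolding coeff_space_def using that by (rule continuous_map_product_projection)
    moreover have "continuous_map (top_of_set (- {0})) euclidean (\<lambda>z :: complex. sgn z powi \<nu> p)"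
      by (auto intro!: continuous_intros simp: sgn_zero_iff)
    ultimately have "continuous_map (coeff_space A) euclidean ((\<lambda>z :: complex. sgn z powi \<nu> p) \<circ> (\<lambda>c. c p))"
      by (rule continuous_map_compose)
    then show ?thesis by (simp add: o_def)
  qed
  have "continuous_map (coeff_space A) euclidean (\<lambda>c. \<Prod>p\<in>I. sgn (c p) powi \<nu> p)" if "finite I" "I \<subseteq> A" for I
    using that
  proof (induction I rule: finite_induct)
    case (insert p I)
    have "continuous_map (coeff_space A) (prod_topology euclidean euclidean)
        (\<lambda>c. (sgn (c p) powi \<nu> p, \<Prod>p\<in>I. sgn (c p) powi \<nu> p))"
      using insert by (intro continuous_map_pairedI factor) auto
    moreover have "continuous_map (prod_topology euclidean euclidean) euclidean (\<lambda>(u, v). u * v :: complex)"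
      by (auto simp: case_prod_unfold intro!: continuous_intros)
    ultimately have "continuous_map (coeff_space A) euclidean
        ((\<lambda>(u, v). u * v) \<circ> (\<lambda>c. (sgn (c p) powi \<nu> p, \<Prod>p\<in>I. sgn (c p) powi \<nu> p)))"
      by (rule continuous_map_compose)
    then show ?case using insert.hyps by (simp add: o_def)
  qed simp
  from this[OF finite_support order_refl] show ?thesis by (simp add: phase_product_def[abs_def])
qed

lemma topspace_coeff_space: "topspace (coeff_space A) = (A \<rightarrow>\<^sub>E - {0})"
  by (simp add: coeff_space_def)

text \<open>Rotating the coefficient of one \<open>q\<close> with \<open>\<nu> q > 0\<close> by
  \<open>t\<close> multiplies the product by \<open>cis (\<nu> q * t)\<close>, so arbitrarily small
  rotations leave the exceptional value.\<close>

lemma dense_phase_product_ne: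
  assumes "c \<in> topspace (coeff_space A)" "openin (coeff_space A) V" "c \<in> V"
  shows "\<exists>d\<in>V. phase_product d \<noteq> w"
proof (cases "phase_product c = w")
  case False
  then show ?thesis using assms by blast
next
  case True
  have c: "c \<in> extensional A" "\<And>p. p \<in> A \<Longrightarrow> c p \<noteq> 0"
    using assms(1) by (auto simp: topspace_coeff_space PiE_iff)
  obtain q where q: "q \<in> A" "\<nu> q > 0" using two_pos by blast
  define h where "h t = c(q := c q * cis t)" for t
  have "continuous_map euclideanreal (coeff_space A) h"
    unfolding coeff_space_def continuous_map_componentwise
  proof (intro conjI ballI)
    show "h ` topspace euclideanreal \<subseteq> extensional A" using c(1) q(1) by (auto simp: h_def extensional_def)
    fix p assume "p \<in> A"
    then show "continuous_map euclideanreal (top_of_set (- {0})) (\<lambda>t. h t p)"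
      using c(2) by (cases "p = q") (auto simp: h_def continuous_map_in_subtopology intro!: continuous_intros)
  qed
  from openin_continuous_map_preimage[OF this assms(2)]
  have "open {t. h t \<in> V}" by simp
  moreover have "h 0 = c" by (simp add: h_def)
  ultimately obtain e where e: "e > 0" "\<And>t. \<bar>t\<bar> < e \<Longrightarrow> h t \<in> V"
    using assms(3) unfolding open_dist by (auto simp: dist_real_def)
  \<comment> \<open>The bound \<open>e / 2\<close> keeps the rotated coefficients in
    \<open>V\<close>; \<open>pi / \<nu> q\<close> keeps \<open>\<nu> q * t\<close> in (0, pi], where
    \<open>cis\<close> is not 1.\<close>
  define t where "t = min (e / 2) (pi / \<nu> q)"
  have "t > 0" using e(1) q(2) by (simp add: t_def)
  moreover have "t \<le> e / 2" "t \<le> pi / \<nu> q" unfolding t_def by (rule min.cobounded1, rule min.cobounded2)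
  ultimately have t: "t > 0" "\<bar>t\<bar> < e" "\<nu> q * t \<le> pi"
    using e(1) q(2) by (simp_all add: pos_le_divide_eq mult.commute)
  have "phase_product (h t) = cis (\<nu> q * t) * phase_product c"
  proof -
    have "(\<Prod>p\<in>A - {q}. sgn (h t p) powi \<nu> p) = (\<Prod>p\<in>A - {q}. sgn (c p) powi \<nu> p)"
      by (intro prod.cong) (auto simp: h_def)
    moreover have "sgn (h t q) powi \<nu> q = sgn (c q) powi \<nu> q * cis (\<nu> q * t)"
      by (simp add: h_def sgn_mult sgn_div_norm[of "cis t"] power_int_mult_distrib cis_power_int)
    ultimately show ?thesis
      using finite_support q(1) by (simp add: phase_product_def prod.remove[of A q])
  qed
  moreover have "cis (\<nu> q * t) \<noteq> 1"
  proof
    assume "cis (\<nu> q * t) = 1"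
    then have "cos (\<nu> q * t) = cos 0" by (simp add: complex_eq_iff)
    moreover have "0 < \<nu> q * t" using t(1) q(2) by simp
    ultimately show False using cos_inj_pi[of "\<nu> q * t" 0] t(3) by auto
  qed
  moreover have "phase_product c \<noteq> 0" using phase_product_eq[of c] c(2) by simp
  ultimately have "phase_product (h t) \<noteq> w" using True by simp
  then show ?thesis using e(2)[OF t(2)] by blast
qed

theorem generically_card_components:
  "generically A (\<lambda>c. real (card (components (- closure (coamoeba (laurent_poly A c))))) =
    fact CARD('n) * measure lebesgue (convex hull (of_int_vec ` A) :: (real ^ 'n) set))"
  unfolding generically_def
proof (intro exI conjI ballI)
  define U where "U = {c \<in> topspace (coeff_space A). phase_product c \<in> - {cis (pi * pos_weight)}}"
  show "openin (coeff_space A) U"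
    unfolding U_def by (rule openin_continuous_map_preimage[OF continuous_map_phase_product]) auto
  show "coeff_space A closure_of U = topspace (coeff_space A)"
  proof (intro equalityI closure_of_subset_topspace subsetI)
    fix c assume c: "c \<in> topspace (coeff_space A)"
    show "c \<in> coeff_space A closure_of U"
      unfolding in_closure_of
    proof (intro conjI allI impI c)
      fix T assume T: "c \<in> T \<and> openin (coeff_space A) T"
      then obtain d where "d \<in> T" "phase_product d \<noteq> cis (pi * pos_weight)"
        using dense_phase_product_ne[OF c] by blast
      moreover have "d \<in> topspace (coeff_space A)" using T \<open>d \<in> T\<close> openin_subset by blast
      ultimately show "\<exists>y. y \<in> U \<and> y \<in> T" by (auto simp: U_def)
    qed
  qed
  fix c assume "c \<in> U"
  then have c: "\<And>p. p \<in> A \<Longrightarrow> c p \<noteq> 0" "phase_product c \<noteq> cis (pi * pos_weight)"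
    by (auto simp: U_def topspace_coeff_space PiE_iff)
  then show "real (card (components (- closure (coamoeba (laurent_poly A c))))) =
    fact CARD('n) * measure lebesgue (convex hull (of_int_vec ` A) :: (real ^ 'n) set)"
    using phase_product_eq[of c] by (intro card_components_complement_coamoeba) auto
qed

end

theorem corollary5p3:
  fixes \<Delta> :: "(real ^ 'n) set" and A :: "(int ^ 'n) set"
  assumes "lattice_polytope \<Delta>"
    and "aff_dim \<Delta> = int CARD('n)"
    and "card (vertices \<Delta>) = CARD('n) + 2"
    and "of_int_vec ` A = vertices \<Delta>"
  shows "generically A (\<lambda>c.
    real (card (components (- closure (coamoeba (laurent_poly A c))))) =
      fact CARD('n) * measure lebesgue \<Delta>)"
proof -
  let ?v = "of_int_vec :: int ^ 'n \<Rightarrow> real ^ 'n"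
  have hull: "convex hull (?v ` A) = \<Delta>"
    using newton_polytope_vertices(1)[OF assms(1,4)] by (simp add: newton_polytope_def)
  have inj: "inj_on ?v A" using inj_of_int_vec inj_on_subset by blast
  have card_A: "card A = CARD('n) + 2" using card_image[OF inj] assms(3,4) by simp
  then have fin: "finite A" by (intro card_ge_0_finite) simp
  have full: "affine hull (?v ` A) = UNIV"
    using assms(2) aff_dim_convex_hull[of "?v ` A"] aff_dim_eq_full[of "?v ` A"] by (simp add: hull)
  obtain \<nu> where \<nu>: "(\<Sum>p\<in>A. \<nu> p) = 0" "(\<Sum>p\<in>A. real_of_int (\<nu> p) *\<^sub>R ?v p) = 0" "\<exists>p\<in>A. \<nu> p \<noteq> 0"
    using exists_integer_affine_relation[OF fin card_A full] by blast
  \<comment> \<open>Removing an extreme point leaves a convex set, which therefore contains the hull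
    of the other vertices.\<close>
  have vert: "?v p \<notin> convex hull (?v ` (A - {p}))" if "p \<in> A" for p
  proof -
    have "?v p extreme_point_of \<Delta>" using that assms(4) by (auto simp: vertices_def)
    then have "convex (\<Delta> - {?v p})"
      using extreme_point_of_stillconvex[of \<Delta>] hull convex_convex_hull by metis
    moreover have "?v ` (A - {p}) \<subseteq> \<Delta> - {?v p}"
      using hull_inc[of _ "?v ` A" convex] inj that by (auto simp: hull inj_on_eq_iff)
    ultimately have "convex hull (?v ` (A - {p})) \<subseteq> \<Delta> - {?v p}" by (intro hull_minimal)
    then show ?thesis by blast
  qed
  have real_sum: "(\<Sum>p\<in>A. real_of_int (\<nu> p)) = 0" using \<nu>(1) by (metis of_int_0 of_int_sum)
  interpret integer_circuit A \<nu>
  proof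
    show "\<exists>j\<in>A. j \<noteq> i \<and> \<nu> j > 0" for i
      using exists_two_positive[OF fin inj real_sum \<nu>(2) _ vert, of i] \<nu>(3) by auto
    \<comment> \<open>The opposite relation yields the two negative coefficients.\<close>
    have "(\<Sum>p\<in>A. - real_of_int (\<nu> p)) = 0" "(\<Sum>p\<in>A. (- real_of_int (\<nu> p)) *\<^sub>R ?v p) = 0"
      using real_sum \<nu>(2) by (simp_all add: sum_negf)
    from exists_two_positive[OF fin inj this _ vert]
    show "\<exists>j\<in>A. j \<noteq> i \<and> \<nu> j < 0" for i using \<nu>(3) by auto
  qed (use fin card_A full \<nu> in auto)
  show ?thesis using generically_card_components unfolding hull .
qed

end
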